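(* Let $X$ be a Hausdorff sequentially complete locally convex space over $\mathbb{C}$, let $n\in\mathbb{N}$, let $q_0,q_1,\dots,q_n$ be non-negative integers with $q_0=0$ and $0<q_1\le q_2\le\cdots\le q_n$, and let $A_0,A_1,\dots,A_{n-1},A_n=:B$ be closed linear operators acting on $X$. Suppose that $C\in L(X)$ is injective, $CA_i\subseteq A_iC$ for $0\le i\le n$, $0<\zeta\le 2$, $\phi\in(-\pi,\pi]$, $\theta\in(\pi-\pi\zeta,\ \pi-(\pi\zeta)/2)$, $a>r>0$, and that $\nu'$ satisfies $$-\infty<\nu'<\min_{0\le\omega\le q_n-1}\Bigl[-\Bigl(q_n-1-\omega+\max\bigl\{q_j : j\in\{0,1,\dots,n\}\setminus S_\omega\bigr\}\Bigr)\Bigr],$$ where $S_\omega:=\{j\in\{0,1,\dots,n\} : q_j-1\ge\omega\}$. Assume, further, that the following holds: (i) The operator family $\{(1+|\lambda|)^{-\nu'}P_{\lambda^{1/\zeta}}^{-1}C : \lambda\in e^{i\phi}\Sigma_{(\zeta\pi/2)+\theta},\ |\lambda|\ge r\}\subseteq L(X)$ is both equicontinuous and strongly continuous. (ii) For every $x\in X$ and $i\in\{0,1,\dots,n-1\}$, the mapping $\lambda\mapsto A_iP_{\lambda^{1/\zeta}}^{-1}Cx$, $\lambda\in e^{i\phi}\Sigma_{(\zeta\pi/2)+\theta}$, $|\lambda|\ge r$, is continuous and there exists $v_i\in\mathbb{N}$ such that the operator family $\{(1+|\lambda|)^{-v_i}A_iP_{\lambda^{1/\zeta}}^{-1}C :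 \lambda\in e^{i\phi}\Sigma_{(\zeta\pi/2)+\theta},\ |\lambda|\ge r\}\subseteq L(X)$ is equicontinuous. Denote by $\mathfrak{W}$ (respectively, $\mathfrak{W}_e$) the subspace of $X^{q_n}$ if $\zeta\in(0,1]$, resp. of $X^{2q_n}$ if $\zeta\in(1,2]$, consisting of all initial values $(u_0,\dots,u_{q_n-1})\in X^{q_n}$, resp. $(u_0,\dots,u_{q_n-1};v_0,\dots,v_{q_n-1})\in X^{2q_n}$, for which there exists an analytical solution $u(\cdot)$ on the region $\mathbb{C}\setminus(-\infty,0]$ (respectively, an entire solution $u(\cdot)$) of the degenerate multi-term Cauchy problem $$\sum_{i=0}^{n}A_i(\mathbf{D}_t^{\zeta})^{q_i}u(t)=0,\quad t\ge 0,$$ with these initial values. Then $\mathfrak{W}$ is dense in $\bigl(C(\bigcap_{j=0}^nD(A_j))\bigr)^{q_n}$ for the topology of $X^{q_n}$, provided that $0<\zeta<1$, resp. in $\bigl(C(\bigcap_{j=0}^nD(A_j))\bigr)^{2q_n}$ for the topology of $X^{2q_n}$, provided that $1<\zeta<2$; furthermore, $\mathfrak{W}_e$ is dense in $\bigl(C(\bigcap_{j=0}^nD(A_j))\bigr)^{q_n}$ for the topology of $X^{q_n}$, provided that $\zeta=1$, resp. in $\bigl(C(\bigcap_{j=0}^nD(A_j))\bigr)^{2q_n}$ for the topology of $X^{2q_n}$, provided that $\zeta=2$.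
   Context: $L(X)$ is the space of continuous linear maps $X\to X$; $D(A)$ is the domain of $A$. For $\vartheta\in(0,\pi]$, $\Sigma_{\vartheta}:=\{\lambda\in\mathbb{C}:\lambda\ne0,\ |\arg\lambda|<\vartheta\}$. Analyticity of an $X$-valued function means local expansion in uniformly convergent power series. Operator pencil: $P_\lambda:=\lambda^{q_n\zeta}B+\sum_{i=0}^{n-1}\lambda^{q_i\zeta}A_i$ for $\lambda\in\mathbb{C}\setminus\{0\}$, and correspondingly $P_{\lambda^{1/\zeta}}=\lambda^{q_n}B+\sum_{i=0}^{n-1}\lambda^{q_i}A_i$ for $\lambda\neq 0$, with domain $\bigcap_{j=0}^nD(A_j)$. Writing $P_{\lambda^{1/\zeta}}^{-1}C\in L(X)$ presupposes that $P_{\lambda^{1/\zeta}}$ is injective and $R(C)\subseteq R(P_{\lambda^{1/\zeta}})$. Caputo derivative: $g_\beta(t):=t^{\beta-1}/\Gamma(\beta)$ for $\beta>0$, $t>0$; $g_0$ is the Dirac delta; $(f*g)(t)=\int_0^tf(t-s)g(s)\,ds$. For $\zeta>0$, $\mathbf{D}_t^\zeta u$ is defined for those $u\in C^{\lceil\zeta\rceil-1}([0,\infty):X)$ for which $g_{\lceil\zeta\rceil-\zeta}*\bigl(u-\sum_{j=0}^{\lceil\zeta\rceil-1}u^{(j)}(0)g_{j+1}\bigr)\in C^{\lceil\zeta\rceil}([0,\infty):X)$, by $$\mathbf{D}_t^\zeta u(t):=\frac{d^{\lceil\zeta\rceil}}{dt^{\lceil\zeta\rceil}}\Bigl[g_{\lceil\zeta\rceil-\zeta}*\Bigl(u-\sum_{j=0}^{\lceil\zeta\rceil-1}u^{(j)}(0)g_{j+1}\Bigr)\Bigr].$$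 $(\mathbf{D}_t^\zeta)^p$ denotes the $p$-fold iterate (identity if $p=0$). Initial conditions: if $\zeta\in(0,1]$, $\bigl((\mathbf{D}_t^\zeta)^ju(t)\bigr)_{t=0}=u_j$ for $0\le j\le q_n-1$; if $\zeta\in(1,2]$, $\bigl((\mathbf{D}_t^\zeta)^ju(t)\bigr)_{t=0}=u_j$ and $\bigl(\frac{d}{dt}(\mathbf{D}_t^\zeta)^ju(t)\bigr)_{t=0}=v_j$ for $0\le j\le q_n-1$. Solutions of the Cauchy problem: - A function $u\in C([0,\infty):X)$ is a strong solution iff each term $A_i(\mathbf{D}_t^\zeta)^{q_i}u(t)$ ($0\le i\le n$) is well defined and continuous for $t\ge0$, and the equation together with the initial conditions holds on $[0,\infty)$. - $u$ is an entire solution iff it is a strong solution, $u$ can be analytically extended to the whole complex plane, and each of the terms $A_iu^{(p)}(\cdot)$ ($0\le i\le n$, $p\in\mathbb{N}_0$) can be analytically extended to the whole complex plane. - $u$ is an analytical solution on the region $\mathbb{C}\setminus(-\infty,0]$ iff it is a strong solution, $u$ can be extended to the whole complex plane, analytically on $\mathbb{C}\setminus(-\infty,0]$ and continuously on $\mathbb{C}\setminus(-\infty,0)$, and each of the terms $A_i(\mathbf{D}_t^\zeta)^pu(t)$ ($0\le i\le n$, $p\in\mathbb{N}_0$, $t\ge0$) is well defined and can be extended to the whole complex plane, analytically on $\mathbb{C}\setminus(-\infty,0]$ and continuously on $\mathbb{C}\setminus(-\infty,0)$. "$\mathfrak{W}$ is dense in $Y$ for the topology of $X^k$" means that the closure of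 $\mathfrak{W}$ in $X^k$ contains $Y$ ($\mathfrak{W}$ need not be contained in $Y$). *)

theory Defs
  imports "HOL-Analysis.Analysis"
begin

section \<open>Sequentially complete locally convex spaces over the complex numbers\<close>

class scaleC = scaleR +
  fixes scaleC :: "complex \<Rightarrow> 'a \<Rightarrow> 'a"  (infixr \<open>*\<^sub>C\<close> 75)
  assumes scaleR_scaleC: "r *\<^sub>R x = complex_of_real r *\<^sub>C x"

class complex_vector = scaleC + ab_group_add +
  assumes scaleC_add_right: "a *\<^sub>C (x + y) = a *\<^sub>C x + a *\<^sub>C y"
    and scaleC_add_left: "(a + b) *\<^sub>C x = a *\<^sub>C x + b *\<^sub>C x"
    and scaleC_scaleC: "a *\<^sub>C (b *\<^sub>C x) = (a * b) *\<^sub>C x"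
    and scaleC_one: "1 *\<^sub>C x = x"

subclass (in complex_vector) real_vector
  by standard
    (simp_all add: scaleR_scaleC scaleC_add_right scaleC_add_left scaleC_scaleC scaleC_one)

class complex_topological_vector = complex_vector + topological_ab_group_add +
  assumes tendsto_scaleC_Pair:
    "filterlim (\<lambda>p. fst p *\<^sub>C snd p) (nhds (c *\<^sub>C x)) (nhds c \<times>\<^sub>F nhds x)"

text \<open>The convexity of \<open>V\<close> is unfolded here, since \<^const>\<open>convex\<close> cannot be used in a class declaration.\<close>

class complex_locally_convex = complex_topological_vector +
  assumes convex_neighbourhood_base:
    "open U \<Longrightarrow> 0 \<in> U \<Longrightarrow> \<exists>V. open V \<and> 0 \<in> V \<and> V \<subseteq> U \<and>
       (\<forall>x\<in>V. \<forall>y\<in>V. \<forall>u\<ge>0. \<forall>v\<ge>0. u + v = 1 \<longrightarrow> u *\<^sub>R x + v *\<^sub>R y \<in> V)"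

text \<open>Cauchy sequences are those of the uniformity given by the neighbourhoods of the origin.\<close>

class complex_sclcs = complex_locally_convex + t2_space +
  assumes sequentially_complete:
    "(\<forall>U. open U \<and> 0 \<in> U \<longrightarrow> (\<exists>N. \<forall>j\<ge>N. \<forall>k\<ge>N. s j - s k \<in> U)) \<Longrightarrow> \<exists>l. s \<longlonglongrightarrow> l"


section \<open>Linear operators\<close>

definition bounded_ops :: "('a::complex_sclcs \<Rightarrow> 'a) set" where
  "bounded_ops = {T. Vector_Spaces.linear (*\<^sub>C) (*\<^sub>C) T \<and> continuous_on UNIV T}"

text \<open>An unbounded operator is given by its domain \<open>D\<close> and a total function \<open>A\<close>, of which only the
  values on \<open>D\<close> matter.\<close>

definition closed_linear_operator :: "'a::complex_sclcs set \<Rightarrow> ('a \<Rightarrow> 'a) \<Rightarrow> bool" where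
  "closed_linear_operator D A \<longleftrightarrow>
     module.subspace (*\<^sub>C) D \<and>
     (\<forall>x\<in>D. \<forall>y\<in>D. A (x + y) = A x + A y) \<and>
     (\<forall>c. \<forall>x\<in>D. A (c *\<^sub>C x) = c *\<^sub>C A x) \<and>
     closed ((\<lambda>x. (x, A x)) ` D)"

text \<open>Equicontinuity of a family of linear maps, tested at the origin.\<close>

definition equicontinuous_family :: "('a::complex_sclcs \<Rightarrow> 'a) set \<Rightarrow> bool" where
  "equicontinuous_family F \<longleftrightarrow>
     (\<forall>U. open U \<and> 0 \<in> U \<longrightarrow> (\<exists>V. open V \<and> 0 \<in> V \<and> (\<forall>T\<in>F. T ` V \<subseteq> U)))"


section \<open>The operator pencil\<close>

text \<open>\<open>pencil n q A z\<close>, on the domain \<open>pencil_dom n D\<close>, is the operator written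
  $P_{\lambda^{1/\zeta}}$ for $\lambda =$ \<open>z\<close>, with $B = A_n$; it does not depend on $\zeta$.\<close>

definition pencil_dom :: "nat \<Rightarrow> (nat \<Rightarrow> 'a::complex_sclcs set) \<Rightarrow> 'a set" where
  "pencil_dom n D = (\<Inter>j\<in>{0..n}. D j)"

definition pencil ::
    "nat \<Rightarrow> (nat \<Rightarrow> nat) \<Rightarrow> (nat \<Rightarrow> 'a::complex_sclcs \<Rightarrow> 'a) \<Rightarrow> complex \<Rightarrow> 'a \<Rightarrow> 'a" where
  "pencil n q A z x = z ^ q n *\<^sub>C A n x + (\<Sum>i<n. z ^ q i *\<^sub>C A i x)"

definition pencil_inv_defined ::
    "nat \<Rightarrow> (nat \<Rightarrow> nat) \<Rightarrow> (nat \<Rightarrow> 'a::complex_sclcs set) \<Rightarrow> (nat \<Rightarrow> 'a \<Rightarrow> 'a) \<Rightarrow> ('a \<Rightarrow> 'a)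
      \<Rightarrow> complex \<Rightarrow> bool" where
  "pencil_inv_defined n q D A C z \<longleftrightarrow>
     inj_on (pencil n q A z) (pencil_dom n D) \<and> range C \<subseteq> pencil n q A z ` pencil_dom n D"

definition pencil_inv ::
    "nat \<Rightarrow> (nat \<Rightarrow> nat) \<Rightarrow> (nat \<Rightarrow> 'a::complex_sclcs set) \<Rightarrow> (nat \<Rightarrow> 'a \<Rightarrow> 'a) \<Rightarrow> ('a \<Rightarrow> 'a)
      \<Rightarrow> complex \<Rightarrow> 'a \<Rightarrow> 'a" where
  "pencil_inv n q D A C z x = inv_into (pencil_dom n D) (pencil n q A z) (C x)"

definition sector :: "real \<Rightarrow> complex set" where
  "sector \<theta> = {z. z \<noteq> 0 \<and> \<bar>Arg z\<bar> < \<theta>}"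

definition truncated_sector :: "real \<Rightarrow> real \<Rightarrow> real \<Rightarrow> complex set" where
  "truncated_sector \<phi> \<theta> r = {z \<in> (\<lambda>w. exp (\<i> * of_real \<phi>) * w) ` sector \<theta>. norm z \<ge> r}"


section \<open>Calculus for functions with values in a locally convex space\<close>

text \<open>The library versions of these notions are restricted to normed spaces. Functions on
  $[0,\infty)$ are represented by total functions on the reals of which only the values at
  \<open>t \<ge> 0\<close> matter; derivatives at \<open>0\<close> are one-sided.\<close>

definition diff_quot :: "(real \<Rightarrow> 'a::complex_sclcs) \<Rightarrow> real \<Rightarrow> real \<Rightarrow> 'a" where
  "diff_quot f t s = (1 / (s - t)) *\<^sub>R (f s - f t)"

definition vderiv :: "(real \<Rightarrow> 'a::complex_sclcs) \<Rightarrow> real \<Rightarrow> 'a" where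
  "vderiv f t = Lim (at t within {0..}) (diff_quot f t)"

definition C_k :: "nat \<Rightarrow> (real \<Rightarrow> 'a::complex_sclcs) \<Rightarrow> bool" where
  "C_k k f \<longleftrightarrow>
     (\<forall>j<k. \<forall>t\<ge>0. (diff_quot ((vderiv ^^ j) f) t \<longlongrightarrow> (vderiv ^^ Suc j) f t) (at t within {0..})) \<and>
     (\<forall>j\<le>k. continuous_on {0..} ((vderiv ^^ j) f))"

text \<open>The Henstock-Kurzweil integral, with the library's filter of tagged divisions: the Riemann
  integral for continuous integrands, the improper one for an integrable endpoint singularity.\<close>

definition lcs_integral :: "real \<Rightarrow> real \<Rightarrow> (real \<Rightarrow> 'a::complex_sclcs) \<Rightarrow> 'a" where
  "lcs_integral a b f =
     Lim (division_filter (cbox a b)) (\<lambda>p. \<Sum>(x, K)\<in>p. measure lborel K *\<^sub>R f x)"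

text \<open>Local expansion in uniformly convergent power series; to be used with \<open>S\<close> open.\<close>

definition lcs_analytic_on :: "(complex \<Rightarrow> 'a::complex_sclcs) \<Rightarrow> complex set \<Rightarrow> bool" where
  "lcs_analytic_on f S \<longleftrightarrow>
     (\<forall>z\<in>S. \<exists>\<rho>>0. \<exists>c :: nat \<Rightarrow> 'a. \<forall>U. open U \<and> 0 \<in> U \<longrightarrow>
        (\<exists>N. \<forall>m\<ge>N. \<forall>w\<in>ball z \<rho>. f w - (\<Sum>k<m. (w - z) ^ k *\<^sub>C c k) \<in> U))"

definition extends_entire :: "(real \<Rightarrow> 'a::complex_sclcs) \<Rightarrow> bool" where
  "extends_entire f \<longleftrightarrow>
     (\<exists>F. (\<forall>t\<ge>0. F (complex_of_real t) = f t) \<and> lcs_analytic_on F UNIV)"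

definition extends_slit :: "(real \<Rightarrow> 'a::complex_sclcs) \<Rightarrow> bool" where
  "extends_slit f \<longleftrightarrow>
     (\<exists>F. (\<forall>t\<ge>0. F (complex_of_real t) = f t) \<and>
          lcs_analytic_on F (UNIV - complex_of_real ` {..0}) \<and>
          continuous_on (UNIV - complex_of_real ` {..<0}) F)"


section \<open>The Caputo derivative\<close>

text \<open>The value at \<open>0\<close> is the continuous extension if \<open>\<beta> \<ge> 1\<close> (note \<open>0 powr 0 = 0\<close>) and
  immaterial if \<open>\<beta> < 1\<close>.\<close>

definition g_ker :: "real \<Rightarrow> real \<Rightarrow> real" where
  "g_ker \<beta> t = (if t = 0 then (if \<beta> = 1 then 1 else 0) else t powr (\<beta> - 1) / Gamma \<beta>)"

text \<open>Convolution with $g_\beta$, where $g_0$ is the Dirac delta.\<close>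

definition g_conv :: "real \<Rightarrow> (real \<Rightarrow> 'a::complex_sclcs) \<Rightarrow> real \<Rightarrow> 'a" where
  "g_conv \<beta> f t =
     (if \<beta> = 0 then f t else lcs_integral 0 t (\<lambda>s. g_ker \<beta> (t - s) *\<^sub>R f s))"

definition caputo_aux :: "real \<Rightarrow> (real \<Rightarrow> 'a::complex_sclcs) \<Rightarrow> real \<Rightarrow> 'a" where
  "caputo_aux \<zeta> u =
     g_conv (of_int \<lceil>\<zeta>\<rceil> - \<zeta>)
       (\<lambda>t. u t - (\<Sum>j<nat \<lceil>\<zeta>\<rceil>. g_ker (real j + 1) t *\<^sub>R (vderiv ^^ j) u 0))"

definition caputo_defined :: "real \<Rightarrow> (real \<Rightarrow> 'a::complex_sclcs) \<Rightarrow> bool" where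
  "caputo_defined \<zeta> u \<longleftrightarrow> C_k (nat \<lceil>\<zeta>\<rceil> - 1) u \<and> C_k (nat \<lceil>\<zeta>\<rceil>) (caputo_aux \<zeta> u)"

definition caputo :: "real \<Rightarrow> (real \<Rightarrow> 'a::complex_sclcs) \<Rightarrow> real \<Rightarrow> 'a" where
  "caputo \<zeta> u = (vderiv ^^ nat \<lceil>\<zeta>\<rceil>) (caputo_aux \<zeta> u)"

definition caputo_pow_defined :: "real \<Rightarrow> nat \<Rightarrow> (real \<Rightarrow> 'a::complex_sclcs) \<Rightarrow> bool" where
  "caputo_pow_defined \<zeta> p u \<longleftrightarrow> (\<forall>j<p. caputo_defined \<zeta> ((caputo \<zeta> ^^ j) u))"


section \<open>The Cauchy problem\<close>

text \<open>Initial values $(u_0,\dots,u_{q_n-1})$, resp.\ $(u_0,\dots,u_{q_n-1};v_0,\dots,v_{q_n-1})$, are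
  functions \<open>w\<close> with \<open>w j\<close> $= u_j$ and \<open>w (q n + j)\<close> $= v_j$ for \<open>j < q n\<close>.\<close>

definition initial_conditions ::
    "nat \<Rightarrow> real \<Rightarrow> (nat \<Rightarrow> 'a::complex_sclcs) \<Rightarrow> (real \<Rightarrow> 'a) \<Rightarrow> bool" where
  "initial_conditions qn \<zeta> w u \<longleftrightarrow>
     (\<forall>j<qn. (caputo \<zeta> ^^ j) u 0 = w j) \<and>
     (\<zeta> > 1 \<longrightarrow> (\<forall>j<qn. vderiv ((caputo \<zeta> ^^ j) u) 0 = w (qn + j)))"

definition strong_solution ::
    "nat \<Rightarrow> (nat \<Rightarrow> nat) \<Rightarrow> (nat \<Rightarrow> 'a::complex_sclcs set) \<Rightarrow> (nat \<Rightarrow> 'a \<Rightarrow> 'a) \<Rightarrow> real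
      \<Rightarrow> (nat \<Rightarrow> 'a) \<Rightarrow> (real \<Rightarrow> 'a) \<Rightarrow> bool" where
  "strong_solution n q D A \<zeta> w u \<longleftrightarrow>
     continuous_on {0..} u \<and>
     (\<forall>i\<le>n. caputo_pow_defined \<zeta> (q i) u \<and>
             (\<forall>t\<ge>0. (caputo \<zeta> ^^ q i) u t \<in> D i) \<and>
             continuous_on {0..} (\<lambda>t. A i ((caputo \<zeta> ^^ q i) u t))) \<and>
     (\<forall>t\<ge>0. (\<Sum>i\<le>n. A i ((caputo \<zeta> ^^ q i) u t)) = 0) \<and>
     initial_conditions (q n) \<zeta> w u"

definition entire_solution ::
    "nat \<Rightarrow> (nat \<Rightarrow> nat) \<Rightarrow> (nat \<Rightarrow> 'a::complex_sclcs set) \<Rightarrow> (nat \<Rightarrow> 'a \<Rightarrow> 'a) \<Rightarrow> real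
      \<Rightarrow> (nat \<Rightarrow> 'a) \<Rightarrow> (real \<Rightarrow> 'a) \<Rightarrow> bool" where
  "entire_solution n q D A \<zeta> w u \<longleftrightarrow>
     strong_solution n q D A \<zeta> w u \<and>
     extends_entire u \<and>
     (\<forall>i\<le>n. \<forall>p. (\<forall>t\<ge>0. (vderiv ^^ p) u t \<in> D i) \<and>
                  extends_entire (\<lambda>t. A i ((vderiv ^^ p) u t)))"

definition analytical_solution ::
    "nat \<Rightarrow> (nat \<Rightarrow> nat) \<Rightarrow> (nat \<Rightarrow> 'a::complex_sclcs set) \<Rightarrow> (nat \<Rightarrow> 'a \<Rightarrow> 'a) \<Rightarrow> real
      \<Rightarrow> (nat \<Rightarrow> 'a) \<Rightarrow> (real \<Rightarrow> 'a) \<Rightarrow> bool" where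
  "analytical_solution n q D A \<zeta> w u \<longleftrightarrow>
     strong_solution n q D A \<zeta> w u \<and>
     extends_slit u \<and>
     (\<forall>i\<le>n. \<forall>p. caputo_pow_defined \<zeta> p u \<and>
                  (\<forall>t\<ge>0. (caputo \<zeta> ^^ p) u t \<in> D i) \<and>
                  extends_slit (\<lambda>t. A i ((caputo \<zeta> ^^ p) u t)))"

text \<open>$X^k$ is the set of extensional functions on \<open>{..<k}\<close> with the product topology.\<close>

definition power_topology :: "nat \<Rightarrow> (nat \<Rightarrow> 'a::complex_sclcs) topology" where
  "power_topology k = product_topology (\<lambda>_. euclidean) {..<k}"

definition initial_dim :: "real \<Rightarrow> nat \<Rightarrow> nat" where
  "initial_dim \<zeta> qn = (if \<zeta> \<le> 1 then qn else 2 * qn)"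

definition analytical_values ::
    "nat \<Rightarrow> (nat \<Rightarrow> nat) \<Rightarrow> (nat \<Rightarrow> 'a::complex_sclcs set) \<Rightarrow> (nat \<Rightarrow> 'a \<Rightarrow> 'a) \<Rightarrow> real
      \<Rightarrow> (nat \<Rightarrow> 'a) set" where
  "analytical_values n q D A \<zeta> =
     {w \<in> {..<initial_dim \<zeta> (q n)} \<rightarrow>\<^sub>E UNIV. \<exists>u. analytical_solution n q D A \<zeta> w u}"

definition entire_values ::
    "nat \<Rightarrow> (nat \<Rightarrow> nat) \<Rightarrow> (nat \<Rightarrow> 'a::complex_sclcs set) \<Rightarrow> (nat \<Rightarrow> 'a \<Rightarrow> 'a) \<Rightarrow> real
      \<Rightarrow> (nat \<Rightarrow> 'a) set" where
  "entire_values n q D A \<zeta> =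
     {w \<in> {..<initial_dim \<zeta> (q n)} \<rightarrow>\<^sub>E UNIV. \<exists>u. entire_solution n q D A \<zeta> w u}"

text \<open>Density of \<open>W\<close> in \<open>Y\<^sup>k\<close> for the topology of $X^k$, in the sense that the closure of \<open>W\<close>
  contains \<open>Y\<^sup>k\<close>; \<open>W\<close> need not be a subset of \<open>Y\<^sup>k\<close>.\<close>

definition dense_in_power ::
    "nat \<Rightarrow> (nat \<Rightarrow> 'a::complex_sclcs) set \<Rightarrow> 'a set \<Rightarrow> bool" where
  "dense_in_power k W Y \<longleftrightarrow> ({..<k} \<rightarrow>\<^sub>E Y) \<subseteq> power_topology k closure_of W"

end

theory Submission
  imports Defs "HOL-Complex_Analysis.Complex_Analysis"
begin

text \<open>
  A solution is sought as a fractional power series $u(t) = \sum_k t^{\zeta k}/\Gamma(\zeta k+1)\, x_k$,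
  to which $\sum_k t^{\zeta k+1}/\Gamma(\zeta k+2)\, y_k$ is added when $\zeta > 1$. The Caputo
  derivative shifts the coefficient sequences. Hence $u$ solves the equation as soon as both
  sequences satisfy the recurrence $\sum_i A_i x_{k+q_i} = 0$ and the vectors $x_k$, $A_i x_k$ are
  small enough, compared with $\Gamma(\zeta k+1)$, for all the series to converge for every $t$
  (\<open>solution_seq\<close>). The extension to the slit plane, or to the plane if $\zeta$ is an integer, is
  read off the series, and the initial values are the first $q_n$ coefficients
  (\<open>analytical_solution_frac_sol\<close>, \<open>entire_solution_frac_sol\<close>). It remains to find many such sequences.

  They are moments of $Q(\lambda) = P_{\lambda^{1/\zeta}}^{-1}C$. The complement of the sector on
  which $Q$ is controlled has half-angle less than $\zeta\pi/2$. Therefore the sector contains a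
  wedge-shaped contour that encloses the origin, whose opening still allows a weight
  $e(v) = \exp(-v^\gamma)$, with $\gamma > 1/\zeta$, that decays along it. This weight beats the
  growth of the Mittag-Leffler function, which is exactly the required smallness of the coefficients
  (\<open>fast_decay_wedge_integral\<close>). For $x \in \bigcap_j D(A_j)$ and $w < q_n$ take, up to a constant,
  $$x_k = \int e\, \sum_{q_j > w} \lambda^{k+q_j-1-w} Q(\lambda) A_j x \,d\lambda .$$
  Since $P Q = C$, the sum $\sum_i A_i x_{k+q_i}$ is an integral of the weight against polynomials
  in $\lambda$, which vanishes by Cauchy's theorem (\<open>vanishing_moment\<close>, \<open>solution_seq_moment\<close>).

  The initial values of this solution come from $\sum_j \lambda^{q_j} Q(\lambda) A_j x = Cx$: the
  integrand is $\lambda^{k-1-w} Cx$ minus the terms with $q_j \le w$. The first part contributes $Cx$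
  for $k = w$, by a residue (\<open>residue_moment\<close>), and nothing for $k > w$. Now dilate the contour by a
  factor $R \to \infty$. For $k < w$ the first part is $O(R^{k-w})$, and the bound on $\nu'$ says
  precisely that the remaining terms are $O(R^{-\delta})$ with some $\delta > 0$. So the initial
  values tend to $(0,\dots,0,Cx,0,\dots,0)$ (\<open>approximating_solution_seq\<close>), and sums over $w$ reach
  every tuple with entries in $C(\bigcap_j D(A_j))$.

  Because the contour is dilated while the weight stays fixed, Cauchy's theorem is applied to scalar
  functions only. Vector-valued integrals are limits of Riemann sums; they are estimated by
  continuous seminorms and pass through the closed operators $A_i$.
\<close>

section \<open>Continuous seminorms\<close>

lemma scaleR_scaleC_commute: "r *\<^sub>R (c *\<^sub>C x) = c *\<^sub>C (r *\<^sub>R (x::'a::complex_sclcs))"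
  by (simp add: scaleR_scaleC scaleC_scaleC mult.commute)

lemma vector_space_scaleC: "vector_space ((*\<^sub>C) :: complex \<Rightarrow> 'a::complex_sclcs \<Rightarrow> 'a)"
  by unfold_locales (simp_all add: scaleC_add_right scaleC_add_left scaleC_scaleC scaleC_one)

interpretation cvs: vector_space "(*\<^sub>C) :: complex \<Rightarrow> 'a::complex_sclcs \<Rightarrow> 'a"
  by (rule vector_space_scaleC)

lemma tendsto_scaleC:
  fixes g :: "'b \<Rightarrow> 'a::complex_sclcs"
  assumes "(f \<longlongrightarrow> c) F" "(g \<longlongrightarrow> x) F"
  shows "((\<lambda>t. f t *\<^sub>C g t) \<longlongrightarrow> c *\<^sub>C x) F"
  using filterlim_compose[OF tendsto_scaleC_Pair filterlim_Pair[OF assms]] by simp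

lemma tendsto_scaleR':
  fixes g :: "'b \<Rightarrow> 'a::complex_sclcs"
  assumes "(f \<longlongrightarrow> c) F" "(g \<longlongrightarrow> x) F"
  shows "((\<lambda>t. f t *\<^sub>R g t) \<longlongrightarrow> c *\<^sub>R x) F"
  unfolding scaleR_scaleC by (intro tendsto_scaleC tendsto_of_real assms)

text \<open>The bound on a neighbourhood of the origin is equivalent to continuity, by homogeneity.\<close>

definition continuous_seminorm :: "('a::complex_sclcs \<Rightarrow> real) \<Rightarrow> bool" where
  "continuous_seminorm p \<longleftrightarrow>
     (\<forall>x y. p (x + y) \<le> p x + p y) \<and> (\<forall>c x. p (c *\<^sub>C x) = cmod c * p x) \<and>
     (\<exists>V. open V \<and> 0 \<in> V \<and> (\<forall>x\<in>V. p x \<le> 1))"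

lemma seminorm_triangle: "continuous_seminorm p \<Longrightarrow> p (x + y) \<le> p x + p y"
  and seminorm_scaleC: "continuous_seminorm p \<Longrightarrow> p (c *\<^sub>C x) = cmod c * p x"
  by (auto simp: continuous_seminorm_def)

lemma seminorm_scaleR: "continuous_seminorm p \<Longrightarrow> p (r *\<^sub>R x) = \<bar>r\<bar> * p x"
  by (simp add: scaleR_scaleC seminorm_scaleC)

lemma seminorm_0: "continuous_seminorm p \<Longrightarrow> p 0 = 0"
  using seminorm_scaleC[of p 0 0] by simp

lemma seminorm_minus: "continuous_seminorm p \<Longrightarrow> p (- x) = p x"
  using seminorm_scaleR[of p "-1" x] by simp

lemma seminorm_nonneg: "continuous_seminorm p \<Longrightarrow> p x \<ge> 0"
  using seminorm_triangle[of p x "-x"] by (simp add: seminorm_0 seminorm_minus)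

lemma seminorm_diff_le: "continuous_seminorm p \<Longrightarrow> p (x - y) \<le> p x + p y"
  using seminorm_triangle[of p x "-y"] by (simp add: seminorm_minus)

lemma seminorm_diff_commute: "continuous_seminorm p \<Longrightarrow> p (x - y) = p (y - x)"
  using seminorm_minus[of p "x - y"] by simp

lemma seminorm_diff_ge: "continuous_seminorm p \<Longrightarrow> \<bar>p x - p y\<bar> \<le> p (x - y)"
  using seminorm_triangle[of p "x - y" y] seminorm_triangle[of p "y - x" x]
  by (simp add: seminorm_diff_commute[of p x y])

lemma seminorm_sum: "continuous_seminorm p \<Longrightarrow> p (\<Sum>i\<in>I. f i) \<le> (\<Sum>i\<in>I. p (f i))"
proof (induction I rule: infinite_finite_induct)
  case (insert i I)
  then show ?case
    using seminorm_triangle[of p "f i" "\<Sum>i\<in>I. f i"] by simp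
qed (simp_all add: seminorm_0)

text \<open>The seminorm is the Minkowski gauge of the balanced core of a convex neighbourhood. The core
  is still a neighbourhood of the origin because scalar multiplication is jointly continuous there.
  It follows that continuous seminorms determine the topology (\<open>tendsto_seminorm\<close>).\<close>

lemma exists_seminorm_subset:
  fixes U :: "'a::complex_sclcs set"
  assumes "open U" "0 \<in> U"
  shows "\<exists>p. continuous_seminorm p \<and> (\<forall>x. p x < 1 \<longrightarrow> x \<in> U)"
proof -
  obtain V where V: "open V" "0 \<in> V" "V \<subseteq> U"
    and V_convex: "\<forall>x\<in>V. \<forall>y\<in>V. \<forall>u\<ge>0. \<forall>v\<ge>0. u + v = 1 \<longrightarrow> u *\<^sub>R x + v *\<^sub>R y \<in> V"
    using convex_neighbourhood_base[OF assms] by (elim exE conjE)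
  have conv: "u *\<^sub>R x + v *\<^sub>R y \<in> V"
    if "x \<in> V" "y \<in> V" "u \<ge> 0" "v \<ge> 0" "u + v = 1" for x y u v
    using V_convex that by simp
  \<comment> \<open>The balanced core of \<open>V\<close>.\<close>
  define W where "W = {x. \<forall>c. cmod c \<le> 1 \<longrightarrow> c *\<^sub>C x \<in> V}"
  have W_conv: "u *\<^sub>R x + v *\<^sub>R y \<in> W" if "x \<in> W" "y \<in> W" "u \<ge> 0" "v \<ge> 0" "u + v = 1" for x y u v
    unfolding W_def
  proof (intro CollectI allI impI)
    fix c :: complex assume c: "cmod c \<le> 1"
    have "u *\<^sub>R (c *\<^sub>C x) + v *\<^sub>R (c *\<^sub>C y) \<in> V"
      using that c by (intro conv) (auto simp: W_def)
    then show "c *\<^sub>C (u *\<^sub>R x + v *\<^sub>R y) \<in> V"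
      by (simp add: scaleC_add_right scaleR_scaleC_commute)
  qed
  have W_bal: "c *\<^sub>C x \<in> W" if "x \<in> W" "cmod c \<le> 1" for x c
    using that by (auto simp: W_def scaleC_scaleC norm_mult mult_le_one)
  have W_V: "W \<subseteq> V"
    unfolding W_def using scaleC_one by (auto dest: spec[of _ 1])
  have "\<forall>\<^sub>F p in nhds (0::complex) \<times>\<^sub>F nhds (0::'a). fst p *\<^sub>C snd p \<in> V"
    using topological_tendstoD[OF tendsto_scaleC_Pair[of "0::complex" "0::'a"] V(1)] V(2) by simp
  then obtain P Q where P: "eventually P (nhds (0::complex))" and Q: "eventually Q (nhds (0::'a))"
    and PQ: "\<And>c x. P c \<Longrightarrow> Q x \<Longrightarrow> c *\<^sub>C x \<in> V"
    unfolding eventually_prod_filter by auto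
  obtain d where d: "d > 0" "\<And>c. cmod c < d \<Longrightarrow> P c"
    using P unfolding eventually_nhds_metric by (auto simp: dist_norm)
  have "((\<lambda>x. (2 / d) *\<^sub>R x) \<longlongrightarrow> (2/d) *\<^sub>R (0::'a)) (nhds 0)"
    by (intro tendsto_scaleR' tendsto_const filterlim_ident)
  then have "\<forall>\<^sub>F x in nhds 0. Q ((2/d) *\<^sub>R (x::'a))"
    using Q by (simp add: filterlim_iff)
  then obtain N where N: "open N" "0 \<in> N" "\<And>x. x \<in> N \<Longrightarrow> Q ((2/d) *\<^sub>R x)"
    unfolding eventually_nhds by blast
  have NW: "x \<in> W" if "x \<in> N" for x
    unfolding W_def
  proof (intro CollectI allI impI)
    fix c :: complex assume c: "cmod c \<le> 1"
    have "P (c * of_real (d/2))"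
    proof (rule d(2))
      have "cmod (c * complex_of_real (d / 2)) = cmod c * (d/2)"
        using d(1) by (simp only: norm_mult norm_of_real)
      also have "\<dots> \<le> 1 * (d/2)"
        using c d(1) by (intro mult_right_mono) auto
      finally show "cmod (c * complex_of_real (d / 2)) < d" using d(1) by simp
    qed
    from PQ[OF this N(3)[OF that]] have "(c * of_real (d/2)) *\<^sub>C of_real (2/d) *\<^sub>C x \<in> V"
      by (simp add: scaleR_scaleC)
    also have "(c * of_real (d/2)) *\<^sub>C of_real (2/d) *\<^sub>C x = c *\<^sub>C x"
      using d(1) by (simp add: scaleC_scaleC)
    finally show "c *\<^sub>C x \<in> V" .
  qed
  define S where "S x = {t. t > 0 \<and> (1/t) *\<^sub>R x \<in> W}" for x
  define p where "p x = Inf (S x)" for x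
  have bdd: "bdd_below (S x)" for x
    by (rule bdd_belowI[of _ 0]) (auto simp: S_def)
  have ne: "S x \<noteq> {}" for x
  proof -
    have "((\<lambda>t. (1/t) *\<^sub>R x) \<longlongrightarrow> 0 *\<^sub>R x) at_top"
      by (intro tendsto_scaleR' tendsto_const tendsto_divide_0[OF tendsto_const]
          filterlim_at_top_imp_at_infinity filterlim_ident)
    then have "\<forall>\<^sub>F t::real in at_top. (1/t) *\<^sub>R x \<in> N"
      using topological_tendstoD[of "\<lambda>t::real. (1/t) *\<^sub>R x" _ at_top N] N(1,2) by simp
    from eventually_conj[OF this eventually_gt_at_top[of 0]]
    have "\<exists>t::real. (1/t) *\<^sub>R x \<in> N \<and> t > 0"
      by (rule eventually_happens'[OF trivial_limit_at_top_linorder])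
    then show ?thesis using NW by (auto simp: S_def)
  qed
  have S_up: "t' \<in> S x" if "t \<in> S x" "t \<le> t'" for t t' x
  proof -
    have "(1/t') *\<^sub>R x = of_real (t/t') *\<^sub>C ((1/t) *\<^sub>R x)"
      using that by (simp add: S_def scaleR_scaleC scaleC_scaleC)
    also have "\<dots> \<in> W"
      using that by (intro W_bal) (auto simp: S_def norm_divide)
    finally show ?thesis using that by (auto simp: S_def)
  qed
  have p_less: "\<exists>t\<in>S x. t < s" if "p x < s" for x s
    using that ne cInf_lessD unfolding p_def by metis
  have p_le: "p x \<le> t" if "t \<in> S x" for x t
    unfolding p_def using that bdd by (rule cInf_lower)
  have tri: "p (x + y) \<le> p x + p y" for x y
  proof (rule field_le_epsilon)
    fix e :: real assume e: "e > 0"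
    obtain s where s: "s \<in> S x" "s < p x + e/2" using p_less[of x "p x + e/2"] e by auto
    obtain t where t: "t \<in> S y" "t < p y + e/2" using p_less[of y "p y + e/2"] e by auto
    have pos: "s > 0" "t > 0" using s t by (auto simp: S_def)
    have "(s/(s+t)) *\<^sub>R ((1/s) *\<^sub>R x) + (t/(s+t)) *\<^sub>R ((1/t) *\<^sub>R y) \<in> W"
      using s t pos by (intro W_conv) (auto simp: S_def simp flip: add_divide_distrib)
    then have "(1/(s+t)) *\<^sub>R (x + y) \<in> W"
      using pos by (simp add: scaleR_add_right)
    then have "s + t \<in> S (x + y)" using pos by (simp add: S_def)
    then show "p (x + y) \<le> p x + p y + e" using p_le s t by fastforce
  qed
  have le: "p (c *\<^sub>C x) \<le> cmod c * p x" if c: "c \<noteq> 0" for c x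
  proof (rule field_le_epsilon)
    fix e :: real assume e: "e > 0"
    obtain s where s: "s \<in> S x" "s < p x + e / cmod c"
      using p_less[of x "p x + e / cmod c"] e c by auto
    have "(1/(cmod c * s)) *\<^sub>R (c *\<^sub>C x) = (c / of_real (cmod c)) *\<^sub>C ((1/s) *\<^sub>R x)"
      using s c by (simp add: S_def scaleR_scaleC scaleC_scaleC)
    also have "\<dots> \<in> W" using s c by (intro W_bal) (auto simp: S_def norm_divide)
    finally have "cmod c * s \<in> S (c *\<^sub>C x)" using s c by (simp add: S_def)
    then have "p (c *\<^sub>C x) \<le> cmod c * s" by (rule p_le)
    also have "\<dots> \<le> cmod c * (p x + e / cmod c)" using s by (intro mult_left_mono) auto
    finally show "p (c *\<^sub>C x) \<le> cmod c * p x + e" using c by (simp add: distrib_left)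
  qed
  have p0: "p 0 = 0"
  proof -
    have "0 \<in> W" using V(2) by (auto simp: W_def)
    then have "S 0 = {0<..}" by (auto simp: S_def)
    then show ?thesis by (simp add: p_def)
  qed
  have eq: "p (c *\<^sub>C x) = cmod c * p x" for c x
  proof (cases "c = 0")
    case False
    have "p x = p (inverse c *\<^sub>C (c *\<^sub>C x))" using False by (simp add: scaleC_scaleC scaleC_one)
    also have "\<dots> \<le> cmod (inverse c) * p (c *\<^sub>C x)" using False by (intro le) simp
    finally have "cmod c * p x \<le> p (c *\<^sub>C x)" using False by (simp add: norm_inverse norm_divide field_simps)
    then show ?thesis using le[OF False, of x] by simp
  qed (simp add: p0)
  have "p x \<le> 1" if "x \<in> N" for x
    using NW[OF that] by (intro p_le) (simp add: S_def)
  then have "continuous_seminorm p"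
    unfolding continuous_seminorm_def using tri eq N(1,2) by blast
  moreover have "x \<in> U" if lt: "p x < 1" for x
  proof -
    obtain t where "t \<in> S x" "t < 1" using p_less[OF lt] by blast
    then have "1 \<in> S x" using S_up[of t x 1] by simp
    then show ?thesis using W_V V(3) by (auto simp: S_def)
  qed
  ultimately show ?thesis by blast
qed

lemma tendsto_seminorm:
  fixes f :: "'b \<Rightarrow> 'a::complex_sclcs"
  shows "(f \<longlongrightarrow> l) F \<longleftrightarrow> (\<forall>p. continuous_seminorm p \<longrightarrow> ((\<lambda>x. p (f x - l)) \<longlongrightarrow> 0) F)"
proof safe
  fix p :: "'a \<Rightarrow> real" assume lim: "(f \<longlongrightarrow> l) F" and p: "continuous_seminorm p"
  obtain V where V: "open V" "0 \<in> V" "\<And>x. x \<in> V \<Longrightarrow> p x \<le> 1"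
    using p unfolding continuous_seminorm_def by blast
  show "((\<lambda>x. p (f x - l)) \<longlongrightarrow> 0) F"
  proof (rule tendstoI)
    fix e :: real assume e: "e > 0"
    have "((\<lambda>x. (2/e) *\<^sub>R (f x - l)) \<longlongrightarrow> (2/e) *\<^sub>R (l - l)) F"
      by (intro tendsto_scaleR' tendsto_const tendsto_diff lim)
    then have "\<forall>\<^sub>F x in F. (2/e) *\<^sub>R (f x - l) \<in> V"
      by (rule topological_tendstoD) (use V in auto)
    then show "\<forall>\<^sub>F x in F. dist (p (f x - l)) 0 < e"
    proof eventually_elim
      case (elim x)
      from V(3)[OF elim] have "(2/e) * p (f x - l) \<le> 1" using e p by (simp add: seminorm_scaleR)
      then have "p (f x - l) \<le> e/2" using e by (simp add: field_simps)
      then show ?case using e seminorm_nonneg[OF p, of "f x - l"] by (simp add: dist_norm)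
    qed
  qed
next
  assume *: "\<forall>p. continuous_seminorm p \<longrightarrow> ((\<lambda>x. p (f x - l)) \<longlongrightarrow> 0) F"
  show "(f \<longlongrightarrow> l) F"
  proof (rule topological_tendstoI)
    fix S assume S: "open S" "l \<in> S"
    have "open ((\<lambda>y. l + y) -` S)"
      by (rule open_vimage[OF S(1)]) (intro continuous_intros)
    then obtain p where p: "continuous_seminorm p" "\<And>x. p x < 1 \<Longrightarrow> l + x \<in> S"
      using exists_seminorm_subset[of "(\<lambda>y. l + y) -` S"] S by auto
    have "((\<lambda>x. p (f x - l)) \<longlongrightarrow> 0) F" using * p(1) by blast
    then have "\<forall>\<^sub>F x in F. p (f x - l) < 1" by (rule order_tendstoD) simp
    then show "\<forall>\<^sub>F x in F. f x \<in> S"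
    proof eventually_elim
      case (elim x)
      from p(2)[OF this] show ?case by simp
    qed
  qed
qed

lemma tendsto_seminorm_compose:
  assumes "continuous_seminorm p" "(f \<longlongrightarrow> l) F"
  shows "((\<lambda>x. p (f x)) \<longlongrightarrow> p l) F"
proof -
  have "((\<lambda>x. p (f x - l)) \<longlongrightarrow> 0) F" using assms tendsto_seminorm by blast
  then have "((\<lambda>x. p (f x) - p l) \<longlongrightarrow> 0) F"
    by (rule Lim_null_comparison[rotated])
       (intro always_eventually allI, simp add: seminorm_diff_ge[OF assms(1)])
  then show ?thesis by (rule LIM_zero_cancel)
qed

text \<open>Sequential completeness in the form in which it is used: the Cauchy condition may be checked
  for one seminorm at a time.\<close>

lemma seminorm_Cauchy_convergent:
  fixes s :: "nat \<Rightarrow> 'a::complex_sclcs"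
  assumes "\<And>p e. continuous_seminorm p \<Longrightarrow> e > 0 \<Longrightarrow> \<exists>N. \<forall>j\<ge>N. \<forall>k\<ge>N. p (s j - s k) < e"
  shows "\<exists>l. s \<longlonglongrightarrow> l"
proof (rule sequentially_complete, intro allI impI)
  fix U :: "'a set" assume "open U \<and> 0 \<in> U"
  then obtain p where p: "continuous_seminorm p" "\<And>x. p x < 1 \<Longrightarrow> x \<in> U"
    using exists_seminorm_subset by blast
  show "\<exists>N. \<forall>j\<ge>N. \<forall>k\<ge>N. s j - s k \<in> U"
    using assms[OF p(1), of 1] p(2) by auto
qed

lemma closed_linear_operator_limit:
  assumes "closed_linear_operator D A" "F \<noteq> bot" "\<And>m. f m \<in> D" "(f \<longlongrightarrow> l) F"
    "((\<lambda>m. A (f m)) \<longlongrightarrow> y) F"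
  shows "l \<in> D \<and> A l = y"
proof -
  have "((\<lambda>m. (f m, A (f m))) \<longlongrightarrow> (l, y)) F"
    by (intro tendsto_Pair assms)
  moreover have "closed ((\<lambda>x. (x, A x)) ` D)"
    using assms(1) by (simp add: closed_linear_operator_def)
  ultimately have "(l, y) \<in> (\<lambda>x. (x, A x)) ` D"
    using assms(2,3) by (intro Lim_in_closed_set[where f="\<lambda>m. (f m, A (f m))" and F=F]) auto
  then show ?thesis by auto
qed

lemma closed_linear_operator_sum:
  assumes "closed_linear_operator D A" "\<And>i. i \<in> I \<Longrightarrow> f i \<in> D"
  shows "(\<Sum>i\<in>I. c i *\<^sub>C f i) \<in> D \<and> A (\<Sum>i\<in>I. c i *\<^sub>C f i) = (\<Sum>i\<in>I. c i *\<^sub>C A (f i))"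
proof -
  have sub: "cvs.subspace D" and add: "\<And>x y. x \<in> D \<Longrightarrow> y \<in> D \<Longrightarrow> A (x + y) = A x + A y"
    and sc: "\<And>c x. x \<in> D \<Longrightarrow> A (c *\<^sub>C x) = c *\<^sub>C A x"
    using assms(1) by (auto simp: closed_linear_operator_def)
  have D0: "0 \<in> D" using sub by (rule cvs.subspace_0)
  have A0: "A 0 = 0" using sc[OF D0, of 0] by simp
  have mem: "(\<Sum>i\<in>J. c i *\<^sub>C f i) \<in> D" if "J \<subseteq> I" for J
    using that assms(2) by (intro cvs.subspace_sum[OF sub] cvs.subspace_scale[OF sub]) auto
  have "J \<subseteq> I \<Longrightarrow> A (\<Sum>i\<in>J. c i *\<^sub>C f i) = (\<Sum>i\<in>J. c i *\<^sub>C A (f i))" for J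
  proof (induction J rule: infinite_finite_induct)
    case (insert i J)
    then have "f i \<in> D" "c i *\<^sub>C f i \<in> D"
      using assms(2) cvs.subspace_scale[OF sub] by auto
    then show ?case using insert add mem[of J] sc by simp
  qed (simp_all add: A0)
  then show ?thesis using mem by blast
qed

section \<open>Dominated series\<close>

text \<open>The scalars \<open>M k\<close> majorize coefficient functions, so that every series with such coefficients and
  the vectors \<open>x k\<close> converges uniformly in each seminorm.\<close>

definition dominated :: "(nat \<Rightarrow> real) \<Rightarrow> (nat \<Rightarrow> 'a::complex_sclcs) \<Rightarrow> bool" where
  "dominated M x \<longleftrightarrow> (\<forall>p. continuous_seminorm p \<longrightarrow> summable (\<lambda>k. M k * p (x k)))"

lemma dominated_scale: "dominated M x \<Longrightarrow> dominated (\<lambda>k. c * M k) x"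
  unfolding dominated_def by (auto simp: mult.assoc intro: summable_mult)

lemma seminorm_partial_sum_le:
  assumes p: "continuous_seminorm p" and d: "dominated M x" and f: "\<And>k. cmod (f k) \<le> M k"
    and mn: "m \<le> n"
  shows "p ((\<Sum>k<n. f k *\<^sub>C x k) - (\<Sum>k<m. f k *\<^sub>C x k)) \<le> (\<Sum>k. M (k + m) * p (x (k + m)))"
proof -
  have M: "M k \<ge> 0" for k using f[of k] norm_ge_zero[of "f k"] by linarith
  have "(\<Sum>k<n. f k *\<^sub>C x k) - (\<Sum>k<m. f k *\<^sub>C x k) = (\<Sum>k\<in>{m..<n}. f k *\<^sub>C x k)"
    using sum_diff_nat_ivl[of 0 m n "\<lambda>k. f k *\<^sub>C x k"] mn by (simp add: atLeast0LessThan)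
  then have "p ((\<Sum>k<n. f k *\<^sub>C x k) - (\<Sum>k<m. f k *\<^sub>C x k)) \<le> (\<Sum>k\<in>{m..<n}. p (f k *\<^sub>C x k))"
    using seminorm_sum[OF p] by simp
  also have "\<dots> \<le> (\<Sum>k\<in>{m..<n}. M k * p (x k))"
    using f by (intro sum_mono) (simp add: seminorm_scaleC[OF p] mult_right_mono seminorm_nonneg[OF p])
  also have "\<dots> = (\<Sum>k<n-m. M (k + m) * p (x (k + m)))"
    using mn sum.shift_bounds_nat_ivl[of "\<lambda>k. M k * p (x k)" 0 m "n - m"]
    by (simp add: atLeast0LessThan)
  also have "\<dots> \<le> (\<Sum>k. M (k + m) * p (x (k + m)))"
  proof (rule sum_le_suminf)
    show "summable (\<lambda>k. M (k + m) * p (x (k + m)))"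
      using d p summable_ignore_initial_segment[of "\<lambda>k. M k * p (x k)" m]
      unfolding dominated_def by blast
  qed (use M seminorm_nonneg[OF p] in auto)
  finally show ?thesis .
qed

lemma dominated_tail:
  assumes "continuous_seminorm p" "dominated M x"
  shows "(\<lambda>m. \<Sum>k. M (k + m) * p (x (k + m))) \<longlonglongrightarrow> 0"
  using assms unfolding dominated_def by (intro suminf_exist_split2) auto

lemma dominated_summable:
  assumes d: "dominated M x" and f: "\<And>k. cmod (f k) \<le> M k"
  shows "summable (\<lambda>k. f k *\<^sub>C x k)"
proof -
  have "\<exists>l. (\<lambda>n. \<Sum>k<n. f k *\<^sub>C x k) \<longlonglongrightarrow> l"
  proof (rule seminorm_Cauchy_convergent)
    fix p :: "'a \<Rightarrow> real" and e :: real assume p: "continuous_seminorm p" and e: "e > 0"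
    have "\<forall>\<^sub>F m in sequentially. (\<Sum>k. M (k + m) * p (x (k + m))) < e/2"
      by (rule order_tendstoD(2)[OF dominated_tail[OF p d]]) (use e in simp)
    then obtain N where N: "(\<Sum>k. M (k + N) * p (x (k + N))) < e/2"
      unfolding eventually_sequentially by blast
    let ?S = "\<lambda>n. \<Sum>k<n. f k *\<^sub>C x k"
    have "p (?S j - ?S k) < e" if "j \<ge> N" "k \<ge> N" for j k
    proof -
      have "p (?S j - ?S k) = p ((?S j - ?S N) - (?S k - ?S N))" by simp
      also have "\<dots> \<le> p (?S j - ?S N) + p (?S k - ?S N)" by (rule seminorm_diff_le[OF p])
      also have "\<dots> < e"
        using seminorm_partial_sum_le[OF p d f that(1)] seminorm_partial_sum_le[OF p d f that(2)] N
        by linarith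
      finally show ?thesis .
    qed
    then show "\<exists>N. \<forall>j\<ge>N. \<forall>k\<ge>N. p (?S j - ?S k) < e" by blast
  qed
  then show ?thesis unfolding summable_def sums_def by blast
qed

lemma seminorm_suminf_tail:
  assumes p: "continuous_seminorm p" and d: "dominated M x" and f: "\<And>k. cmod (f k) \<le> M k"
  shows "p ((\<Sum>k. f k *\<^sub>C x k) - (\<Sum>k<m. f k *\<^sub>C x k)) \<le> (\<Sum>k. M (k + m) * p (x (k + m)))"
proof (rule tendsto_upperbound)
  show "((\<lambda>n. p ((\<Sum>k<n. f k *\<^sub>C x k) - (\<Sum>k<m. f k *\<^sub>C x k))) \<longlongrightarrow>
     p ((\<Sum>k. f k *\<^sub>C x k) - (\<Sum>k<m. f k *\<^sub>C x k))) sequentially"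
    by (intro tendsto_seminorm_compose[OF p] tendsto_diff tendsto_const summable_LIMSEQ
        dominated_summable[OF d f])
  show "\<forall>\<^sub>F n in sequentially. p ((\<Sum>k<n. f k *\<^sub>C x k) - (\<Sum>k<m. f k *\<^sub>C x k))
      \<le> (\<Sum>k. M (k + m) * p (x (k + m)))"
    using eventually_ge_at_top[of m]
    by eventually_elim (rule seminorm_partial_sum_le[OF p d f])
qed simp

lemma seminorm_suminf_le:
  assumes "continuous_seminorm p" "dominated M x" "\<And>k. cmod (f k) \<le> M k"
  shows "p (\<Sum>k. f k *\<^sub>C x k) \<le> (\<Sum>k. M k * p (x k))"
  using seminorm_suminf_tail[OF assms, where m=0] by simp

text \<open>Dominated convergence for series of vectors. With the filter as a parameter it serves three
  purposes below: continuity and differentiability of a series (filters at a point), and integration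
  term by term (the filter of tagged divisions).\<close>

lemma vector_tannery:
  fixes x :: "nat \<Rightarrow> 'a::complex_sclcs"
  assumes d: "dominated M x" and lim: "\<And>k. ((\<lambda>t. f t k) \<longlongrightarrow> l k) F"
    and bound: "\<forall>\<^sub>F t in F. \<forall>k. cmod (f t k) \<le> M k"
  shows "((\<lambda>t. \<Sum>k. f t k *\<^sub>C x k) \<longlongrightarrow> (\<Sum>k. l k *\<^sub>C x k)) F"
proof (cases "F = bot")
  case False
  have l: "cmod (l k) \<le> M k" for k
  proof (rule tendsto_upperbound[OF tendsto_norm[OF lim] _ False])
    show "\<forall>\<^sub>F t in F. cmod (f t k) \<le> M k" using bound by eventually_elim auto
  qed
  show ?thesis
    unfolding tendsto_seminorm
  proof (intro allI impI tendstoI)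
    fix p :: "'a \<Rightarrow> real" and e :: real assume p: "continuous_seminorm p" and e: "e > 0"
    have "\<forall>\<^sub>F m in sequentially. (\<Sum>k. M (k + m) * p (x (k + m))) < e/3"
      by (rule order_tendstoD(2)[OF dominated_tail[OF p d]]) (use e in simp)
    then obtain m where m: "(\<Sum>k. M (k + m) * p (x (k + m))) < e/3"
      unfolding eventually_sequentially by blast
    have "((\<lambda>t. \<Sum>k<m. f t k *\<^sub>C x k) \<longlongrightarrow> (\<Sum>k<m. l k *\<^sub>C x k)) F"
      by (intro tendsto_sum tendsto_scaleC tendsto_const lim)
    then have "((\<lambda>t. p ((\<Sum>k<m. f t k *\<^sub>C x k) - (\<Sum>k<m. l k *\<^sub>C x k))) \<longlongrightarrow> 0) F"
      using p unfolding tendsto_seminorm by blast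
    then have "\<forall>\<^sub>F t in F. p ((\<Sum>k<m. f t k *\<^sub>C x k) - (\<Sum>k<m. l k *\<^sub>C x k)) < e/3"
      by (rule order_tendstoD) (use e in simp)
    with bound show "\<forall>\<^sub>F t in F. dist (p ((\<Sum>k. f t k *\<^sub>C x k) - (\<Sum>k. l k *\<^sub>C x k))) 0 < e"
    proof eventually_elim
      case (elim t)
      let ?a = "\<Sum>k. f t k *\<^sub>C x k" and ?b = "\<Sum>k. l k *\<^sub>C x k"
      let ?a' = "\<Sum>k<m. f t k *\<^sub>C x k" and ?b' = "\<Sum>k<m. l k *\<^sub>C x k"
      have "p (?a - ?b) = p (((?a - ?a') + (?a' - ?b')) - (?b - ?b'))" by simp
      also have "\<dots> \<le> p ((?a - ?a') + (?a' - ?b')) + p (?b - ?b')" by (rule seminorm_diff_le[OF p])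
      also have "p ((?a - ?a') + (?a' - ?b')) \<le> p (?a - ?a') + p (?a' - ?b')"
        by (rule seminorm_triangle[OF p])
      also have "p (?a - ?a') < e/3"
        using seminorm_suminf_tail[OF p d, of "f t" m] elim(1) m by fastforce
      also have "p (?a' - ?b') < e/3" by (rule elim(2))
      also have "p (?b - ?b') < e/3"
        using seminorm_suminf_tail[OF p d l, of m] m by linarith
      finally show ?case using seminorm_nonneg[OF p] by simp
    qed
  qed
qed simp

lemma closed_linear_operator_suminf:
  assumes A: "closed_linear_operator D A" and x: "\<And>k. x k \<in> D"
    and d: "dominated M x" "dominated M (\<lambda>k. A (x k))" and f: "\<And>k. cmod (f k) \<le> M k"
  shows "(\<Sum>k. f k *\<^sub>C x k) \<in> D \<and> A (\<Sum>k. f k *\<^sub>C x k) = (\<Sum>k. f k *\<^sub>C A (x k))"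
proof (rule closed_linear_operator_limit[OF A sequentially_bot])
  show "(\<Sum>k<n. f k *\<^sub>C x k) \<in> D" for n
    by (rule closed_linear_operator_sum[OF A x, THEN conjunct1])
  show "(\<lambda>n. \<Sum>k<n. f k *\<^sub>C x k) \<longlonglongrightarrow> (\<Sum>k. f k *\<^sub>C x k)"
    by (intro summable_LIMSEQ dominated_summable[OF d(1) f])
  have "(\<lambda>n. \<Sum>k<n. f k *\<^sub>C A (x k)) \<longlonglongrightarrow> (\<Sum>k. f k *\<^sub>C A (x k))"
    by (intro summable_LIMSEQ dominated_summable[OF d(2) f])
  then show "(\<lambda>n. A (\<Sum>k<n. f k *\<^sub>C x k)) \<longlonglongrightarrow> (\<Sum>k. f k *\<^sub>C A (x k))"
    using closed_linear_operator_sum[where f=x, OF A x] by simp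
qed

section \<open>The integral of a dominated series\<close>

text \<open>Convergence of the Riemann sums is kept as a relation, because sums of values of the
  total function \<^const>\<open>lcs_integral\<close> can be combined only if these limits exist.\<close>

definition has_lcs_integral :: "(real \<Rightarrow> 'a::complex_sclcs) \<Rightarrow> 'a \<Rightarrow> real \<Rightarrow> real \<Rightarrow> bool" where
  "has_lcs_integral f I a b \<longleftrightarrow>
     ((\<lambda>P. \<Sum>(s, K)\<in>P. measure lborel K *\<^sub>R f s) \<longlongrightarrow> I) (division_filter (cbox a b))"

lemma lcs_integral_unique: "has_lcs_integral f I a b \<Longrightarrow> lcs_integral a b f = I"
  unfolding lcs_integral_def has_lcs_integral_def by (rule tendsto_Lim[OF division_filter_not_empty])

lemma has_lcs_integral_add:
  assumes "has_lcs_integral f I a b" "has_lcs_integral g J a b"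
  shows "has_lcs_integral (\<lambda>s. f s + g s) (I + J) a b"
  using tendsto_add[OF assms[unfolded has_lcs_integral_def]]
  by (simp add: has_lcs_integral_def scaleR_add_right split_def sum.distrib)

lemma lcs_integral_cong:
  assumes "\<And>s. s \<in> {a..b} \<Longrightarrow> f s = g s"
  shows "lcs_integral a b f = lcs_integral a b g"
proof -
  have "\<forall>\<^sub>F P in division_filter (cbox a b). (\<Sum>(s, K)\<in>P. measure lborel K *\<^sub>R f s) =
      (\<Sum>(s, K)\<in>P. measure lborel K *\<^sub>R g s)"
    using eventually_division_filter_tagged_division[of "cbox a b"]
  proof eventually_elim
    case (elim P)
    have "fst i \<in> {a..b}" if "i \<in> P" for i
      using tagged_division_ofD(2,3)[OF elim, of "fst i" "snd i"] that by auto
    then show ?case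
      using assms by (intro sum.cong refl) (simp add: split_def)
  qed
  from tendsto_cong[OF this] show ?thesis unfolding lcs_integral_def Topological_Spaces.Lim_def by simp
qed

lemma scaleC_suminf:
  fixes x :: "nat \<Rightarrow> 'a::complex_sclcs"
  assumes "summable x" shows "c *\<^sub>C (\<Sum>k. x k) = (\<Sum>k. c *\<^sub>C x k)" "summable (\<lambda>k. c *\<^sub>C x k)"
proof -
  have "(\<lambda>n. c *\<^sub>C (\<Sum>k<n. x k)) \<longlonglongrightarrow> c *\<^sub>C (\<Sum>k. x k)"
    by (intro tendsto_scaleC tendsto_const summable_LIMSEQ assms)
  then have "(\<lambda>k. c *\<^sub>C x k) sums (c *\<^sub>C (\<Sum>k. x k))"
    by (simp add: sums_def cvs.scale_sum_right)
  then show "c *\<^sub>C (\<Sum>k. x k) = (\<Sum>k. c *\<^sub>C x k)" "summable (\<lambda>k. c *\<^sub>C x k)"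
    by (auto simp: sums_iff)
qed

lemma sum_suminf_scaleC:
  fixes x :: "nat \<Rightarrow> 'a::complex_sclcs"
  assumes d: "dominated M x" and f: "\<And>i k. i \<in> I \<Longrightarrow> cmod (f i k) \<le> M k"
  shows "(\<Sum>i\<in>I. c i *\<^sub>C (\<Sum>k. f i k *\<^sub>C x k)) = (\<Sum>k. (\<Sum>i\<in>I. c i * f i k) *\<^sub>C x k)"
    "summable (\<lambda>k. (\<Sum>i\<in>I. c i * f i k) *\<^sub>C x k)"
proof -
  have s: "summable (\<lambda>k. f i k *\<^sub>C x k)" if "i \<in> I" for i
    using f[OF that] by (rule dominated_summable[OF d])
  have "(\<Sum>i\<in>I. c i *\<^sub>C (\<Sum>k. f i k *\<^sub>C x k)) = (\<Sum>i\<in>I. \<Sum>k. c i *\<^sub>C f i k *\<^sub>C x k)"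
    using s by (intro sum.cong scaleC_suminf) auto
  also have "\<dots> = (\<Sum>k. \<Sum>i\<in>I. c i *\<^sub>C f i k *\<^sub>C x k)"
    using s by (intro suminf_sum[symmetric] scaleC_suminf)
  also have "\<dots> = (\<Sum>k. (\<Sum>i\<in>I. c i * f i k) *\<^sub>C x k)"
    by (simp add: scaleC_scaleC cvs.scale_sum_left)
  finally show "(\<Sum>i\<in>I. c i *\<^sub>C (\<Sum>k. f i k *\<^sub>C x k)) = (\<Sum>k. (\<Sum>i\<in>I. c i * f i k) *\<^sub>C x k)" .
  have "summable (\<lambda>k. \<Sum>i\<in>I. c i *\<^sub>C f i k *\<^sub>C x k)"
    using s by (intro summable_sum scaleC_suminf(2))
  then show "summable (\<lambda>k. (\<Sum>i\<in>I. c i * f i k) *\<^sub>C x k)"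
    by (simp add: scaleC_scaleC cvs.scale_sum_left)
qed

text \<open>The Riemann sum of the series is the series of the Riemann sums, whose coefficients are bounded
  by \<open>W + 1\<close> times the majorant along the filter. The weight \<open>w\<close> may be singular at an endpoint, as
  the kernel of fractional integration is.\<close>

lemma has_lcs_integral_series:
  fixes x :: "nat \<Rightarrow> 'a::complex_sclcs"
  assumes ab: "a \<le> b" and d: "dominated M x" and w: "(w has_integral W) {a..b}" "\<And>s. s \<in> {a..b} \<Longrightarrow> w s \<ge> 0"
    and int: "\<And>k. ((\<lambda>s. w s * f k s) has_integral J k) {a..b}"
    and f: "\<And>k s. s \<in> {a..b} \<Longrightarrow> \<bar>f k s\<bar> \<le> M k"
  shows "has_lcs_integral (\<lambda>s. w s *\<^sub>R (\<Sum>k. f k s *\<^sub>R x k)) (\<Sum>k. J k *\<^sub>R x k) a b"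
  unfolding has_lcs_integral_def
proof -
  let ?F = "division_filter (cbox a b)"
  define S :: "(real \<times> real set) set \<Rightarrow> nat \<Rightarrow> complex"
    where "S P k = complex_of_real (\<Sum>(s, K)\<in>P. measure lborel K *\<^sub>R (w s * f k s))" for P k
  have td: "\<forall>\<^sub>F P in ?F. P tagged_division_of cbox a b"
    by (rule eventually_division_filter_tagged_division)
  have "((\<lambda>P. \<Sum>(s, K)\<in>P. measure lborel K *\<^sub>R w s) \<longlongrightarrow> W) ?F"
    by (rule has_integral_cbox[THEN iffD1, OF w(1)[folded cbox_interval]])
  then have W: "\<forall>\<^sub>F P in ?F. (\<Sum>(s, K)\<in>P. measure lborel K *\<^sub>R w s) < W + 1"
    by (rule order_tendstoD) simp
  have "((\<lambda>P. \<Sum>k. S P k *\<^sub>C x k) \<longlongrightarrow> (\<Sum>k. of_real (J k) *\<^sub>C x k)) ?F"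
  proof (rule vector_tannery)
    show "dominated (\<lambda>k. (W + 1) * M k) x" by (rule dominated_scale[OF d])
    show "((\<lambda>P. S P k) \<longlongrightarrow> of_real (J k)) ?F" for k
      unfolding S_def
      by (rule tendsto_of_real) (rule has_integral_cbox[THEN iffD1, OF int[folded cbox_interval]])
    show "\<forall>\<^sub>F P in ?F. \<forall>k. cmod (S P k) \<le> (W + 1) * M k"
      using td W
    proof eventually_elim
      case (elim P)
      show ?case
      proof
        fix k
        have tag: "s \<in> {a..b}" if "(s, K) \<in> P" for s K
          using tagged_division_ofD(2,3)[OF elim(1) that] by auto
        have "cmod (S P k) \<le> (\<Sum>(s, K)\<in>P. \<bar>measure lborel K *\<^sub>R (w s * f k s)\<bar>)"
          unfolding S_def norm_of_real by (rule order_trans[OF sum_abs]) (simp add: split_def)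
        also have "\<dots> \<le> (\<Sum>(s, K)\<in>P. (measure lborel K *\<^sub>R w s) * M k)"
        proof (rule sum_mono, clarify)
          fix s K assume P: "(s, K) \<in> P"
          have "\<bar>measure lborel K *\<^sub>R (w s * f k s)\<bar> = measure lborel K * w s * \<bar>f k s\<bar>"
            using w(2)[OF tag[OF P]] by (simp add: abs_mult)
          also have "\<dots> \<le> measure lborel K * w s * M k"
            using w(2)[OF tag[OF P]] f[OF tag[OF P]] by (intro mult_left_mono) auto
          finally show "\<bar>measure lborel K *\<^sub>R (w s * f k s)\<bar> \<le> (measure lborel K *\<^sub>R w s) * M k"
            by simp
        qed
        also have "\<dots> = (\<Sum>(s, K)\<in>P. measure lborel K *\<^sub>R w s) * M k"
          by (simp add: sum_distrib_right split_def)
        also have "\<dots> \<le> (W + 1) * M k"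
          using elim(2) order_trans[OF abs_ge_zero f[of a k]] ab by (intro mult_right_mono) auto
        finally show "cmod (S P k) \<le> (W + 1) * M k" .
      qed
    qed
  qed
  moreover have "\<forall>\<^sub>F P in ?F. (\<Sum>(s, K)\<in>P. measure lborel K *\<^sub>R w s *\<^sub>R (\<Sum>k. f k s *\<^sub>R x k)) =
      (\<Sum>k. S P k *\<^sub>C x k)"
    using td
  proof eventually_elim
    case (elim P)
    have tag: "fst i \<in> {a..b}" if "i \<in> P" for i
      using tagged_division_ofD(2,3)[OF elim, of "fst i" "snd i"] that by auto
    have "(\<Sum>(s, K)\<in>P. measure lborel K *\<^sub>R w s *\<^sub>R (\<Sum>k. f k s *\<^sub>R x k)) =
       (\<Sum>i\<in>P. of_real (measure lborel (snd i) * w (fst i)) *\<^sub>C (\<Sum>k. of_real (f k (fst i)) *\<^sub>C x k))"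
      by (simp add: split_def scaleR_scaleC scaleC_scaleC)
    also have "\<dots> = (\<Sum>k. (\<Sum>i\<in>P. of_real (measure lborel (snd i) * w (fst i)) * of_real (f k (fst i))) *\<^sub>C x k)"
      by (rule sum_suminf_scaleC(1)[OF d]) (use tag f in auto)
    also have "\<dots> = (\<Sum>k. S P k *\<^sub>C x k)"
      by (simp add: S_def split_def mult.assoc)
    finally show ?case .
  qed
  ultimately show "((\<lambda>P. \<Sum>(s, K)\<in>P. measure lborel K *\<^sub>R w s *\<^sub>R (\<Sum>k. f k s *\<^sub>R x k)) \<longlongrightarrow>
      (\<Sum>k. J k *\<^sub>R x k)) ?F"
    unfolding scaleR_scaleC[of "J _"] by (simp add: tendsto_cong)
qed

section \<open>Analyticity of dominated series of holomorphic functions\<close>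

lemma taylor_coefficient_bound:
  assumes hol: "f holomorphic_on ball z \<rho>" and \<rho>: "\<rho> > 0" and f: "\<And>w. w \<in> ball z \<rho> \<Longrightarrow> cmod (f w) \<le> B"
  shows "cmod ((deriv ^^ n) f z / fact n) \<le> B / (\<rho>/2) ^ n"
proof -
  have "cmod ((deriv ^^ n) f z) \<le> fact n * B / (\<rho>/2) ^ n"
  proof (rule Cauchy_inequality)
    show "f holomorphic_on ball z (\<rho>/2)" using hol by (rule holomorphic_on_subset) (use \<rho> in auto)
    show "continuous_on (cball z (\<rho>/2)) f"
      by (rule holomorphic_on_imp_continuous_on[OF holomorphic_on_subset[OF hol]]) (use \<rho> in auto)
    show "cmod (f x) \<le> B" if "cmod (z - x) = \<rho>/2" for x
      using that \<rho> by (intro f) (simp add: dist_norm)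
  qed (use \<rho> in auto)
  then show ?thesis using \<rho> by (simp add: norm_divide field_simps)
qed

lemma taylor_remainder_bound:
  assumes hol: "f holomorphic_on ball z \<rho>" and \<rho>: "\<rho> > 0" and f: "\<And>w. w \<in> ball z \<rho> \<Longrightarrow> cmod (f w) \<le> B"
    and w: "w \<in> ball z (\<rho>/4)"
  shows "cmod (f w - (\<Sum>n<m. (w - z) ^ n * ((deriv ^^ n) f z / fact n))) \<le> 2 * (1/2) ^ m * B"
proof -
  let ?a = "\<lambda>n. (w - z) ^ n * ((deriv ^^ n) f z / fact n)"
  have B: "B \<ge> 0" using order_trans[OF norm_ge_zero f[of z]] \<rho> by simp
  have s: "?a sums f w"
    using holomorphic_power_series[OF hol, of w] w \<rho> by (simp add: mult.commute)
  have b: "cmod (?a n) \<le> B * (1/2) ^ n" for n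
  proof -
    have "cmod (?a n) \<le> (\<rho>/4) ^ n * (B / (\<rho>/2) ^ n)"
      unfolding norm_mult norm_power
      using w \<rho> by (intro mult_mono power_mono taylor_coefficient_bound[OF hol \<rho> f])
        (auto simp: dist_norm norm_minus_commute)
    also have "(\<rho>/4) ^ n = (\<rho>/2) ^ n * (1/2) ^ n" by (simp flip: power_mult_distrib)
    also have "(\<rho>/2) ^ n * (1/2) ^ n * (B / (\<rho>/2) ^ n) = B * (1/2) ^ n"
    proof -
      have "u * v * (B / u) = B * v" if "u \<noteq> 0" for u v :: real using that by simp
      from this[of "(\<rho>/2) ^ n"] show ?thesis using \<rho> by simp
    qed
    finally show ?thesis .
  qed
  have g: "(\<lambda>n. B * (1/2) ^ (n + m)) sums (B * (1/2) ^ m * 2)"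
    using sums_mult[OF geometric_sums[of "1/2::real"], of "B * (1/2)^m"]
    by (simp add: power_add mult_ac)
  have "f w - (\<Sum>n<m. ?a n) = (\<Sum>n. ?a (n + m))"
    using suminf_minus_initial_segment[OF sums_summable[OF s], of m] sums_unique[OF s] by simp
  also have "cmod \<dots> \<le> (\<Sum>n. B * (1/2) ^ (n + m))"
    using b by (intro norm_suminf_le sums_summable[OF g])
  finally show ?thesis unfolding sums_unique[OF g, symmetric] by (simp add: mult_ac)
qed

text \<open>Cauchy's estimates bound the Taylor coefficients of all the \<open>f k\<close> by the majorant, so the Taylor
  coefficients of the sum are again convergent series. On a ball of a quarter of the radius the
  remainders are at most $2 \cdot 2^{-m}$ times the majorant, uniformly in \<open>k\<close>.\<close>

lemma lcs_analytic_on_series: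
  fixes x :: "nat \<Rightarrow> 'a::complex_sclcs"
  assumes "\<And>z. z \<in> S \<Longrightarrow> \<exists>\<rho>>0. \<exists>M. dominated M x \<and>
     (\<forall>k. f k holomorphic_on ball z \<rho> \<and> (\<forall>w\<in>ball z \<rho>. cmod (f k w) \<le> M k))"
  shows "lcs_analytic_on (\<lambda>z. \<Sum>k. f k z *\<^sub>C x k) S"
  unfolding lcs_analytic_on_def
proof
  fix z assume "z \<in> S"
  then obtain \<rho> M where \<rho>: "\<rho> > 0" and d: "dominated M x"
    and hol: "\<And>k. f k holomorphic_on ball z \<rho>" and M: "\<And>k w. w \<in> ball z \<rho> \<Longrightarrow> cmod (f k w) \<le> M k"
    using assms by meson
  define c where "c n = (\<Sum>k. ((deriv ^^ n) (f k) z / fact n) *\<^sub>C x k)" for n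
  define R where "R w m k = f k w - (\<Sum>n<m. (w - z) ^ n * ((deriv ^^ n) (f k) z / fact n))" for w m k
  have R: "f' - (\<Sum>n<m. (w - z) ^ n *\<^sub>C c n) = (\<Sum>k. R w m k *\<^sub>C x k)"
    if w: "w \<in> ball z (\<rho>/4)" and f': "f' = (\<Sum>k. f k w *\<^sub>C x k)" for w m f'
  proof -
    have w': "w \<in> ball z \<rho>" using w \<rho> by simp
    define M' where "M' k = (\<Sum>n<m. 1 / (\<rho>/2) ^ n) * M k" for k
    have d': "dominated M' x" unfolding M'_def by (rule dominated_scale[OF d])
    have b: "cmod ((deriv ^^ n) (f k) z / fact n) \<le> M' k" if "n \<in> {..<m}" for n k
    proof -
      have M0: "M k \<ge> 0" using order_trans[OF norm_ge_zero M[of z k]] \<rho> by simp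
      have "cmod ((deriv ^^ n) (f k) z / fact n) \<le> 1 / (\<rho>/2) ^ n * M k"
        using taylor_coefficient_bound[OF hol \<rho> M] by simp
      also have "\<dots> \<le> M' k"
        unfolding M'_def using that \<rho> M0
        by (intro mult_right_mono member_le_sum) auto
      finally show ?thesis .
    qed
    have "(\<Sum>n<m. (w - z) ^ n *\<^sub>C c n)
       = (\<Sum>k. (\<Sum>n<m. (w - z) ^ n * ((deriv ^^ n) (f k) z / fact n)) *\<^sub>C x k)"
      unfolding c_def by (rule sum_suminf_scaleC(1)[OF d' b])
    moreover have s1: "summable (\<lambda>k. (\<Sum>n<m. (w - z) ^ n * ((deriv ^^ n) (f k) z / fact n)) *\<^sub>C x k)"
      by (rule sum_suminf_scaleC(2)[OF d' b])
    moreover have s2: "summable (\<lambda>k. f k w *\<^sub>C x k)"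
      using M[OF w'] by (rule dominated_summable[OF d])
    ultimately have "(\<lambda>N. (\<Sum>k<N. f k w *\<^sub>C x k) -
        (\<Sum>k<N. (\<Sum>n<m. (w - z) ^ n * ((deriv ^^ n) (f k) z / fact n)) *\<^sub>C x k))
        \<longlonglongrightarrow> f' - (\<Sum>n<m. (w - z) ^ n *\<^sub>C c n)"
      unfolding f' using tendsto_diff[OF summable_LIMSEQ[OF s2] summable_LIMSEQ[OF s1]] by simp
    then have "(\<lambda>k. R w m k *\<^sub>C x k) sums (f' - (\<Sum>n<m. (w - z) ^ n *\<^sub>C c n))"
      unfolding sums_def R_def by (simp add: cvs.scale_left_diff_distrib sum_subtractf)
    then show ?thesis by (simp add: sums_iff)
  qed
  show "\<exists>\<rho>>0. \<exists>c :: nat \<Rightarrow> 'a. \<forall>U. open U \<and> 0 \<in> U \<longrightarrow>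
        (\<exists>N. \<forall>m\<ge>N. \<forall>w\<in>ball z \<rho>. (\<Sum>k. f k w *\<^sub>C x k) - (\<Sum>k<m. (w - z) ^ k *\<^sub>C c k) \<in> U)"
  proof (intro exI[of _ "\<rho>/4"] exI[of _ c] conjI allI impI)
    fix U :: "'a set" assume "open U \<and> 0 \<in> U"
    then obtain p where p: "continuous_seminorm p" "\<And>x. p x < 1 \<Longrightarrow> x \<in> U"
      using exists_seminorm_subset by blast
    have "(\<lambda>m. 2 * (1/2) ^ m * (\<Sum>k. M k * p (x k))) \<longlonglongrightarrow> 2 * 0 * (\<Sum>k. M k * p (x k))"
      by (intro tendsto_intros LIMSEQ_power_zero) auto
    then have "\<forall>\<^sub>F m in sequentially. 2 * (1/2) ^ m * (\<Sum>k. M k * p (x k)) < 1"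
      by (intro order_tendstoD) auto
    then obtain N where N: "\<And>m. m \<ge> N \<Longrightarrow> 2 * (1/2) ^ m * (\<Sum>k. M k * p (x k)) < 1"
      unfolding eventually_sequentially by blast
    show "\<exists>N. \<forall>m\<ge>N. \<forall>w\<in>ball z (\<rho>/4). (\<Sum>k. f k w *\<^sub>C x k) - (\<Sum>k<m. (w - z) ^ k *\<^sub>C c k) \<in> U"
    proof (intro exI[of _ N] allI impI ballI p(2))
      fix m w assume m: "m \<ge> N" and w: "w \<in> ball z (\<rho>/4)"
      have "p ((\<Sum>k. f k w *\<^sub>C x k) - (\<Sum>k<m. (w - z) ^ k *\<^sub>C c k)) = p (\<Sum>k. R w m k *\<^sub>C x k)"
        using R[OF w refl] by simp
      also have "\<dots> \<le> (\<Sum>k. 2 * (1/2) ^ m * M k * p (x k))"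
        unfolding R_def
        by (rule seminorm_suminf_le[OF p(1) dominated_scale[OF d]])
           (rule taylor_remainder_bound[OF hol \<rho> M w])
      also have "\<dots> = 2 * (1/2) ^ m * (\<Sum>k. M k * p (x k))"
        using d p(1) unfolding dominated_def by (simp add: mult.assoc suminf_mult)
      also have "\<dots> < 1" by (rule N[OF m])
      finally show "p ((\<Sum>k. f k w *\<^sub>C x k) - (\<Sum>k<m. (w - z) ^ k *\<^sub>C c k)) < 1" .
    qed
  qed (use \<rho> in auto)
qed

section \<open>The kernels of fractional integration\<close>

text \<open>Restrict the integral that defines $\Gamma$ to $[t,\infty)$, where $x^{b-1} \ge t^{b-1}$. With $t$
  free this one inequality replaces the asymptotics of $\Gamma$ everywhere.\<close>

lemma Gamma_ge_powr_exp:
  fixes b t :: real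
  assumes b: "b \<ge> 1" and t: "t > 0"
  shows "t powr (b - 1) * exp (- t) \<le> Gamma b"
proof -
  have 1: "((\<lambda>x. x powr (b - 1) / exp x) has_integral Gamma b) {0..}"
    using b by (intro Gamma_integral_real) simp
  have "((\<lambda>x. exp (- 1 * x)) has_integral exp (- 1 * t) / 1) {t..}"
    by (rule has_integral_exp_minus_to_infinity) simp
  then have "((\<lambda>x. t powr (b - 1) * exp (- x)) has_integral t powr (b - 1) * exp (- t)) {t..}"
    using has_integral_mult_right[of "\<lambda>x. exp (- x)" "exp (- t)" "{t..}" "t powr (b - 1)"] by simp
  then have 2: "((\<lambda>x. if x \<in> {t..} then t powr (b - 1) * exp (- x) else 0)
      has_integral t powr (b - 1) * exp (- t)) {0..}"
    using t by (subst has_integral_restrict) auto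
  show ?thesis
  proof (rule has_integral_le[OF 2 1])
    fix x :: real assume "x \<in> {0..}"
    then show "(if x \<in> {t..} then t powr (b - 1) * exp (- x) else 0) \<le> x powr (b - 1) / exp x"
      using t b by (auto simp: exp_minus field_simps intro: powr_mono2)
  qed
qed

lemma Gamma_real_nonzero: "0 < b \<Longrightarrow> Gamma (b::real) \<noteq> 0"
  using Gamma_real_pos[of b] by linarith

lemma g_ker_1: "t \<ge> 0 \<Longrightarrow> g_ker 1 t = 1"
  by (simp add: g_ker_def)

lemma g_ker_0: "b \<noteq> 1 \<Longrightarrow> g_ker b 0 = 0"
  by (simp add: g_ker_def)

lemma g_ker_pos: "t > 0 \<Longrightarrow> g_ker b t = t powr (b - 1) / Gamma b"
  by (simp add: g_ker_def)

lemma g_ker_nonneg: "b > 0 \<Longrightarrow> g_ker b t \<ge> 0"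
  by (auto simp: g_ker_def intro!: divide_nonneg_nonneg)

lemma g_ker_mono:
  assumes "b \<ge> 1" "0 \<le> s" "s \<le> t"
  shows "g_ker b s \<le> g_ker b t"
proof (cases "s = 0")
  case True
  show ?thesis
  proof (cases "b = 1")
    case True then show ?thesis using assms by (simp add: g_ker_1)
  next
    case False then show ?thesis using True assms g_ker_nonneg[of b t] by (simp add: g_ker_0)
  qed
next
  case False
  then show ?thesis using assms by (auto simp: g_ker_pos intro!: divide_right_mono powr_mono2)
qed

lemma g_ker_has_derivative:
  assumes b: "b \<ge> 1" and t: "t \<ge> 0"
  shows "(g_ker (b + 1) has_real_derivative g_ker b t) (at t within {0..})"
proof (cases "t = 0")
  case False
  then have t: "t > 0" using t by simp
  have "((\<lambda>s. s powr b / Gamma (b + 1)) has_real_derivative (b * t powr (b - 1)) / Gamma (b + 1)) (at t)"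
    using t by (intro DERIV_cdivide has_real_derivative_powr)
  moreover have "\<forall>\<^sub>F s in nhds t. s powr b / Gamma (b + 1) = g_ker (b + 1) s"
    using order_tendstoD(1)[OF filterlim_ident t]
    by eventually_elim (simp add: g_ker_pos)
  moreover have "(b * t powr (b - 1)) / Gamma (b + 1) = g_ker b t"
    using b t Gamma_plus1[of b] by (simp add: g_ker_pos pochhammer_rec nonpos_Ints_def)
  ultimately have "(g_ker (b + 1) has_real_derivative g_ker b t) (at t)"
    by (metis DERIV_cong_ev)
  then show ?thesis by (rule has_field_derivative_at_within)
next
  case True
  have ev: "\<forall>\<^sub>F s in at 0 within {0..}. s powr (b - 1) / Gamma (b + 1) = (g_ker (b + 1) s - g_ker (b + 1) 0) / (s - 0)"
    unfolding eventually_at_filter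
  proof (rule always_eventually, intro allI impI)
    fix s :: real assume "s \<noteq> 0" "s \<in> {0..}"
    then have s: "s > 0" by simp
    then have "s powr b = s * s powr (b - 1)" by (simp add: powr_diff)
    then show "s powr (b - 1) / Gamma (b + 1) = (g_ker (b + 1) s - g_ker (b + 1) 0) / (s - 0)"
      using s b by (simp add: g_ker_pos g_ker_0)
  qed
  have "((\<lambda>s. s powr (b - 1) / Gamma (b + 1)) \<longlongrightarrow> g_ker b 0) (at 0 within {0..})"
  proof (cases "b = 1")
    case True
    have "\<forall>\<^sub>F s in at 0 within {0..}. 1 = s powr (b - 1) / Gamma (b + 1)"
      unfolding eventually_at_filter
      by (rule always_eventually) (auto simp: True Gamma_numeral)
    from tendsto_cong[OF this, of 1] show ?thesis using True by (simp add: g_ker_1)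
  next
    case False
    then have "((\<lambda>s. s powr (b - 1) / Gamma (b + 1)) \<longlongrightarrow> 0 powr (b - 1) / Gamma (b + 1)) (at 0 within {0..})"
      using b by (intro tendsto_intros tendsto_powr' Gamma_real_nonzero) (auto simp: eventually_at_filter)
    then show ?thesis using False by (simp add: g_ker_0)
  qed
  then show ?thesis
    unfolding has_field_derivative_iff True using tendsto_cong[OF ev] by blast
qed

lemma continuous_on_g_ker:
  assumes "b \<ge> 1" shows "continuous_on {0..} (g_ker b)"
proof -
  have "continuous_on {0..} (\<lambda>t. if b = 1 then 1 else t powr (b - 1) / Gamma b)"
    using assms Gamma_real_nonzero[of b]
    by (cases "b = 1") (auto intro!: continuous_intros continuous_on_powr')
  then show ?thesis
    by (rule continuous_on_eq) (auto simp: g_ker_def)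
qed

text \<open>Euler's Beta integral, scaled to the interval $[0,t]$. The endpoints are treated as
  exceptional points, because for $b = 1$ the two integrands differ at $0$.\<close>

lemma g_ker_convolution:
  assumes \<beta>: "0 < \<beta>" "\<beta> < 1" and b: "b \<ge> 1" and t: "t > 0"
  shows "((\<lambda>s. g_ker \<beta> (t - s) * g_ker b s) has_integral g_ker (b + \<beta>) t) {0..t}"
proof -
  let ?f = "\<lambda>\<tau>. \<tau> powr (b - 1) * (1 - \<tau>) powr (\<beta> - 1)"
  have "(?f has_integral Beta b \<beta>) (cbox 0 1)"
    using has_integral_Beta_real[of b \<beta>] \<beta> b by simp
  from has_integral_affinity[OF this, of "1/t" 0]
  have "((\<lambda>s. ?f (s / t)) has_integral t * Beta b \<beta>) ((\<lambda>x. t * x) ` {0..1})"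
    using t by simp
  also have "(\<lambda>x. t * x) ` {0..1} = {0..t}"
    using t by (simp add: image_mult_atLeastAtMost)
  finally have "((\<lambda>s. t powr (b + \<beta> - 2) / (Gamma b * Gamma \<beta>) * ?f (s / t)) has_integral
      t powr (b + \<beta> - 2) / (Gamma b * Gamma \<beta>) * (t * Beta b \<beta>)) {0..t}"
    by (rule has_integral_mult_right)
  moreover have "t powr (b + \<beta> - 2) / (Gamma b * Gamma \<beta>) * (t * Beta b \<beta>) = g_ker (b + \<beta>) t"
  proof -
    have "t powr (b + \<beta> - 1) = t powr (b + \<beta> - 2 + 1)" by simp
    also have "\<dots> = t powr (b + \<beta> - 2) * t" using t by (simp only: powr_add powr_one)
    finally show ?thesis
      using t \<beta> b Gamma_real_nonzero[of b] Gamma_real_nonzero[of \<beta>] Gamma_real_nonzero[of "b + \<beta>"]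
      by (simp add: g_ker_pos Beta_def)
  qed
  ultimately have I: "((\<lambda>s. t powr (b + \<beta> - 2) / (Gamma b * Gamma \<beta>) * ?f (s / t)) has_integral
      g_ker (b + \<beta>) t) {0..t}" by simp
  show ?thesis
  proof (rule has_integral_spike_finite[OF _ _ I])
    show "finite {0, t}" by simp
    fix s assume "s \<in> {0..t} - {0, t}"
    then have s: "0 < s" "s < t" by auto
    have e: "1 - s / t = (t - s) / t" using t by (simp add: diff_divide_distrib)
    have "?f (s / t) = s powr (b - 1) / t powr (b - 1) * ((t - s) powr (\<beta> - 1) / t powr (\<beta> - 1))"
      unfolding e using s t by (simp only: powr_divide)
    moreover have "t powr (b + \<beta> - 2) = t powr (b - 1) * t powr (\<beta> - 1)"
      by (simp flip: powr_add) 
    ultimately show "g_ker \<beta> (t - s) * g_ker b s = t powr (b + \<beta> - 2) / (Gamma b * Gamma \<beta>) * ?f (s / t)"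
      using s t by (simp add: g_ker_pos) (simp add: mult_ac)
  qed
qed

section \<open>Series of fractional powers\<close>

text \<open>The vectors \<open>x k\<close> are $O(\rho^{-k}\,\Gamma(\zeta k+b))$ for every $\rho$, in every seminorm. The shift
  \<open>l\<close> and the offset \<open>b\<close> are quantified inside, so that shifting a sequence or differentiating its
  series needs no comparison of values of $\Gamma$.\<close>

definition fast_decay :: "real \<Rightarrow> (nat \<Rightarrow> 'a::complex_sclcs) \<Rightarrow> bool" where
  "fast_decay \<zeta> x \<longleftrightarrow> (\<forall>p. continuous_seminorm p \<longrightarrow>
     (\<forall>\<rho>>0. \<forall>l. \<forall>b\<ge>1. \<exists>B. \<forall>k. \<rho> ^ k * p (x (k + l)) \<le> B * Gamma (\<zeta> * real k + b)))"

lemma fast_decay_shift: "fast_decay \<zeta> x \<Longrightarrow> fast_decay \<zeta> (\<lambda>k. x (k + m))"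
  unfolding fast_decay_def by (auto simp: add.assoc)

text \<open>The value of $t^{\zeta k+b-1}/\Gamma(\zeta k+b)$ at $t = R$, which majorizes the terms for $t \le R$.\<close>

definition weight :: "real \<Rightarrow> real \<Rightarrow> real \<Rightarrow> nat \<Rightarrow> real" where
  "weight \<zeta> b R k = (R powr \<zeta>) ^ k * R powr (b - 1) / Gamma (\<zeta> * real k + b)"

lemma dominated_weight:
  assumes fast: "fast_decay \<zeta> x" and \<zeta>: "\<zeta> > 0" and b: "b \<ge> 1" and R: "R > 0"
  shows "dominated (weight \<zeta> b R) x"
  unfolding dominated_def
proof (intro allI impI)
  fix p :: "'a \<Rightarrow> real" assume p: "continuous_seminorm p"
  \<comment> \<open>The factor two leaves a geometric series.\<close>
  have "2 * R powr \<zeta> > 0" using R by simp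
  then obtain B where B: "\<And>k. (2 * R powr \<zeta>) ^ k * p (x k) \<le> B * Gamma (\<zeta> * real k + b)"
    using fast p b unfolding fast_decay_def by (metis add_0_right)
  show "summable (\<lambda>k. weight \<zeta> b R k * p (x k))"
  proof (rule summable_comparison_test')
    show "summable (\<lambda>k. B * R powr (b - 1) * (1/2) ^ k)"
      by (intro summable_mult summable_geometric) simp
    fix k :: nat
    have G: "Gamma (\<zeta> * real k + b) > 0" using \<zeta> b by (intro Gamma_real_pos add_nonneg_pos) auto
    have "weight \<zeta> b R k * p (x k) =
        R powr (b - 1) * (1/2) ^ k * (((2 * R powr \<zeta>) ^ k * p (x k)) / Gamma (\<zeta> * real k + b))"
      by (simp add: weight_def power_mult_distrib power_one_over)
    also have "\<dots> \<le> R powr (b - 1) * (1/2) ^ k * B"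
      using B[of k] G by (intro mult_left_mono) (auto simp: divide_le_eq)
    finally have "weight \<zeta> b R k * p (x k) \<le> B * R powr (b - 1) * (1/2) ^ k"
      by (simp add: mult_ac)
    moreover have "weight \<zeta> b R k * p (x k) \<ge> 0"
      using G seminorm_nonneg[OF p] by (simp add: weight_def)
    ultimately show "norm (weight \<zeta> b R k * p (x k)) \<le> B * R powr (b - 1) * (1/2) ^ k" by simp
  qed
qed

lemma g_ker_le_weight:
  assumes \<zeta>: "\<zeta> > 0" and b: "b \<ge> 1" and t: "0 \<le> t" "t \<le> R" "R > 0"
  shows "\<bar>g_ker (\<zeta> * real k + b) t\<bar> \<le> weight \<zeta> b R k"
proof -
  have b': "\<zeta> * real k + b \<ge> 1" using \<zeta> b by (simp add: add_increasing)
  then have "\<bar>g_ker (\<zeta> * real k + b) t\<bar> = g_ker (\<zeta> * real k + b) t"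
    using g_ker_nonneg[of "\<zeta> * real k + b" t] by simp
  also have "\<dots> \<le> g_ker (\<zeta> * real k + b) R" by (rule g_ker_mono[OF b' t(1,2)])
  also have "\<dots> = R powr (real k * \<zeta> + (b - 1)) / Gamma (\<zeta> * real k + b)"
    using t(3) by (simp add: g_ker_pos algebra_simps)
  also have "\<dots> = weight \<zeta> b R k"
    using t(3) by (simp add: weight_def powr_add powr_power mult.commute)
  finally show ?thesis .
qed

definition frac_series :: "real \<Rightarrow> real \<Rightarrow> (nat \<Rightarrow> 'a::complex_sclcs) \<Rightarrow> real \<Rightarrow> 'a" where
  "frac_series \<zeta> b x t = (\<Sum>k. g_ker (\<zeta> * real k + b) t *\<^sub>R x k)"

lemma frac_series_at_0:
  assumes "\<zeta> > 0" "b > 1" shows "frac_series \<zeta> b x 0 = 0"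
proof -
  have "g_ker (\<zeta> * real k + b) 0 = 0" for k
    using assms mult_nonneg_nonneg[of \<zeta> "real k"] by (intro g_ker_0) linarith
  then show ?thesis by (simp add: frac_series_def)
qed

context
  fixes \<zeta> b :: real and x :: "nat \<Rightarrow> 'a::complex_sclcs"
  assumes fast: "fast_decay \<zeta> x" and \<zeta>: "\<zeta> > 0" and b: "b \<ge> 1"
begin

lemma frac_series_summable: "t \<ge> 0 \<Longrightarrow> summable (\<lambda>k. g_ker (\<zeta> * real k + b) t *\<^sub>R x k)"
  using dominated_summable[OF dominated_weight[OF fast \<zeta> b, of "t + 1"],
      of "\<lambda>k. of_real (g_ker (\<zeta> * real k + b) t)"] g_ker_le_weight[OF \<zeta> b, of t "t + 1"]
  by (simp add: scaleR_scaleC)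

text \<open>Removing the first term raises the offset by $\zeta$: this is the mechanism behind the shift by the
  Caputo derivative.\<close>

lemma frac_series_peel:
  assumes t: "t \<ge> 0"
  shows "frac_series \<zeta> b x t = g_ker b t *\<^sub>R x 0 + frac_series \<zeta> (b + \<zeta>) (\<lambda>k. x (k + 1)) t"
proof -
  have "summable (\<lambda>k. g_ker (\<zeta> * real k + (b + \<zeta>)) t *\<^sub>R x (k + 1))"
    using dominated_summable[OF dominated_weight[OF fast_decay_shift[OF fast] \<zeta>, of "b + \<zeta>" "t + 1" 1],
        of "\<lambda>k. of_real (g_ker (\<zeta> * real k + (b + \<zeta>)) t)"]
      g_ker_le_weight[OF \<zeta>, of "b + \<zeta>" t "t + 1"] \<zeta> b t
    by (simp add: scaleR_scaleC)
  then have "(\<lambda>k. g_ker (\<zeta> * real k + (b + \<zeta>)) t *\<^sub>R x (k + 1)) sums frac_series \<zeta> (b + \<zeta>) (\<lambda>k. x (k + 1)) t"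
    unfolding frac_series_def by (rule summable_sums)
  then have "(\<lambda>k. g_ker (\<zeta> * real (Suc k) + b) t *\<^sub>R x (Suc k)) sums frac_series \<zeta> (b + \<zeta>) (\<lambda>k. x (k + 1)) t"
    by (simp add: algebra_simps)
  from sums_Suc[where f="\<lambda>k. g_ker (\<zeta> * real k + b) t *\<^sub>R x k", OF this]
  show ?thesis unfolding frac_series_def by (simp add: sums_iff add.commute)
qed

lemma continuous_on_frac_series: "continuous_on {0..} (frac_series \<zeta> b x)"
  unfolding continuous_on_def
proof
  fix t :: real assume t: "t \<in> {0..}"
  have "((\<lambda>s. \<Sum>k. complex_of_real (g_ker (\<zeta> * real k + b) s) *\<^sub>C x k) \<longlongrightarrow>
      (\<Sum>k. complex_of_real (g_ker (\<zeta> * real k + b) t) *\<^sub>C x k)) (at t within {0..})"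
  proof (rule vector_tannery[OF dominated_weight[OF fast \<zeta> b, of "t + 1"]])
    show "0 < t + 1" using t by simp
    show "((\<lambda>s. complex_of_real (g_ker (\<zeta> * real k + b) s)) \<longlongrightarrow>
        complex_of_real (g_ker (\<zeta> * real k + b) t)) (at t within {0..})" for k
      using continuous_on_g_ker[of "\<zeta> * real k + b"] \<zeta> b t
      by (intro tendsto_of_real) (simp add: continuous_on_def add_increasing)
    have "\<forall>\<^sub>F s in at t within {0..}. s < t + 1"
      by (rule order_tendstoD[OF tendsto_ident_at]) simp
    moreover have "\<forall>\<^sub>F s in at t within {0..}. s \<ge> 0"
      by (auto simp: eventually_at_filter)
    ultimately show "\<forall>\<^sub>F s in at t within {0..}. \<forall>k. cmod (complex_of_real (g_ker (\<zeta> * real k + b) s))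
        \<le> weight \<zeta> b (t + 1) k"
    proof eventually_elim
      case (elim s) then show ?case
        using g_ker_le_weight[OF \<zeta> b, of s "t + 1"] t by simp
    qed
  qed
  then show "(frac_series \<zeta> b x \<longlongrightarrow> frac_series \<zeta> b x t) (at t within {0..})"
    by (simp add: frac_series_def[abs_def] scaleR_scaleC)
qed

text \<open>The difference quotients of the kernels are dominated by the mean value theorem, because the
  derivative of each kernel is the kernel with offset lower by one.\<close>

lemma frac_series_has_derivative:
  assumes t: "t \<ge> 0"
  shows "(diff_quot (frac_series \<zeta> (b + 1) x) t \<longlongrightarrow> frac_series \<zeta> b x t) (at t within {0..})"
proof -
  define dq where "dq s k = (g_ker (\<zeta> * real k + b + 1) s - g_ker (\<zeta> * real k + b + 1) t) / (s - t)" for s k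
  have bk: "\<zeta> * real k + b \<ge> 1" for k using \<zeta> b by (simp add: add_increasing)
  have near: "\<forall>\<^sub>F s in at t within {0..}. 0 \<le> s \<and> s < t + 1 \<and> s \<noteq> t"
    using eventually_conj[OF order_tendstoD(2)[OF tendsto_ident_at[of t "{0..}"], of "t + 1"],
        of "\<lambda>s. 0 \<le> s \<and> s \<noteq> t"]
    by (auto simp: eventually_at_filter elim!: eventually_mono)
  have "((\<lambda>s. \<Sum>k. complex_of_real (dq s k) *\<^sub>C x k) \<longlongrightarrow>
      (\<Sum>k. complex_of_real (g_ker (\<zeta> * real k + b) t) *\<^sub>C x k)) (at t within {0..})"
  proof (rule vector_tannery[OF dominated_weight[OF fast \<zeta> b, of "t + 1"]])
    show "0 < t + 1" using t by simp
    show "((\<lambda>s. complex_of_real (dq s k)) \<longlongrightarrow>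
        complex_of_real (g_ker (\<zeta> * real k + b) t)) (at t within {0..})" for k
      unfolding dq_def
      using g_ker_has_derivative[OF bk t, of k] by (intro tendsto_of_real) (simp add: has_field_derivative_iff)
    show "\<forall>\<^sub>F s in at t within {0..}. \<forall>k. cmod (complex_of_real (dq s k)) \<le> weight \<zeta> b (t + 1) k"
      using near
    proof eventually_elim
      case (elim s)
      show ?case
      proof
        fix k
        let ?g = "g_ker (\<zeta> * real k + b + 1)"
        have "norm (?g s - ?g t) \<le> weight \<zeta> b (t + 1) k * norm (s - t)"
        proof (rule field_differentiable_bound[where S="{0..t+1}"])
          show "(?g has_field_derivative g_ker (\<zeta> * real k + b) r) (at r within {0..t+1})" if "r \<in> {0..t+1}" for r
            by (rule has_field_derivative_subset[OF g_ker_has_derivative[OF bk]]) (use that in auto)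
          show "norm (g_ker (\<zeta> * real k + b) r) \<le> weight \<zeta> b (t + 1) k" if "r \<in> {0..t+1}" for r
            using g_ker_le_weight[OF \<zeta> b, of r "t + 1" k] that t by simp
        qed (use elim t in auto)
        then show "cmod (complex_of_real (dq s k)) \<le> weight \<zeta> b (t + 1) k"
          unfolding norm_of_real using elim by (simp add: dq_def divide_le_eq)
      qed
    qed
  qed
  moreover have "\<forall>\<^sub>F s in at t within {0..}. (\<Sum>k. complex_of_real (dq s k) *\<^sub>C x k) = diff_quot (frac_series \<zeta> (b + 1) x) t s"
    using near
  proof eventually_elim
    case (elim s)
    have sm: "(\<lambda>k. g_ker (\<zeta> * real k + (b + 1)) r *\<^sub>R x k) sums frac_series \<zeta> (b + 1) x r" if "r \<ge> 0" for r
      using dominated_summable[OF dominated_weight[OF fast \<zeta>, of "b + 1" "r + 1"],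
        of "\<lambda>k. of_real (g_ker (\<zeta> * real k + (b + 1)) r)"] g_ker_le_weight[OF \<zeta>, of "b + 1" r "r + 1"] that b
      by (simp add: scaleR_scaleC frac_series_def summable_sums)
    have "(\<lambda>N. (1 / (s - t)) *\<^sub>R ((\<Sum>k<N. g_ker (\<zeta> * real k + (b + 1)) s *\<^sub>R x k) - (\<Sum>k<N. g_ker (\<zeta> * real k + (b + 1)) t *\<^sub>R x k)))
        \<longlonglongrightarrow> (1 / (s - t)) *\<^sub>R (frac_series \<zeta> (b + 1) x s - frac_series \<zeta> (b + 1) x t)"
      using sm[of s] sm[of t] elim t unfolding sums_def
      by (intro tendsto_scaleR' tendsto_const tendsto_diff) auto
    then have "(\<lambda>k. complex_of_real (dq s k) *\<^sub>C x k) sums diff_quot (frac_series \<zeta> (b + 1) x) t s"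
      unfolding sums_def diff_quot_def scaleR_scaleC[symmetric] dq_def
      by (simp add: scaleR_sum_right scaleR_diff_left diff_divide_distrib algebra_simps flip: sum_subtractf)
    then show ?case by (simp add: sums_iff)
  qed
  ultimately show ?thesis
    by (simp add: frac_series_def[of \<zeta> b x] scaleR_scaleC tendsto_cong)
qed

lemma has_lcs_integral_frac_series:
  assumes \<beta>: "0 < \<beta>" "\<beta> < 1" and t: "t > 0"
  shows "has_lcs_integral (\<lambda>s. g_ker \<beta> (t - s) *\<^sub>R frac_series \<zeta> b x s) (frac_series \<zeta> (b + \<beta>) x t) 0 t"
proof -
  have bk: "\<zeta> * real k + b \<ge> 1" for k using \<zeta> b by (simp add: add_increasing)
  have w: "((\<lambda>s. g_ker \<beta> (t - s)) has_integral g_ker (1 + \<beta>) t) {0..t}"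
    by (rule has_integral_eq[OF _ g_ker_convolution[OF \<beta> _ t, of 1]]) (auto simp: g_ker_1)
  have "has_lcs_integral (\<lambda>s. g_ker \<beta> (t - s) *\<^sub>R (\<Sum>k. g_ker (\<zeta> * real k + b) s *\<^sub>R x k))
      (\<Sum>k. g_ker (\<zeta> * real k + b + \<beta>) t *\<^sub>R x k) 0 t"
  proof (rule has_lcs_integral_series[OF _ dominated_weight[OF fast \<zeta> b t] w])
    show "((\<lambda>s. g_ker \<beta> (t - s) * g_ker (\<zeta> * real k + b) s) has_integral g_ker (\<zeta> * real k + b + \<beta>) t) {0..t}" for k
      by (rule g_ker_convolution[OF \<beta> bk t])
    show "\<bar>g_ker (\<zeta> * real k + b) s\<bar> \<le> weight \<zeta> b t k" if "s \<in> {0..t}" for k s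
      using g_ker_le_weight[OF \<zeta> b] that t by simp
  qed (use t \<beta> g_ker_nonneg in auto)
  then show ?thesis by (simp add: frac_series_def[abs_def] add.assoc)
qed

end

section \<open>Derivatives on the half-line\<close>

text \<open>\<^const>\<open>vderiv\<close> is defined by a limit that need not exist; here existence is part of the claim.\<close>

definition has_vderiv :: "(real \<Rightarrow> 'a::complex_sclcs) \<Rightarrow> (real \<Rightarrow> 'a) \<Rightarrow> bool" where
  "has_vderiv f f' \<longleftrightarrow> (\<forall>t\<ge>0. (diff_quot f t \<longlongrightarrow> f' t) (at t within {0..}))"

lemma at_within_half_line:
  assumes "t \<ge> 0" shows "at t within {0::real..} \<noteq> bot"
proof
  assume "at t within {0..} = bot"
  moreover have "at_right t \<le> at t within {0..}" using assms by (intro at_le) auto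
  ultimately show False using trivial_limit_at_right_real[of t] by (simp add: bot_unique)
qed

lemma vderiv_eq: "has_vderiv f f' \<Longrightarrow> t \<ge> 0 \<Longrightarrow> vderiv f t = f' t"
  unfolding vderiv_def has_vderiv_def using at_within_half_line[of t] by (auto intro!: tendsto_Lim)

lemma has_vderiv_cong:
  assumes fg: "\<And>t. t \<ge> 0 \<Longrightarrow> f t = g t" and fg': "\<And>t. t \<ge> 0 \<Longrightarrow> f' t = g' t"
    and f: "has_vderiv f f'"
  shows "has_vderiv g g'"
  unfolding has_vderiv_def
proof (intro allI impI)
  fix t :: real assume t: "t \<ge> 0"
  have "\<forall>\<^sub>F s in at t within {0..}. diff_quot f t s = diff_quot g t s"
    unfolding eventually_at_filter by (rule always_eventually) (use fg t in \<open>auto simp: diff_quot_def\<close>)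
  moreover have "(diff_quot f t \<longlongrightarrow> g' t) (at t within {0..})"
    unfolding fg'[OF t, symmetric] using f t unfolding has_vderiv_def by blast
  ultimately show "(diff_quot g t \<longlongrightarrow> g' t) (at t within {0..})"
    using tendsto_cong by blast
qed

lemma has_vderiv_add:
  assumes "has_vderiv f f'" "has_vderiv g g'"
  shows "has_vderiv (\<lambda>t. f t + g t) (\<lambda>t. f' t + g' t)"
  unfolding has_vderiv_def
proof (intro allI impI)
  fix t :: real assume t: "t \<ge> 0"
  have "((\<lambda>s. diff_quot f t s + diff_quot g t s) \<longlongrightarrow> f' t + g' t) (at t within {0..})"
    using assms t unfolding has_vderiv_def by (intro tendsto_add) auto
  also have "(\<lambda>s. diff_quot f t s + diff_quot g t s) = diff_quot (\<lambda>t. f t + g t) t"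
    by (simp add: diff_quot_def fun_eq_iff algebra_simps)
  finally show "(diff_quot (\<lambda>t. f t + g t) t \<longlongrightarrow> f' t + g' t) (at t within {0..})" .
qed

lemma has_vderiv_const: "has_vderiv (\<lambda>_. c) (\<lambda>_. 0)"
  unfolding has_vderiv_def diff_quot_def by simp

lemma iterated_vderiv:
  assumes "\<And>t. t \<ge> 0 \<Longrightarrow> f t = h 0 t" "\<And>j. j < k \<Longrightarrow> has_vderiv (h j) (h (Suc j))" "j \<le> k" "t \<ge> 0"
  shows "(vderiv ^^ j) f t = h j t"
  using assms(3,4)
proof (induction j arbitrary: t)
  case (Suc j)
  have "has_vderiv ((vderiv ^^ j) f) (h (Suc j))"
  proof (rule has_vderiv_cong[OF _ _ assms(2)])
    show "h j t = (vderiv ^^ j) f t" if "t \<ge> 0" for t using Suc.IH[of t] Suc.prems(1) that by simp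
  qed (use Suc.prems in auto)
  from vderiv_eq[OF this] show ?case using Suc.prems by simp
qed (use assms(1) in auto)

text \<open>The iterates of \<^const>\<open>vderiv\<close> are identified on the half-line with a given chain of
  derivatives \<open>h\<close>; for negative arguments they are arbitrary.\<close>

lemma C_kI:
  assumes f: "\<And>t. t \<ge> 0 \<Longrightarrow> f t = h 0 t" and h: "\<And>j. j < k \<Longrightarrow> has_vderiv (h j) (h (Suc j))"
    and c: "\<And>j. j \<le> k \<Longrightarrow> continuous_on {0..} (h j)"
  shows "C_k k f"
proof -
  have eq: "(vderiv ^^ j) f t = h j t" if "j \<le> k" "t \<ge> 0" for j t
    using iterated_vderiv[OF f h] that by blast
  have "has_vderiv ((vderiv ^^ j) f) ((vderiv ^^ Suc j) f)" if "j < k" for j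
    by (rule has_vderiv_cong[OF _ _ h[OF that]]) (use eq that in \<open>auto simp del: funpow.simps\<close>)
  moreover have "continuous_on {0..} ((vderiv ^^ j) f)" if "j \<le> k" for j
    by (rule continuous_on_eq[OF c[OF that]]) (use eq that in auto)
  ultimately show ?thesis unfolding C_k_def has_vderiv_def by blast
qed

section \<open>The Caputo derivative shifts fractional power series\<close>

text \<open>For $\zeta \le 1$ there are no second initial values, and the series that carries them is absent.\<close>

definition frac_sol :: "real \<Rightarrow> real \<Rightarrow> (nat \<Rightarrow> 'a::complex_sclcs) \<Rightarrow> (nat \<Rightarrow> 'a) \<Rightarrow> real \<Rightarrow> 'a" where
  "frac_sol \<zeta> b x y t = frac_series \<zeta> b x t + (if \<zeta> > 1 then frac_series \<zeta> (b + 1) y t else 0)"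

context
  fixes \<zeta> :: real and x y :: "nat \<Rightarrow> 'a::complex_sclcs"
  assumes \<zeta>: "0 < \<zeta>" "\<zeta> \<le> 2" and x: "fast_decay \<zeta> x" and y: "fast_decay \<zeta> y"
begin

lemma has_vderiv_frac_sol: "b \<ge> 1 \<Longrightarrow> has_vderiv (frac_sol \<zeta> (b + 1) x y) (frac_sol \<zeta> b x y)"
proof (cases "\<zeta> > 1")
  case True
  assume b: "b \<ge> 1"
  have "has_vderiv (\<lambda>t. frac_series \<zeta> (b + 1) x t + frac_series \<zeta> ((b + 1) + 1) y t)
      (\<lambda>t. frac_series \<zeta> b x t + frac_series \<zeta> (b + 1) y t)"
    using frac_series_has_derivative[OF x \<zeta>(1) b] frac_series_has_derivative[OF y \<zeta>(1), of "b + 1"] b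
    by (intro has_vderiv_add) (auto simp: has_vderiv_def)
  then show ?thesis using True by (simp add: frac_sol_def[abs_def])
next
  case False
  assume b: "b \<ge> 1"
  then show ?thesis using False frac_series_has_derivative[OF x \<zeta>(1) b]
    by (simp add: frac_sol_def[abs_def] has_vderiv_def)
qed

lemma continuous_on_frac_sol: "b \<ge> 1 \<Longrightarrow> continuous_on {0..} (frac_sol \<zeta> b x y)"
proof (cases "\<zeta> > 1")
  case True
  assume b: "b \<ge> 1"
  then show ?thesis
    using continuous_on_frac_series[OF x \<zeta>(1) b] continuous_on_frac_series[OF y \<zeta>(1), of "b + 1"] True
    by (simp add: frac_sol_def[abs_def] continuous_on_def) (auto intro!: tendsto_add)
next
  case False
  assume b: "b \<ge> 1"
  then show ?thesis using False continuous_on_frac_series[OF x \<zeta>(1) b]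
    by (simp add: frac_sol_def[abs_def])
qed

lemma frac_sol_peel:
  assumes "t \<ge> 0" "b \<ge> 1"
  shows "frac_sol \<zeta> b x y t = g_ker b t *\<^sub>R x 0 + (if \<zeta> > 1 then g_ker (b + 1) t *\<^sub>R y 0 else 0)
    + frac_sol \<zeta> (b + \<zeta>) (\<lambda>k. x (k + 1)) (\<lambda>k. y (k + 1)) t"
  using frac_series_peel[OF x \<zeta>(1) assms(2,1)] frac_series_peel[OF y \<zeta>(1) _ assms(1), of "b + 1"] assms
  by (simp add: frac_sol_def add_ac)

text \<open>Fractional integration raises the offset by $\beta$. For $\beta = 0$ the kernel is the Dirac delta, and
  at $t = 0$ both sides vanish because $b > 1$.\<close>

lemma g_conv_frac_sol:
  assumes \<beta>: "0 \<le> \<beta>" "\<beta> < 1" and t: "t \<ge> 0" and b: "b > 1"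
    and f: "\<And>s. s \<ge> 0 \<Longrightarrow> f s = frac_sol \<zeta> b x y s"
  shows "g_conv \<beta> f t = frac_sol \<zeta> (b + \<beta>) x y t"
proof (cases "\<beta> = 0 \<or> t = 0")
  case True
  show ?thesis
  proof (cases "\<beta> = 0")
    case True then show ?thesis using f t by (simp add: g_conv_def)
  next
    case False
    then have t0: "t = 0" using True by simp
    have "lcs_integral 0 0 (\<lambda>s. g_ker \<beta> (0 - s) *\<^sub>R f s) = 0"
    proof (rule lcs_integral_unique, unfold has_lcs_integral_def, rule tendsto_eventually)
      show "\<forall>\<^sub>F P in division_filter (cbox 0 (0::real)). (\<Sum>(s, K)\<in>P. measure lborel K *\<^sub>R g_ker \<beta> (0 - s) *\<^sub>R f s) = 0"
        using eventually_division_filter_tagged_division[of "cbox 0 (0::real)"]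
      proof eventually_elim
        case (elim P)
        have "fst i = 0" if "i \<in> P" for i
          using tagged_division_ofD(2,3)[OF elim, of "fst i" "snd i"] that by auto
        then show ?case using False \<beta> by (intro sum.neutral) (simp add: g_ker_0 split_def)
      qed
    qed
    then show ?thesis using False t0 b \<beta> by (simp add: g_conv_def frac_sol_def frac_series_at_0[OF \<zeta>(1)])
  qed
next
  case False
  then have \<beta>': "0 < \<beta>" and t': "t > 0" using \<beta> t by auto
  have I: "has_lcs_integral (\<lambda>s. g_ker \<beta> (t - s) *\<^sub>R frac_series \<zeta> b x s) (frac_series \<zeta> (b + \<beta>) x t) 0 t"
    using b by (intro has_lcs_integral_frac_series[OF x \<zeta>(1) _ \<beta>' \<beta>(2) t']) simp
  have J: "has_lcs_integral (\<lambda>s. g_ker \<beta> (t - s) *\<^sub>R frac_series \<zeta> (b + 1) y s) (frac_series \<zeta> (b + 1 + \<beta>) y t) 0 t"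
    using b by (intro has_lcs_integral_frac_series[OF y \<zeta>(1) _ \<beta>' \<beta>(2) t']) simp
  have "has_lcs_integral (\<lambda>s. g_ker \<beta> (t - s) *\<^sub>R frac_sol \<zeta> b x y s) (frac_sol \<zeta> (b + \<beta>) x y t) 0 t"
  proof (cases "\<zeta> > 1")
    case True
    then show ?thesis using has_lcs_integral_add[OF I J]
      by (simp add: frac_sol_def[abs_def] scaleR_add_right add_ac)
  qed (use I in \<open>simp add: frac_sol_def[abs_def]\<close>)
  from lcs_integral_unique[OF this]
  have "lcs_integral 0 t (\<lambda>s. g_ker \<beta> (t - s) *\<^sub>R f s) = frac_sol \<zeta> (b + \<beta>) x y t"
    using lcs_integral_cong[of 0 t "\<lambda>s. g_ker \<beta> (t - s) *\<^sub>R f s" "\<lambda>s. g_ker \<beta> (t - s) *\<^sub>R frac_sol \<zeta> b x y s"] f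
    by simp
  then show ?thesis using False by (simp add: g_conv_def)
qed

lemma frac_sol_0: "frac_sol \<zeta> 1 x y 0 = x 0"
  using frac_sol_peel[of 0 1] \<zeta>(1) by (simp add: frac_sol_def frac_series_at_0[OF \<zeta>(1)] g_ker_def)

lemma has_vderiv_frac_sol_1:
  assumes "\<zeta> > 1"
  shows "has_vderiv (frac_sol \<zeta> 1 x y) (\<lambda>t. frac_series \<zeta> \<zeta> (\<lambda>k. x (k + 1)) t + frac_series \<zeta> 1 y t)"
proof -
  have "has_vderiv (\<lambda>t. x 0 + frac_series \<zeta> (\<zeta> + 1) (\<lambda>k. x (k + 1)) t + frac_series \<zeta> (1 + 1) y t)
     (\<lambda>t. 0 + frac_series \<zeta> \<zeta> (\<lambda>k. x (k + 1)) t + frac_series \<zeta> 1 y t)"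
    using frac_series_has_derivative[OF fast_decay_shift[OF x] \<zeta>(1), of \<zeta> _ 1]
      frac_series_has_derivative[OF y \<zeta>(1), of 1] assms
    by (intro has_vderiv_add has_vderiv_const) (auto simp: has_vderiv_def)
  then show ?thesis
    by (rule has_vderiv_cong[rotated 2])
      (use frac_series_peel[OF x \<zeta>(1), of 1] assms in \<open>auto simp: frac_sol_def g_ker_1 add_ac\<close>)
qed

lemma vderiv_frac_sol_0:
  assumes "\<zeta> > 1" and u: "\<And>t. t \<ge> 0 \<Longrightarrow> u t = frac_sol \<zeta> 1 x y t"
  shows "vderiv u 0 = y 0"
proof -
  have "vderiv u 0 = frac_series \<zeta> \<zeta> (\<lambda>k. x (k + 1)) 0 + frac_series \<zeta> 1 y 0"
    by (rule vderiv_eq[OF has_vderiv_cong[OF _ _ has_vderiv_frac_sol_1[OF assms(1)]]]) (auto simp: u)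
  also have "frac_series \<zeta> \<zeta> (\<lambda>k. x (k + 1)) 0 = 0"
    by (rule frac_series_at_0[OF \<zeta>(1) assms(1)])
  also have "frac_series \<zeta> 1 y 0 = y 0"
    using frac_series_peel[OF y \<zeta>(1), of 1 0] \<zeta>(1) by (simp add: frac_series_at_0[OF \<zeta>(1)] g_ker_1)
  finally show ?thesis by simp
qed

end

text \<open>Subtracting the initial values removes the leading terms, which leaves the shifted sequences with
  offset $1+\zeta$. Convolution with $g_{m-\zeta}$, $m = \lceil\zeta\rceil$, raises this to $1+m$, and $m$
  derivatives bring it back to $1$.\<close>

lemma caputo_frac_sol:
  assumes \<zeta>: "0 < \<zeta>" "\<zeta> \<le> 2" and x: "fast_decay \<zeta> x" and y: "fast_decay \<zeta> y"
    and u: "\<And>t. t \<ge> 0 \<Longrightarrow> u t = frac_sol \<zeta> 1 x y t"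
  shows "caputo_defined \<zeta> u \<and>
    (\<forall>t\<ge>0. caputo \<zeta> u t = frac_sol \<zeta> 1 (\<lambda>k. x (k + 1)) (\<lambda>k. y (k + 1)) t)"
proof -
  define m where "m = nat \<lceil>\<zeta>\<rceil>"
  let ?x = "\<lambda>k. x (k + 1)" and ?y = "\<lambda>k. y (k + 1)"
  have fx: "fast_decay \<zeta> ?x" and fy: "fast_decay \<zeta> ?y"
    using fast_decay_shift x y by blast+
  have m: "m = (if \<zeta> > 1 then 2 else 1)"
  proof (cases "\<zeta> > 1")
    case True then have "\<lceil>\<zeta>\<rceil> = 2" using \<zeta> by (simp add: ceiling_eq_iff)
    then show ?thesis using True by (simp add: m_def)
  next
    case False then have "\<lceil>\<zeta>\<rceil> = 1" using \<zeta> by (simp add: ceiling_eq_iff)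
    then show ?thesis using False by (simp add: m_def)
  qed
  have ceil: "real_of_int \<lceil>\<zeta>\<rceil> = real m" using \<zeta>(1) by (simp add: m_def)
  have C1: "C_k (m - 1) u"
  proof (cases "\<zeta> > 1")
    case True
    \<comment> \<open>The series for \<open>x\<close> loses its constant term under the derivative, so its offset becomes \<open>\<zeta>\<close>.\<close>
    define h where "h = (\<lambda>j::nat. if j = 0 then frac_sol \<zeta> 1 x y
        else (\<lambda>t. frac_series \<zeta> \<zeta> ?x t + frac_series \<zeta> 1 y t))"
    show ?thesis
    proof (rule C_kI[where h=h])
      show "has_vderiv (h j) (h (Suc j))" if "j < m - 1" for j
        using that True has_vderiv_frac_sol_1[OF \<zeta> x y] by (simp add: m h_def)
      show "continuous_on {0..} (h j)" for j
        using True continuous_on_frac_sol[OF \<zeta> x y, of 1] continuous_on_frac_series[OF fx \<zeta>(1), of \<zeta>]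
          continuous_on_frac_series[OF y \<zeta>(1), of 1]
        by (auto simp: h_def continuous_on_def intro!: tendsto_add)
    qed (use u in \<open>simp add: h_def\<close>)
  next
    case False
    show ?thesis
      by (rule C_kI[where h="\<lambda>_. frac_sol \<zeta> 1 x y"]) (use u False continuous_on_frac_sol[OF \<zeta> x y, of 1] in \<open>auto simp: m\<close>)
  qed
  have init: "u t - (\<Sum>j<m. g_ker (real j + 1) t *\<^sub>R (vderiv ^^ j) u 0) = frac_sol \<zeta> (1 + \<zeta>) ?x ?y t"
    if "t \<ge> 0" for t
    using frac_sol_peel[OF \<zeta> x y that, of 1] u[OF that] u[of 0] frac_sol_0[OF \<zeta> x y] vderiv_frac_sol_0[OF \<zeta> x y _ u]
    by (auto simp: m numeral_2_eq_2 add_ac)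
  have aux: "caputo_aux \<zeta> u t = frac_sol \<zeta> (1 + real m) ?x ?y t" if "t \<ge> 0" for t
  proof -
    have "caputo_aux \<zeta> u t = frac_sol \<zeta> (1 + \<zeta> + (real m - \<zeta>)) ?x ?y t"
      unfolding caputo_aux_def m_def[symmetric] ceil
      by (rule g_conv_frac_sol[OF \<zeta> fx fy]) (use \<zeta> that init in \<open>auto simp: m split: if_splits\<close>)
    then show ?thesis by simp
  qed
  define h where "h j = frac_sol \<zeta> (1 + real (m - j)) ?x ?y" for j
  have h: "has_vderiv (h j) (h (Suc j))" if "j < m" for j
  proof -
    have "real (m - j) = real (m - Suc j) + 1" using that by simp
    then show ?thesis
      using has_vderiv_frac_sol[OF \<zeta> fx fy, of "1 + real (m - Suc j)"] by (simp add: h_def add_ac)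
  qed
  have hc: "continuous_on {0..} (h j)" for j
    unfolding h_def by (rule continuous_on_frac_sol[OF \<zeta> fx fy]) simp
  have h0: "caputo_aux \<zeta> u t = h 0 t" if "t \<ge> 0" for t using aux[OF that] by (simp add: h_def)
  have "C_k m (caputo_aux \<zeta> u)" by (rule C_kI[OF h0 h hc])
  moreover have "caputo \<zeta> u t = frac_sol \<zeta> 1 ?x ?y t" if "t \<ge> 0" for t
    unfolding caputo_def m_def[symmetric]
    using iterated_vderiv[OF h0 h order_refl that] by (simp add: h_def)
  ultimately show ?thesis using C1 unfolding caputo_defined_def m_def[symmetric] by blast
qed

lemma caputo_pow_frac_sol:
  assumes \<zeta>: "0 < \<zeta>" "\<zeta> \<le> 2" and x: "fast_decay \<zeta> x" and y: "fast_decay \<zeta> y"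
    and t: "t \<ge> 0"
  shows "(caputo \<zeta> ^^ j) (frac_sol \<zeta> 1 x y) t = frac_sol \<zeta> 1 (\<lambda>k. x (k + j)) (\<lambda>k. y (k + j)) t"
  using t
proof (induction j arbitrary: t)
  case (Suc j)
  have "\<forall>t\<ge>0. caputo \<zeta> ((caputo \<zeta> ^^ j) (frac_sol \<zeta> 1 x y)) t
      = frac_sol \<zeta> 1 (\<lambda>k. x (k + 1 + j)) (\<lambda>k. y (k + 1 + j)) t"
    using caputo_frac_sol[OF \<zeta> fast_decay_shift[OF x] fast_decay_shift[OF y] Suc.IH] by blast
  then show ?case using Suc.prems by (simp add: add_ac)
qed simp

lemma caputo_pow_defined_frac_sol:
  assumes \<zeta>: "0 < \<zeta>" "\<zeta> \<le> 2" and x: "fast_decay \<zeta> x" and y: "fast_decay \<zeta> y"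
  shows "caputo_pow_defined \<zeta> p (frac_sol \<zeta> 1 x y)"
  unfolding caputo_pow_defined_def
  using caputo_frac_sol[OF \<zeta> fast_decay_shift[OF x] fast_decay_shift[OF y] caputo_pow_frac_sol[OF assms]]
  by blast

section \<open>Extension of the solutions to the complex plane\<close>

lemma lcs_analytic_on_add:
  fixes f g :: "complex \<Rightarrow> 'a::complex_sclcs"
  assumes "lcs_analytic_on f S" "lcs_analytic_on g S"
  shows "lcs_analytic_on (\<lambda>z. f z + g z) S"
  unfolding lcs_analytic_on_def
proof
  fix z assume z: "z \<in> S"
  obtain r c where r: "r > 0" and c: "\<And>U. open U \<Longrightarrow> 0 \<in> U \<Longrightarrow>
      \<exists>N. \<forall>m\<ge>N. \<forall>w\<in>ball z r. f w - (\<Sum>k<m. (w - z) ^ k *\<^sub>C c k) \<in> U"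
    using assms(1) z unfolding lcs_analytic_on_def by meson
  obtain s d where s: "s > 0" and d: "\<And>U. open U \<Longrightarrow> 0 \<in> U \<Longrightarrow>
      \<exists>N. \<forall>m\<ge>N. \<forall>w\<in>ball z s. g w - (\<Sum>k<m. (w - z) ^ k *\<^sub>C d k) \<in> U"
    using assms(2) z unfolding lcs_analytic_on_def by meson
  show "\<exists>\<rho>>0. \<exists>e :: nat \<Rightarrow> 'a. \<forall>U. open U \<and> 0 \<in> U \<longrightarrow>
        (\<exists>N. \<forall>m\<ge>N. \<forall>w\<in>ball z \<rho>. f w + g w - (\<Sum>k<m. (w - z) ^ k *\<^sub>C e k) \<in> U)"
  proof (intro exI[of _ "min r s"] exI[of _ "\<lambda>k. c k + d k"] conjI allI impI)
    fix U :: "'a set" assume U: "open U \<and> 0 \<in> U"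
    have "((\<lambda>(x, y). x + y) \<longlongrightarrow> 0 + 0) (nhds (0::'a) \<times>\<^sub>F nhds 0)"
      unfolding case_prod_unfold by (rule tendsto_add_Pair)
    then have "\<forall>\<^sub>F p in nhds (0::'a) \<times>\<^sub>F nhds 0. (\<lambda>(x, y). x + y) p \<in> U"
      by (rule topological_tendstoD) (use U in auto)
    then obtain P Q where PQ: "eventually P (nhds (0::'a))" "eventually Q (nhds (0::'a))"
      "\<And>x y. P x \<Longrightarrow> Q y \<Longrightarrow> x + y \<in> U"
      unfolding eventually_prod_filter by auto
    obtain V where V: "open V" "0 \<in> V" "\<And>x. x \<in> V \<Longrightarrow> P x" using PQ(1) unfolding eventually_nhds by blast
    obtain W where W: "open W" "0 \<in> W" "\<And>x. x \<in> W \<Longrightarrow> Q x" using PQ(2) unfolding eventually_nhds by blast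
    obtain M where M: "\<And>m w. m \<ge> M \<Longrightarrow> w \<in> ball z r \<Longrightarrow> f w - (\<Sum>k<m. (w - z) ^ k *\<^sub>C c k) \<in> V"
      using c[OF V(1,2)] by blast
    obtain N where N: "\<And>m w. m \<ge> N \<Longrightarrow> w \<in> ball z s \<Longrightarrow> g w - (\<Sum>k<m. (w - z) ^ k *\<^sub>C d k) \<in> W"
      using d[OF W(1,2)] by blast
    show "\<exists>N. \<forall>m\<ge>N. \<forall>w\<in>ball z (min r s). f w + g w - (\<Sum>k<m. (w - z) ^ k *\<^sub>C (c k + d k)) \<in> U"
    proof (intro exI[of _ "max M N"] allI impI ballI)
      fix m w assume "max M N \<le> m" "w \<in> ball z (min r s)"
      then have "(f w - (\<Sum>k<m. (w - z) ^ k *\<^sub>C c k)) + (g w - (\<Sum>k<m. (w - z) ^ k *\<^sub>C d k)) \<in> U"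
        by (intro PQ(3) V(3) W(3) M N) auto
      then show "f w + g w - (\<Sum>k<m. (w - z) ^ k *\<^sub>C (c k + d k)) \<in> U"
        by (simp add: scaleC_add_right sum.distrib algebra_simps)
    qed
  qed (use r s in auto)
qed

definition frac_coeff :: "real \<Rightarrow> nat \<Rightarrow> nat \<Rightarrow> complex \<Rightarrow> complex \<Rightarrow> complex" where
  "frac_coeff \<zeta> d k v z = v ^ k * z ^ d / of_real (Gamma (\<zeta> * real k + (real d + 1)))"

text \<open>The function \<open>h\<close> is a version of $z^\zeta$: the principal branch on the slit plane, or the
  monomial if $\zeta$ is an integer. Powers of \<open>h z\<close>, with $0^0 = 1$, give the term for \<open>k = 0\<close> its correct
  value at the origin.\<close>

definition complex_series ::
    "real \<Rightarrow> nat \<Rightarrow> (complex \<Rightarrow> complex) \<Rightarrow> (nat \<Rightarrow> 'a::complex_sclcs) \<Rightarrow> complex \<Rightarrow> 'a" where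
  "complex_series \<zeta> d h x z = (\<Sum>k. frac_coeff \<zeta> d k (h z) z *\<^sub>C x k)"

context
  fixes \<zeta> :: real and d :: nat and h :: "complex \<Rightarrow> complex" and x :: "nat \<Rightarrow> 'a::complex_sclcs"
    and T :: "complex set"
  assumes \<zeta>: "\<zeta> > 0" and x: "fast_decay \<zeta> x" and h: "\<And>z. z \<in> T \<Longrightarrow> cmod (h z) \<le> cmod z powr \<zeta>"
begin

lemma complex_series_term_le:
  assumes "z \<in> T" "cmod z \<le> R" "R > 0"
  shows "cmod (frac_coeff \<zeta> d k (h z) z) \<le> weight \<zeta> (real d + 1) R k"
proof -
  have G: "Gamma (\<zeta> * real k + (real d + 1)) > 0" using \<zeta> by (intro Gamma_real_pos add_nonneg_pos) auto
  have "cmod (h z) \<le> R powr \<zeta>"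
    using h[OF assms(1)] powr_mono2[of \<zeta> "cmod z" R] \<zeta> assms by simp
  then have "cmod (h z) ^ k * cmod z ^ d \<le> (R powr \<zeta>) ^ k * R ^ d"
    using assms by (intro mult_mono power_mono) auto
  moreover have "R ^ d = R powr (real d + 1 - 1)" using assms by (simp add: powr_realpow)
  ultimately show ?thesis
    using G by (simp add: weight_def frac_coeff_def norm_mult norm_divide norm_power divide_right_mono)
qed

lemma lcs_analytic_on_complex_series:
  assumes T: "open S" "S \<subseteq> T" "h holomorphic_on S"
  shows "lcs_analytic_on (complex_series \<zeta> d h x) S"
  unfolding complex_series_def[abs_def]
proof (rule lcs_analytic_on_series)
  fix z assume "z \<in> S"
  then obtain \<rho> where \<rho>: "\<rho> > 0" "ball z \<rho> \<subseteq> S" using T(1) open_contains_ball by blast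
  let ?R = "cmod z + \<rho>"
  have "cmod w \<le> ?R" if "w \<in> ball z \<rho>" for w
    using that norm_triangle_ineq2[of w z] by (simp add: dist_norm norm_minus_commute)
  moreover have "(\<lambda>z. frac_coeff \<zeta> d k (h z) z) holomorphic_on ball z \<rho>" for k
    unfolding frac_coeff_def using \<zeta> Gamma_real_nonzero[of "\<zeta> * real k + (real d + 1)"]
    by (intro holomorphic_intros holomorphic_on_subset[OF T(3) \<rho>(2)]) (auto simp: add_nonneg_pos)
  moreover have "dominated (weight \<zeta> (real d + 1) ?R) x"
    using \<rho>(1) by (intro dominated_weight[OF x \<zeta>]) (auto simp: add_nonneg_pos)
  ultimately show "\<exists>\<rho>>0. \<exists>M. dominated M x \<and>
      (\<forall>k. (\<lambda>z. frac_coeff \<zeta> d k (h z) z) holomorphic_on ball z \<rho> \<and>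
      (\<forall>w\<in>ball z \<rho>. cmod (frac_coeff \<zeta> d k (h w) w) \<le> M k))"
    using \<rho> T(2)
    by (intro exI[of _ \<rho>] exI[of _ "weight \<zeta> (real d + 1) ?R"] conjI allI ballI complex_series_term_le)
       (auto simp: add_nonneg_pos)
qed

lemma continuous_on_complex_series:
  assumes "continuous_on T h"
  shows "continuous_on T (complex_series \<zeta> d h x)"
  unfolding continuous_on_def complex_series_def[abs_def]
proof
  fix z assume z: "z \<in> T"
  have R: "cmod z + 1 > 0" using norm_ge_zero[of z] by linarith
  show "((\<lambda>z. \<Sum>k. frac_coeff \<zeta> d k (h z) z *\<^sub>C x k) \<longlongrightarrow>
     (\<Sum>k. frac_coeff \<zeta> d k (h z) z *\<^sub>C x k)) (at z within T)"
  proof (rule vector_tannery[OF dominated_weight[OF x \<zeta> _ R, of "real d + 1"]])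
    fix k
    have "Gamma (\<zeta> * real k + (real d + 1)) \<noteq> 0" using \<zeta> by (intro Gamma_real_nonzero add_nonneg_pos) auto
    then show "((\<lambda>z. frac_coeff \<zeta> d k (h z) z) \<longlongrightarrow>
        frac_coeff \<zeta> d k (h z) z) (at z within T)"
      using assms z unfolding continuous_on_def frac_coeff_def by (intro tendsto_intros) auto
  next
    have "((\<lambda>w. cmod w) \<longlongrightarrow> cmod z) (at z within T)" by (intro tendsto_intros)
    then have "\<forall>\<^sub>F w in at z within T. cmod w < cmod z + 1" by (rule order_tendstoD) simp
    moreover have "\<forall>\<^sub>F w in at z within T. w \<in> T" by (auto simp: eventually_at_filter)
    ultimately show "\<forall>\<^sub>F w in at z within T. \<forall>k. cmod (frac_coeff \<zeta> d k (h w) w)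
        \<le> weight \<zeta> (real d + 1) (cmod z + 1) k"
      by eventually_elim (use complex_series_term_le[OF _ _ R] in auto)
  qed simp
qed

end

lemma complex_series_of_real:
  assumes h: "h (of_real t) = of_real (t powr \<zeta>)" and t: "t \<ge> 0" and \<zeta>: "\<zeta> > 0"
  shows "complex_series \<zeta> d h x (of_real t) = frac_series \<zeta> (real d + 1) x t"
proof -
  have "h (of_real t) ^ k * of_real t ^ d / of_real (Gamma (\<zeta> * real k + (real d + 1)))
      = complex_of_real (g_ker (\<zeta> * real k + (real d + 1)) t)" for k
  proof (cases "t = 0")
    case True
    have "\<zeta> * real k + real d = 0 \<longleftrightarrow> k = 0 \<and> d = 0"
      using \<zeta> by (simp add: add_nonneg_eq_0_iff)
    then show ?thesis using True h by (simp add: g_ker_def power_0_left)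
  next
    case False
    then have "(t powr \<zeta>) ^ k * t ^ d = t powr (\<zeta> * real k + (real d + 1) - 1)"
      using t by (simp add: powr_add powr_power powr_realpow mult.commute)
    then have "h (of_real t) ^ k * of_real t ^ d = complex_of_real (t powr (\<zeta> * real k + (real d + 1) - 1))"
      unfolding h by (simp flip: of_real_power of_real_mult)
    then show ?thesis using False t by (simp add: g_ker_pos)
  qed
  then show ?thesis by (simp add: complex_series_def frac_coeff_def frac_series_def scaleR_scaleC)
qed

lemma norm_complex_powr: "cmod (z powr of_real \<zeta>) = cmod z powr \<zeta>"
  by (simp add: powr_def norm_exp_eq_Re)

lemma continuous_on_powr_slit:
  assumes "\<zeta> > 0"
  shows "continuous_on (UNIV - complex_of_real ` {..<0}) (\<lambda>z. z powr of_real \<zeta>)"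
  unfolding continuous_on_def
proof
  fix z assume z: "z \<in> UNIV - complex_of_real ` {..<0}"
  show "((\<lambda>z. z powr of_real \<zeta>) \<longlongrightarrow> z powr of_real \<zeta>) (at z within UNIV - complex_of_real ` {..<0})"
  proof (cases "z = 0")
    case True
    have "((\<lambda>z. cmod z powr \<zeta>) \<longlongrightarrow> 0 powr \<zeta>) (at 0 within UNIV - complex_of_real ` {..<0})"
      using assms tendsto_norm_zero[OF tendsto_ident_at, of "UNIV - complex_of_real ` {..<0}"]
      by (intro tendsto_powr') auto
    then have "((\<lambda>z. z powr of_real \<zeta>) \<longlongrightarrow> 0) (at 0 within UNIV - complex_of_real ` {..<0})"
      by (intro tendsto_norm_zero_cancel[where f="\<lambda>z. z powr of_real \<zeta>"]) (simp add: norm_complex_powr)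
    then show ?thesis by (simp add: True)
  next
    case False
    have "z \<notin> \<real>\<^sub>\<le>\<^sub>0"
    proof
      assume "z \<in> \<real>\<^sub>\<le>\<^sub>0"
      then obtain r where "z = of_real r" "r \<le> 0" by (auto simp: nonpos_Reals_def)
      then show False using z False by (cases "r = 0") auto
    qed
    then show ?thesis by (intro tendsto_intros) auto
  qed
qed

lemma slit_eq: "UNIV - complex_of_real ` {..0} = - \<real>\<^sub>\<le>\<^sub>0"
  by (auto simp: nonpos_Reals_def)

context
  fixes \<zeta> :: real and x y :: "nat \<Rightarrow> 'a::complex_sclcs"
  assumes \<zeta>: "0 < \<zeta>" "\<zeta> \<le> 2" and x: "fast_decay \<zeta> x" and y: "fast_decay \<zeta> y"
begin

lemma extends_slit_frac_sol: "extends_slit (frac_sol \<zeta> 1 x y)"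
proof -
  let ?h = "\<lambda>z. z powr of_real \<zeta>"
  let ?F = "\<lambda>z. complex_series \<zeta> 0 ?h x z + (if \<zeta> > 1 then complex_series \<zeta> 1 ?h y z else 0)"
  have h: "?h (complex_of_real t) = complex_of_real (t powr \<zeta>)" if "t \<ge> 0" for t
    using that by (simp add: powr_of_real)
  have hol: "?h holomorphic_on (UNIV - complex_of_real ` {..0})"
    unfolding slit_eq by (intro holomorphic_intros) auto
  have le: "cmod (?h z) \<le> cmod z powr \<zeta>" for z by (simp add: norm_complex_powr)
  have an: "lcs_analytic_on (complex_series \<zeta> d ?h z) (UNIV - complex_of_real ` {..0})"
    if "fast_decay \<zeta> z" for d and z :: "nat \<Rightarrow> 'a"
    by (rule lcs_analytic_on_complex_series[OF \<zeta>(1) that le _ _ hol, of UNIV])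
       (auto simp: slit_eq intro: closed_nonpos_Reals_complex)
  have co: "continuous_on (UNIV - complex_of_real ` {..<0}) (complex_series \<zeta> d ?h z)"
    if "fast_decay \<zeta> z" for d and z :: "nat \<Rightarrow> 'a"
    by (rule continuous_on_complex_series[OF \<zeta>(1) that le continuous_on_powr_slit[OF \<zeta>(1)]])
  have "?F (complex_of_real t) = frac_sol \<zeta> 1 x y t" if "t \<ge> 0" for t
    using complex_series_of_real[of ?h t \<zeta> 0 x, OF h[OF that] that \<zeta>(1)]
      complex_series_of_real[of ?h t \<zeta> 1 y, OF h[OF that] that \<zeta>(1)]
    by (simp add: frac_sol_def)
  moreover have "lcs_analytic_on ?F (UNIV - complex_of_real ` {..0})"
    using an[OF x, of 0] lcs_analytic_on_add[OF an[OF x, of 0] an[OF y, of 1]] by (cases "\<zeta> > 1") simp_all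
  moreover have "continuous_on (UNIV - complex_of_real ` {..<0}) ?F"
    using co[OF x, of 0] co[OF y, of 1] by (cases "\<zeta> > 1") (auto simp: continuous_on_def intro!: tendsto_add)
  ultimately show ?thesis unfolding extends_slit_def by (intro exI[of _ ?F] conjI allI impI)
qed

lemma extends_entire_frac_sol:
  assumes N: "\<zeta> = real N"
  shows "extends_entire (frac_sol \<zeta> 1 x y)"
proof -
  let ?h = "\<lambda>z::complex. z ^ N"
  let ?F = "\<lambda>z. complex_series \<zeta> 0 ?h x z + (if \<zeta> > 1 then complex_series \<zeta> 1 ?h y z else 0)"
  have N0: "N > 0" using \<zeta>(1) N by simp
  have h: "?h (complex_of_real t) = complex_of_real (t powr \<zeta>)" if "t \<ge> 0" for t
    using that N N0 by (cases "t = 0") (simp_all add: powr_realpow)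
  have le: "cmod (?h z) \<le> cmod z powr \<zeta>" for z
    using N N0 by (cases "z = 0") (simp_all add: norm_power powr_realpow power_0_left)
  have an: "lcs_analytic_on (complex_series \<zeta> d ?h z) UNIV" if "fast_decay \<zeta> z" for d and z :: "nat \<Rightarrow> 'a"
    by (rule lcs_analytic_on_complex_series[OF \<zeta>(1) that le, of UNIV]) (auto intro: holomorphic_intros)
  have "?F (complex_of_real t) = frac_sol \<zeta> 1 x y t" if "t \<ge> 0" for t
    using complex_series_of_real[of ?h t \<zeta> 0 x, OF h[OF that] that \<zeta>(1)]
      complex_series_of_real[of ?h t \<zeta> 1 y, OF h[OF that] that \<zeta>(1)]
    by (simp add: frac_sol_def)
  moreover have "lcs_analytic_on ?F UNIV"
    using an[OF x, of 0] lcs_analytic_on_add[OF an[OF x, of 0] an[OF y, of 1]] by (cases "\<zeta> > 1") simp_all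
  ultimately show ?thesis unfolding extends_entire_def by (intro exI[of _ ?F] conjI allI impI)
qed

end

lemma extends_slit_cong: "extends_slit f \<Longrightarrow> (\<And>t. t \<ge> 0 \<Longrightarrow> f t = g t) \<Longrightarrow> extends_slit g"
  unfolding extends_slit_def by metis

lemma extends_entire_cong: "extends_entire f \<Longrightarrow> (\<And>t. t \<ge> 0 \<Longrightarrow> f t = g t) \<Longrightarrow> extends_entire g"
  unfolding extends_entire_def by metis

section \<open>Solutions of the Cauchy problem from sequences\<close>

lemma frac_series_closed_operator:
  assumes A: "closed_linear_operator D A" and "fast_decay \<zeta> x" "fast_decay \<zeta> (\<lambda>k. A (x k))"
    "\<And>k. x k \<in> D" "\<zeta> > 0" "b \<ge> 1" "t \<ge> 0"
  shows "frac_series \<zeta> b x t \<in> D \<and> A (frac_series \<zeta> b x t) = frac_series \<zeta> b (\<lambda>k. A (x k)) t"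
  unfolding frac_series_def scaleR_scaleC
proof (rule closed_linear_operator_suminf[OF A])
  show "dominated (weight \<zeta> b (t + 1)) x" "dominated (weight \<zeta> b (t + 1)) (\<lambda>k. A (x k))"
    using assms by (auto intro!: dominated_weight)
  show "cmod (complex_of_real (g_ker (\<zeta> * real k + b) t)) \<le> weight \<zeta> b (t + 1) k" for k
    using g_ker_le_weight[of \<zeta> b t "t + 1" k] assms by simp
qed (rule assms)

lemma frac_series_sum_zero:
  assumes fast: "\<And>i. i \<in> I \<Longrightarrow> fast_decay \<zeta> (z i)" and "\<zeta> > 0" "b \<ge> 1" "t \<ge> 0"
    and zero: "\<And>k. (\<Sum>i\<in>I. z i k) = 0"
  shows "(\<Sum>i\<in>I. frac_series \<zeta> b (z i) t) = 0"
proof -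
  have "(\<Sum>i\<in>I. frac_series \<zeta> b (z i) t) = (\<Sum>k. \<Sum>i\<in>I. g_ker (\<zeta> * real k + b) t *\<^sub>R z i k)"
    unfolding frac_series_def
    using frac_series_summable[OF fast] assms by (intro suminf_sum[symmetric]) auto
  also have "\<dots> = 0" by (simp add: zero flip: scaleR_sum_right)
  finally show ?thesis .
qed

text \<open>The algebraic form of the Cauchy problem: the conditions on the coefficients under which
  \<^const>\<open>frac_sol\<close> is a solution.\<close>

definition solution_seq ::
    "nat \<Rightarrow> (nat \<Rightarrow> nat) \<Rightarrow> (nat \<Rightarrow> 'a::complex_sclcs set) \<Rightarrow> (nat \<Rightarrow> 'a \<Rightarrow> 'a) \<Rightarrow> real
      \<Rightarrow> (nat \<Rightarrow> 'a) \<Rightarrow> bool" where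
  "solution_seq n q D A \<zeta> x \<longleftrightarrow> fast_decay \<zeta> x \<and>
     (\<forall>i\<le>n. (\<forall>k. x k \<in> D i) \<and> fast_decay \<zeta> (\<lambda>k. A i (x k))) \<and>
     (\<forall>k. (\<Sum>i\<le>n. A i (x (k + q i))) = 0)"

lemma solution_seq_shift: "solution_seq n q D A \<zeta> x \<Longrightarrow> solution_seq n q D A \<zeta> (\<lambda>k. x (k + m))"
  unfolding solution_seq_def
proof (intro conjI allI impI; elim conjE)
  fix k assume *: "\<forall>k. (\<Sum>i\<le>n. A i (x (k + q i))) = 0"
  have "(\<Sum>i\<le>n. A i (x (k + q i + m))) = (\<Sum>i\<le>n. A i (x (k + m + q i)))" by (simp add: add_ac)
  also have "\<dots> = 0" using * by blast
  finally show "(\<Sum>i\<le>n. A i (x (k + q i + m))) = 0" .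
qed (auto intro: fast_decay_shift fast_decay_shift[where x="\<lambda>k. A _ (x k)"])

context
  fixes n :: nat and q :: "nat \<Rightarrow> nat" and D :: "nat \<Rightarrow> 'a::complex_sclcs set" and A :: "nat \<Rightarrow> 'a \<Rightarrow> 'a"
    and \<zeta> :: real
  assumes closed_A: "\<forall>i\<le>n. closed_linear_operator (D i) (A i)" and \<zeta>: "0 < \<zeta>" "\<zeta> \<le> 2"
begin

lemma frac_sol_closed_operator:
  assumes x: "solution_seq n q D A \<zeta> x" and y: "solution_seq n q D A \<zeta> y" and i: "i \<le> n" and t: "t \<ge> 0"
  shows "frac_sol \<zeta> 1 x y t \<in> D i \<and> A i (frac_sol \<zeta> 1 x y t) = frac_sol \<zeta> 1 (\<lambda>k. A i (x k)) (\<lambda>k. A i (y k)) t"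
proof -
  have A: "closed_linear_operator (D i) (A i)" using closed_A i by blast
  have "frac_series \<zeta> 1 x t \<in> D i \<and> A i (frac_series \<zeta> 1 x t) = frac_series \<zeta> 1 (\<lambda>k. A i (x k)) t"
    using x i t \<zeta> unfolding solution_seq_def by (intro frac_series_closed_operator[OF A]) auto
  moreover have "frac_series \<zeta> 2 y t \<in> D i \<and> A i (frac_series \<zeta> 2 y t) = frac_series \<zeta> 2 (\<lambda>k. A i (y k)) t"
    using y i t \<zeta> unfolding solution_seq_def by (intro frac_series_closed_operator[OF A]) auto
  ultimately show ?thesis
    using A cvs.subspace_add[of "D i"] unfolding closed_linear_operator_def frac_sol_def by auto
qed

lemma strong_solution_frac_sol:
  assumes x: "solution_seq n q D A \<zeta> x" and y: "solution_seq n q D A \<zeta> y"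
    and w: "\<And>j. j < q n \<Longrightarrow> w j = x j" "\<And>j. \<zeta> > 1 \<Longrightarrow> j < q n \<Longrightarrow> w (q n + j) = y j"
  shows "strong_solution n q D A \<zeta> w (frac_sol \<zeta> 1 x y)"
proof -
  let ?u = "frac_sol \<zeta> 1 x y"
  have fx: "fast_decay \<zeta> x" and fy: "fast_decay \<zeta> y" using x y by (auto simp: solution_seq_def)
  note pow = caputo_pow_frac_sol[OF \<zeta> fx fy]
  have AD: "(caputo \<zeta> ^^ p) ?u t \<in> D i \<and> A i ((caputo \<zeta> ^^ p) ?u t) =
      frac_sol \<zeta> 1 (\<lambda>k. A i (x (k + p))) (\<lambda>k. A i (y (k + p))) t" if "i \<le> n" "t \<ge> 0" for i t p
    using frac_sol_closed_operator[OF solution_seq_shift[OF x] solution_seq_shift[OF y] that] pow[OF that(2)] by simp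
  have fA: "fast_decay \<zeta> (\<lambda>k. A i (x (k + p)))" "fast_decay \<zeta> (\<lambda>k. A i (y (k + p)))" if "i \<le> n" for i p
    using solution_seq_shift[OF x, of p] solution_seq_shift[OF y, of p] that by (auto simp: solution_seq_def)
  have "continuous_on {0..} ?u" by (rule continuous_on_frac_sol[OF \<zeta> fx fy]) simp
  moreover have "continuous_on {0..} (\<lambda>t. A i ((caputo \<zeta> ^^ q i) ?u t))" if "i \<le> n" for i
    by (rule continuous_on_eq[OF continuous_on_frac_sol[OF \<zeta> fA[OF that], of 1 "q i" "q i"]])
       (use AD that in auto)
  moreover have "(\<Sum>i\<le>n. A i ((caputo \<zeta> ^^ q i) ?u t)) = 0" if t: "t \<ge> 0" for t
  proof -
    have sx: "(\<Sum>i\<in>{..n}. frac_series \<zeta> 1 (\<lambda>k. A i (x (k + q i))) t) = 0"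
      by (rule frac_series_sum_zero) (use t \<zeta> x fA in \<open>auto simp: solution_seq_def\<close>)
    have sy: "(\<Sum>i\<in>{..n}. frac_series \<zeta> (1 + 1) (\<lambda>k. A i (y (k + q i))) t) = 0"
      by (rule frac_series_sum_zero) (use t \<zeta> y fA in \<open>auto simp: solution_seq_def\<close>)
    have "(\<Sum>i\<le>n. A i ((caputo \<zeta> ^^ q i) ?u t)) =
       (\<Sum>i\<le>n. frac_sol \<zeta> 1 (\<lambda>k. A i (x (k + q i))) (\<lambda>k. A i (y (k + q i))) t)"
      by (rule sum.cong) (use AD t in auto)
    also have "\<dots> = 0"
      using sx sy by (cases "\<zeta> > 1") (simp_all add: frac_sol_def sum.distrib)
    finally show ?thesis .
  qed
  moreover have "initial_conditions (q n) \<zeta> w ?u"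
    unfolding initial_conditions_def
  proof (intro conjI allI impI)
    fix j assume j: "j < q n"
    have fxj: "fast_decay \<zeta> (\<lambda>k. x (k + j))" and fyj: "fast_decay \<zeta> (\<lambda>k. y (k + j))"
      by (rule fast_decay_shift[OF fx], rule fast_decay_shift[OF fy])
    show "(caputo \<zeta> ^^ j) ?u 0 = w j"
      using frac_sol_0[OF \<zeta> fxj fyj] pow[of 0 j] w(1)[OF j] by simp
    show "vderiv ((caputo \<zeta> ^^ j) ?u) 0 = w (q n + j)" if "\<zeta> > 1"
      using vderiv_frac_sol_0[OF \<zeta> fxj fyj that pow] w(2)[OF that j] by simp
  qed
  ultimately show ?thesis
    unfolding strong_solution_def using AD caputo_pow_defined_frac_sol[OF \<zeta> fx fy] by auto
qed

lemma analytical_solution_frac_sol: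
  assumes x: "solution_seq n q D A \<zeta> x" and y: "solution_seq n q D A \<zeta> y"
    and w: "\<And>j. j < q n \<Longrightarrow> w j = x j" "\<And>j. \<zeta> > 1 \<Longrightarrow> j < q n \<Longrightarrow> w (q n + j) = y j"
  shows "analytical_solution n q D A \<zeta> w (frac_sol \<zeta> 1 x y)"
proof -
  let ?u = "frac_sol \<zeta> 1 x y"
  have fx: "fast_decay \<zeta> x" and fy: "fast_decay \<zeta> y" using x y by (auto simp: solution_seq_def)
  have AD: "(caputo \<zeta> ^^ p) ?u t \<in> D i \<and> A i ((caputo \<zeta> ^^ p) ?u t) =
      frac_sol \<zeta> 1 (\<lambda>k. A i (x (k + p))) (\<lambda>k. A i (y (k + p))) t" if "i \<le> n" "t \<ge> 0" for i t p
    using frac_sol_closed_operator[OF solution_seq_shift[OF x] solution_seq_shift[OF y] that]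
      caputo_pow_frac_sol[OF \<zeta> fx fy that(2)] by simp
  have "extends_slit (\<lambda>t. A i ((caputo \<zeta> ^^ p) ?u t))" if "i \<le> n" for i p
  proof (rule extends_slit_cong)
    show "extends_slit (frac_sol \<zeta> 1 (\<lambda>k. A i (x (k + p))) (\<lambda>k. A i (y (k + p))))"
      using solution_seq_shift[OF x, of p] solution_seq_shift[OF y, of p] that
      by (intro extends_slit_frac_sol[OF \<zeta>]) (auto simp: solution_seq_def)
  qed (use AD that in simp)
  then show ?thesis
    unfolding analytical_solution_def
    using strong_solution_frac_sol[OF assms] extends_slit_frac_sol[OF \<zeta> fx fy] AD
      caputo_pow_defined_frac_sol[OF \<zeta> fx fy] by blast
qed

text \<open>For $\zeta = 1$ the derivative shifts the first sequence. For $\zeta = 2$ it exchanges the two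
  sequences and shifts one of them. In both cases derivatives stay in the class of these solutions.\<close>

lemma vderiv_pow_frac_sol:
  assumes N: "\<zeta> = 1 \<or> \<zeta> = 2"
    and x: "solution_seq n q D A \<zeta> x" and y: "solution_seq n q D A \<zeta> y"
  shows "\<exists>x' y'. solution_seq n q D A \<zeta> x' \<and> solution_seq n q D A \<zeta> y' \<and>
    (\<forall>t\<ge>0. (vderiv ^^ p) (frac_sol \<zeta> 1 x y) t = frac_sol \<zeta> 1 x' y' t)"
proof (induction p)
  case 0
  show ?case using x y by (intro exI[of _ x] exI[of _ y]) simp
next
  case (Suc p)
  then obtain x' y' where x': "solution_seq n q D A \<zeta> x'" and y': "solution_seq n q D A \<zeta> y'"
    and eq: "\<And>t. t \<ge> 0 \<Longrightarrow> (vderiv ^^ p) (frac_sol \<zeta> 1 x y) t = frac_sol \<zeta> 1 x' y' t"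
    by blast
  have fx: "fast_decay \<zeta> x'" and fy: "fast_decay \<zeta> y'" using x' y' by (auto simp: solution_seq_def)
  let ?x = "\<lambda>k. x' (k + 1)"
  have sx: "solution_seq n q D A \<zeta> ?x" by (rule solution_seq_shift[OF x'])
  have "\<exists>x'' y''. solution_seq n q D A \<zeta> x'' \<and> solution_seq n q D A \<zeta> y'' \<and>
      has_vderiv (frac_sol \<zeta> 1 x' y') (frac_sol \<zeta> 1 x'' y'')"
  proof (cases "\<zeta> = 1")
    case True
    have "has_vderiv (\<lambda>t. x' 0 + frac_series \<zeta> (1 + 1) ?x t) (\<lambda>t. 0 + frac_series \<zeta> 1 ?x t)"
      using frac_series_has_derivative[OF fast_decay_shift[OF fx] \<zeta>(1), of 1 _ 1]
      by (intro has_vderiv_add has_vderiv_const) (auto simp: has_vderiv_def)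
    then have "has_vderiv (frac_sol \<zeta> 1 x' y') (frac_sol \<zeta> 1 ?x y')"
      by (rule has_vderiv_cong[rotated 2])
        (use frac_series_peel[OF fx \<zeta>(1), of 1] True in \<open>auto simp: frac_sol_def g_ker_1\<close>)
    then show ?thesis using sx y' by blast
  next
    case False
    then have z: "\<zeta> = 2" using N by simp
    have "has_vderiv (frac_sol \<zeta> 1 x' y') (frac_sol \<zeta> 1 y' ?x)"
      by (rule has_vderiv_cong[OF _ _ has_vderiv_frac_sol_1[OF \<zeta> fx fy]])
        (auto simp: z frac_sol_def add_ac)
    then show ?thesis using sx y' by blast
  qed
  then obtain x'' y'' where *: "solution_seq n q D A \<zeta> x''" "solution_seq n q D A \<zeta> y''"
    "has_vderiv (frac_sol \<zeta> 1 x' y') (frac_sol \<zeta> 1 x'' y'')" by blast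
  have "has_vderiv ((vderiv ^^ p) (frac_sol \<zeta> 1 x y)) (frac_sol \<zeta> 1 x'' y'')"
    by (rule has_vderiv_cong[OF _ _ *(3)]) (auto simp: eq)
  from vderiv_eq[OF this] show ?case using * by auto
qed

lemma entire_solution_frac_sol:
  assumes N: "\<zeta> = 1 \<or> \<zeta> = 2"
    and x: "solution_seq n q D A \<zeta> x" and y: "solution_seq n q D A \<zeta> y"
    and w: "\<And>j. j < q n \<Longrightarrow> w j = x j" "\<And>j. \<zeta> > 1 \<Longrightarrow> j < q n \<Longrightarrow> w (q n + j) = y j"
  shows "entire_solution n q D A \<zeta> w (frac_sol \<zeta> 1 x y)"
proof -
  let ?u = "frac_sol \<zeta> 1 x y"
  obtain N where N': "\<zeta> = real N" using N by (metis of_nat_1 of_nat_numeral)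
  have ext: "extends_entire (frac_sol \<zeta> 1 x y)" if "fast_decay \<zeta> x" "fast_decay \<zeta> y" for x y :: "nat \<Rightarrow> 'a"
    by (rule extends_entire_frac_sol[OF \<zeta> that N'])
  have "(\<forall>t\<ge>0. (vderiv ^^ p) ?u t \<in> D i) \<and> extends_entire (\<lambda>t. A i ((vderiv ^^ p) ?u t))"
    if i: "i \<le> n" for i p
  proof -
    obtain x' y' where x': "solution_seq n q D A \<zeta> x'" and y': "solution_seq n q D A \<zeta> y'"
      and eq: "\<And>t. t \<ge> 0 \<Longrightarrow> (vderiv ^^ p) ?u t = frac_sol \<zeta> 1 x' y' t"
      using vderiv_pow_frac_sol[OF N x y, of p] by blast
    have "extends_entire (frac_sol \<zeta> 1 (\<lambda>k. A i (x' k)) (\<lambda>k. A i (y' k)))"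
      using x' y' i by (intro ext) (auto simp: solution_seq_def)
    then have "extends_entire (\<lambda>t. A i ((vderiv ^^ p) ?u t))"
      by (rule extends_entire_cong) (use frac_sol_closed_operator[OF x' y' i] eq in simp)
    then show ?thesis using frac_sol_closed_operator[OF x' y' i] eq by simp
  qed
  then show ?thesis
    unfolding entire_solution_def
    using strong_solution_frac_sol[OF x y w] ext x y by (auto simp: solution_seq_def)
qed

end

section \<open>Integrals of continuous vector-valued functions over the unit interval\<close>

definition riemann_sum :: "(real \<Rightarrow> 'b::real_vector) \<Rightarrow> nat \<Rightarrow> 'b" where
  "riemann_sum G m = (1 / 2 ^ m) *\<^sub>R (\<Sum>j<2 ^ m. G (real j / 2 ^ m))"

lemma continuous_on_seminorm:
  "continuous_seminorm p \<Longrightarrow> continuous_on S f \<Longrightarrow> continuous_on S (\<lambda>x. p (f x))"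
  unfolding continuous_on_def by (blast intro: tendsto_seminorm_compose)

text \<open>The real function $(s,t) \mapsto p(G(s)-G(t))$ is continuous on a compact square and vanishes on
  the diagonal.\<close>

lemma seminorm_uniformly_continuous:
  fixes G :: "real \<Rightarrow> 'a::complex_sclcs"
  assumes p: "continuous_seminorm p" and G: "continuous_on {0..1} G" and e: "e > 0"
  shows "\<exists>d>0. \<forall>s\<in>{0..1}. \<forall>t\<in>{0..1}. \<bar>s - t\<bar> < d \<longrightarrow> p (G s - G t) < e"
proof -
  let ?\<Phi> = "\<lambda>x::real \<times> real. p (G (fst x) - G (snd x))"
  have "continuous_on ({0..1} \<times> {0..1}) ?\<Phi>"
    by (intro continuous_on_seminorm[OF p] continuous_on_diff continuous_on_compose2[OF G] continuous_intros) auto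
  then have "uniformly_continuous_on ({0..1} \<times> {0..1}) ?\<Phi>"
    by (intro compact_uniformly_continuous compact_Times compact_Icc)
  then obtain d where d: "d > 0"
    and *: "\<And>x y. x \<in> {0..1} \<times> {0..1} \<Longrightarrow> y \<in> {0..1} \<times> {0..1} \<Longrightarrow> dist y x < d \<Longrightarrow> dist (?\<Phi> y) (?\<Phi> x) < e"
    using e unfolding uniformly_continuous_on_def by metis
  have "p (G s - G t) < e" if "s \<in> {0..1}" "t \<in> {0..1}" "\<bar>s - t\<bar> < d" for s t
    using *[of "(s, s)" "(s, t)"] that seminorm_nonneg[OF p, of "G s - G t"]
    by (simp add: dist_Pair_Pair dist_norm seminorm_0[OF p])
  then show ?thesis using d by blast
qed

lemma dyadic_point: "j < 2 ^ m \<Longrightarrow> real j / 2 ^ m \<in> {0..1}"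
  by (simp add: divide_le_eq)

lemma seminorm_riemann_sum_le:
  assumes p: "continuous_seminorm p" and B: "\<And>t. t \<in> {0..1} \<Longrightarrow> p (G t) \<le> B"
  shows "p (riemann_sum G m) \<le> B"
proof -
  have "p (riemann_sum G m) = (1 / 2 ^ m) * p (\<Sum>j<2 ^ m. G (real j / 2 ^ m))"
    by (simp add: riemann_sum_def seminorm_scaleR[OF p])
  also have "\<dots> \<le> (1 / 2 ^ m) * (\<Sum>j<2 ^ m. p (G (real j / 2 ^ m)))"
    by (intro mult_left_mono seminorm_sum[OF p]) simp
  also have "(\<Sum>j<2 ^ m. p (G (real j / 2 ^ m))) \<le> of_nat (card {..<2 ^ m::nat}) * B"
    by (intro sum_bounded_above B dyadic_point) simp
  finally show ?thesis by (simp add: divide_right_mono)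
qed

text \<open>The coarse sum over the points of the finer grid, for comparison term by term.\<close>

lemma riemann_sum_refine:
  fixes G :: "real \<Rightarrow> 'b::real_vector"
  shows "riemann_sum G m = (1 / 2 ^ (m + l)) *\<^sub>R (\<Sum>k<2 ^ (m + l). G (real (k div 2 ^ l) / 2 ^ m))"
proof -
  have "(\<Sum>k<2 ^ m * 2 ^ l. G (real (k div 2 ^ l) / 2 ^ m)) =
      (\<Sum>j<2 ^ m. sum (\<lambda>k. G (real (k div 2 ^ l) / 2 ^ m)) {j * 2 ^ l..<j * 2 ^ l + 2 ^ l})"
    by (rule sum.nat_group[symmetric])
  also have "\<dots> = (\<Sum>j<2 ^ m. 2 ^ l *\<^sub>R G (real j / 2 ^ m))"
  proof (rule sum.cong[OF refl])
    fix j :: nat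
    have "k div 2 ^ l = j" if "k \<in> {j * 2 ^ l..<j * 2 ^ l + 2 ^ l}" for k
      using that by (intro div_nat_eqI) (auto simp: mult.commute)
    then have "sum (\<lambda>k. G (real (k div 2 ^ l) / 2 ^ m)) {j * 2 ^ l..<j * 2 ^ l + 2 ^ l}
        = (\<Sum>k\<in>{j * 2 ^ l..<j * 2 ^ l + 2 ^ l}. G (real j / 2 ^ m))"
      by (intro sum.cong) auto
    then show "sum (\<lambda>k. G (real (k div 2 ^ l) / 2 ^ m)) {j * 2 ^ l..<j * 2 ^ l + 2 ^ l} = 2 ^ l *\<^sub>R G (real j / 2 ^ m)"
      by (simp add: sum_constant_scaleR)
  qed
  finally show ?thesis by (simp add: riemann_sum_def power_add flip: scaleR_sum_right)
qed

lemma riemann_sum_convergent: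
  fixes G :: "real \<Rightarrow> 'a::complex_sclcs"
  assumes G: "continuous_on {0..1} G"
  shows "\<exists>l. riemann_sum G \<longlonglongrightarrow> l"
proof (rule seminorm_Cauchy_convergent)
  fix p :: "'a \<Rightarrow> real" and e :: real assume p: "continuous_seminorm p" and e: "e > 0"
  obtain d where d: "d > 0" "\<And>s t. s \<in> {0..1} \<Longrightarrow> t \<in> {0..1} \<Longrightarrow> \<bar>s - t\<bar> < d \<Longrightarrow> p (G s - G t) < e/3"
    using seminorm_uniformly_continuous[OF p G, of "e/3"] e by auto
  obtain N where N: "(1/2) ^ N < d" using real_arch_pow_inv[OF d(1), of "1/2"] by auto
  have near: "p (riemann_sum G (N + l) - riemann_sum G N) \<le> e/3" for l
  proof -
    have "riemann_sum G (N + l) - riemann_sum G N =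
        (1 / 2 ^ (N + l)) *\<^sub>R (\<Sum>k<2 ^ (N + l). G (real k / 2 ^ (N + l)) - G (real (k div 2 ^ l) / 2 ^ N))"
      unfolding riemann_sum_refine[of G N l] by (simp add: riemann_sum_def scaleR_diff_right sum_subtractf)
    also have "p \<dots> = (1 / 2 ^ (N + l)) * p (\<Sum>k<2 ^ (N + l). G (real k / 2 ^ (N + l)) - G (real (k div 2 ^ l) / 2 ^ N))"
      by (simp add: seminorm_scaleR[OF p])
    also have "\<dots> \<le> (1 / 2 ^ (N + l)) * (\<Sum>k<2 ^ (N + l). p (G (real k / 2 ^ (N + l)) - G (real (k div 2 ^ l) / 2 ^ N)))"
      by (intro mult_left_mono seminorm_sum[OF p]) simp
    also have "(\<Sum>k<2 ^ (N + l). p (G (real k / 2 ^ (N + l)) - G (real (k div 2 ^ l) / 2 ^ N)))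
        \<le> of_nat (card {..<2 ^ (N + l)::nat}) * (e/3)"
    proof (intro sum_bounded_above less_imp_le d(2))
      fix k :: nat assume k: "k \<in> {..<2 ^ (N + l)}"
      then show "real k / 2 ^ (N + l) \<in> {0..1}" by (intro dyadic_point) simp
      have "k div 2 ^ l < 2 ^ N" using k by (simp add: less_mult_imp_div_less power_add)
      then show "real (k div 2 ^ l) / 2 ^ N \<in> {0..1}" by (rule dyadic_point)
      have "real k = real (2 ^ l * (k div 2 ^ l) + k mod 2 ^ l)" by simp
      then have "real k / 2 ^ (N + l) - real (k div 2 ^ l) / 2 ^ N = real (k mod 2 ^ l) / 2 ^ (N + l)"
        by (simp only: of_nat_add of_nat_mult of_nat_power) (simp add: power_add field_simps)
      moreover have "real (k mod 2 ^ l) \<le> 2 ^ l"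
        using mod_less_divisor[of "2 ^ l" k] by (metis less_imp_le of_nat_le_iff of_nat_numeral of_nat_power pos2 zero_less_power)
      then have "real (k mod 2 ^ l) / 2 ^ (N + l) \<le> (1/2) ^ N"
        by (simp add: power_add field_simps)
      ultimately show "\<bar>real k / 2 ^ (N + l) - real (k div 2 ^ l) / 2 ^ N\<bar> < d"
        using N by simp
    qed
    finally show ?thesis by (simp add: divide_right_mono)
  qed
  show "\<exists>N. \<forall>j\<ge>N. \<forall>k\<ge>N. p (riemann_sum G j - riemann_sum G k) < e"
  proof (intro exI[of _ N] allI impI)
    fix j k assume "j \<ge> N" "k \<ge> N"
    then obtain a b where ab: "j = N + a" "k = N + b" by (metis le_Suc_ex)
    have "p (riemann_sum G j - riemann_sum G k) =
        p ((riemann_sum G j - riemann_sum G N) - (riemann_sum G k - riemann_sum G N))" by simp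
    also have "\<dots> \<le> p (riemann_sum G j - riemann_sum G N) + p (riemann_sum G k - riemann_sum G N)"
      by (rule seminorm_diff_le[OF p])
    also have "\<dots> < e" using near[of a] near[of b] e unfolding ab by linarith
    finally show "p (riemann_sum G j - riemann_sum G k) < e" .
  qed
qed

text \<open>Dyadic Riemann sums suffice: the integrands are continuous up to both ends, since infinite rays
  are parametrized by the unit interval.\<close>

definition vint :: "(real \<Rightarrow> 'a::complex_sclcs) \<Rightarrow> 'a" where
  "vint G = lim (riemann_sum G)"

lemma vint_LIMSEQ: "continuous_on {0..1} G \<Longrightarrow> riemann_sum G \<longlonglongrightarrow> vint G"
  unfolding vint_def using riemann_sum_convergent limI by metis

lemma vint_eqI: "riemann_sum G \<longlonglongrightarrow> l \<Longrightarrow> vint G = l"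
  unfolding vint_def by (rule limI)

lemma seminorm_vint_le:
  assumes p: "continuous_seminorm p" and G: "continuous_on {0..1} G" and B: "\<And>t. t \<in> {0..1} \<Longrightarrow> p (G t) \<le> B"
  shows "p (vint G) \<le> B"
  by (rule tendsto_upperbound[OF tendsto_seminorm_compose[OF p vint_LIMSEQ[OF G]]])
     (use seminorm_riemann_sum_le[OF p B] in auto)

lemma vint_cong:
  assumes "\<And>t. t \<in> {0..1} \<Longrightarrow> G t = H t" shows "vint G = vint H"
proof -
  have "riemann_sum G m = riemann_sum H m" for m
    unfolding riemann_sum_def using assms[OF dyadic_point[of _ m]]
    by (intro arg_cong[where f="scaleR _"] sum.cong) auto
  then have "riemann_sum G = riemann_sum H" by blast
  then show ?thesis by (simp add: vint_def)
qed

lemma vint_add: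
  assumes "continuous_on {0..1} G" "continuous_on {0..1} H"
  shows "vint (\<lambda>t. G t + H t) = vint G + vint H"
  using tendsto_add[OF vint_LIMSEQ[OF assms(1)] vint_LIMSEQ[OF assms(2)]]
  by (intro vint_eqI) (simp add: riemann_sum_def[abs_def] sum.distrib scaleR_add_right)

lemma vint_zero: "vint (\<lambda>t. 0) = 0"
  by (rule vint_eqI) (simp add: riemann_sum_def[abs_def])

lemma vint_sum:
  assumes "finite I" "\<And>i. i \<in> I \<Longrightarrow> continuous_on {0..1} (G i)"
  shows "vint (\<lambda>t. \<Sum>i\<in>I. G i t) = (\<Sum>i\<in>I. vint (G i))"
  using assms
proof (induction I rule: finite_induct)
  case (insert i I)
  then have "vint (\<lambda>t. G i t + (\<Sum>i\<in>I. G i t)) = vint (G i) + vint (\<lambda>t. \<Sum>i\<in>I. G i t)"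
    by (intro vint_add) (auto simp: continuous_on_def intro!: tendsto_sum)
  then show ?case using insert by simp
qed (simp add: vint_zero)

lemma vint_closed_operator:
  assumes A: "closed_linear_operator D A" and D: "\<And>t. t \<in> {0..1} \<Longrightarrow> G t \<in> D"
    and G: "continuous_on {0..1} G" and AG: "continuous_on {0..1} (\<lambda>t. A (G t))"
  shows "vint G \<in> D \<and> A (vint G) = vint (\<lambda>t. A (G t))"
proof -
  have eq: "riemann_sum H m = (\<Sum>j<2 ^ m. complex_of_real (1 / 2 ^ m) *\<^sub>C H (real j / 2 ^ m))" for H :: "real \<Rightarrow> 'a" and m
    by (simp add: riemann_sum_def scaleR_scaleC cvs.scale_sum_right)
  have mem: "j \<in> {..<2 ^ m} \<Longrightarrow> G (real j / 2 ^ m) \<in> D" for j m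
    by (intro D dyadic_point) simp
  have R: "riemann_sum G m \<in> D \<and> A (riemann_sum G m) = riemann_sum (\<lambda>t. A (G t)) m" for m
    unfolding eq by (rule closed_linear_operator_sum[OF A mem])
  show ?thesis
    using R vint_LIMSEQ[OF AG] by (intro closed_linear_operator_limit[OF A sequentially_bot _ vint_LIMSEQ[OF G]]) auto
qed

text \<open>The increment of \<open>H\<close> over each dyadic interval is compared with the corresponding term of the
  sum by the mean value inequality. The derivative is needed only in the interior, so \<open>H\<close> may be
  defined by limits at the endpoints.\<close>

lemma riemann_sum_fundamental_theorem:
  fixes g :: "real \<Rightarrow> complex"
  assumes g: "continuous_on {0..1} g" and H: "continuous_on {0..1} H"
    and deriv: "\<And>t. 0 < t \<Longrightarrow> t < 1 \<Longrightarrow> (H has_vector_derivative g t) (at t)"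
  shows "riemann_sum g \<longlonglongrightarrow> H 1 - H 0"
proof (rule LIMSEQ_I)
  fix e :: real assume e: "e > 0"
  have "uniformly_continuous_on {0..1} g" by (rule compact_uniformly_continuous[OF g compact_Icc])
  then obtain d where d: "d > 0" "\<And>s t. s \<in> {0..1} \<Longrightarrow> t \<in> {0..1} \<Longrightarrow> dist t s < d \<Longrightarrow> dist (g t) (g s) < e/2"
    unfolding uniformly_continuous_on_def using e half_gt_zero[OF e] by metis
  obtain N where N: "(1/2) ^ N < d" using real_arch_pow_inv[OF d(1), of "1/2"] by auto
  show "\<exists>N. \<forall>m\<ge>N. norm (riemann_sum g m - (H 1 - H 0)) < e"
  proof (intro exI[of _ N] allI impI)
    fix m assume m: "m \<ge> N"
    define \<delta> where "\<delta> = 1 / (2::real) ^ m"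
    have \<delta>: "\<delta> > 0" by (simp add: \<delta>_def)
    have "\<delta> \<le> (1/2) ^ N" using m by (simp add: \<delta>_def power_decreasing flip: power_one_over)
    then have \<delta>d: "\<delta> < d" using N by simp
    have step: "norm (\<delta> *\<^sub>R g (real j * \<delta>) - (H (real (Suc j) * \<delta>) - H (real j * \<delta>))) \<le> \<delta> * (e/2)"
      if j: "j < 2 ^ m" for j
    proof -
      let ?a = "real j * \<delta>" and ?b = "real (Suc j) * \<delta>"
      have ab: "?b = ?a + \<delta>" by (simp add: algebra_simps)
      have a0: "?a \<ge> 0" using \<delta> by simp
      have "real (Suc j) \<le> 2 ^ m" using j by (metis Suc_leI of_nat_le_iff of_nat_numeral of_nat_power)
      then have b1: "?b \<le> 1" by (simp add: \<delta>_def field_simps)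
      define F where "F t = t *\<^sub>R g ?a - H t" for t
      have "norm (F ?b - F ?a) \<le> (e/2) * ?b - (e/2) * ?a"
      proof (rule differentiable_bound_general)
        show "?a < ?b" using ab \<delta> by simp
        show "continuous_on {?a..?b} F"
          unfolding F_def by (intro continuous_intros continuous_on_subset[OF H]) (use a0 b1 in auto)
        show "continuous_on {?a..?b} (\<lambda>t. (e/2) * t)" by (intro continuous_intros)
        fix t assume t: "?a < t" "t < ?b"
        have "(H has_vector_derivative g t) (at t)" using t a0 b1 by (intro deriv) linarith+
        then show "(F has_vector_derivative (g ?a - g t)) (at t)"
          unfolding F_def by (auto intro!: derivative_eq_intros)
        show "((\<lambda>t. (e/2) * t) has_vector_derivative e/2) (at t)"
          unfolding has_real_derivative_iff_has_vector_derivative[symmetric] by (auto intro!: derivative_eq_intros)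
        have "dist (g ?a) (g t) < e/2"
        proof (rule d(2))
          have "0 \<le> ?a \<and> ?a \<le> 1 \<and> 0 \<le> t \<and> t \<le> 1"
            using t a0 b1 by (intro conjI; linarith)
          then show "?a \<in> {0..1}" "t \<in> {0..1}" by (auto simp only: atLeastAtMost_iff)
          show "dist ?a t < d" using t ab \<delta>d unfolding dist_real_def by linarith
        qed
        then show "norm (g ?a - g t) \<le> e/2" by (simp add: dist_norm)
      qed
      moreover have "F ?b - F ?a = \<delta> *\<^sub>R g ?a - (H ?b - H ?a)"
        unfolding F_def ab by (simp add: algebra_simps)
      ultimately have "norm (\<delta> *\<^sub>R g ?a - (H ?b - H ?a)) \<le> (e/2) * ?b - (e/2) * ?a"
        by (simp only:)
      also have "\<dots> = \<delta> * (e/2)" unfolding ab by (simp add: algebra_simps)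
      finally show ?thesis .
    qed
    have "H 1 - H 0 = (\<Sum>j<2 ^ m. H (real (Suc j) * \<delta>) - H (real j * \<delta>))"
      using sum_lessThan_telescope[of "\<lambda>j. H (real j * \<delta>)" "2 ^ m"] by (simp add: \<delta>_def)
    then have "riemann_sum g m - (H 1 - H 0) =
        (\<Sum>j<2 ^ m. \<delta> *\<^sub>R g (real j * \<delta>) - (H (real (Suc j) * \<delta>) - H (real j * \<delta>)))"
      by (simp add: riemann_sum_def \<delta>_def scaleR_sum_right sum_subtractf)
    also have "norm \<dots> \<le> (\<Sum>j<2 ^ m. norm (\<delta> *\<^sub>R g (real j * \<delta>) - (H (real (Suc j) * \<delta>) - H (real j * \<delta>))))"
      by (rule norm_sum)
    also have "\<dots> \<le> of_nat (card {..<2 ^ m::nat}) * (\<delta> * (e/2))"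
      by (rule sum_bounded_above) (use step in auto)
    also have "\<dots> = e/2" by (simp add: \<delta>_def)
    finally show "norm (riemann_sum g m - (H 1 - H 0)) < e" using e by simp
  qed
qed

lemma vint_fundamental_theorem:
  fixes g :: "real \<Rightarrow> complex" and y :: "'a::complex_sclcs"
  assumes "continuous_on {0..1} g" "continuous_on {0..1} H"
    "\<And>t. 0 < t \<Longrightarrow> t < 1 \<Longrightarrow> (H has_vector_derivative g t) (at t)"
  shows "vint (\<lambda>t. g t *\<^sub>C y) = (H 1 - H 0) *\<^sub>C y"
proof (rule vint_eqI)
  have "(\<lambda>m. riemann_sum g m *\<^sub>C y) \<longlonglongrightarrow> (H 1 - H 0) *\<^sub>C y"
    by (intro tendsto_scaleC tendsto_const riemann_sum_fundamental_theorem assms)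
  moreover have "riemann_sum (\<lambda>t. g t *\<^sub>C y) = (\<lambda>m. riemann_sum g m *\<^sub>C y)"
    by (simp add: fun_eq_iff riemann_sum_def scaleR_scaleC scaleC_scaleC scaleR_conv_of_real flip: cvs.scale_sum_left)
  ultimately show "riemann_sum (\<lambda>t. g t *\<^sub>C y) \<longlonglongrightarrow> (H 1 - H 0) *\<^sub>C y" by simp
qed

section \<open>A wedge-shaped contour\<close>

text \<open>The term $s^\gamma$ dominates $(1+s)^a$ and every logarithm, because $a < \gamma$.\<close>

lemma exp_powr_decay_bounded:
  fixes a c \<gamma> M :: real
  assumes "0 < a" "a < \<gamma>" "0 < c" "M \<ge> 0"
  shows "\<exists>K>0. \<forall>s\<ge>0. exp (M * (1 + s) powr a) * (1 + s) ^ N * exp (- c * s powr \<gamma>) \<le> K"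
proof -
  \<comment> \<open>The power of \<open>1 + s\<close> is absorbed into the exponential by \<open>ln (1 + s) \<le> (1 + s) powr a / a\<close>.\<close>
  define M' where "M' = M + real N / a"
  have M': "M' \<ge> 0" using assms by (simp add: M'_def)
  define s1 where "s1 = max 1 ((M' * 2 powr a / c) powr (1 / (\<gamma> - a)))"
  have s1: "s1 \<ge> 1" by (simp add: s1_def)
  have le: "exp (M * (1 + s) powr a) * (1 + s) ^ N * exp (- c * s powr \<gamma>) \<le> exp (M' * (1 + s) powr a - c * s powr \<gamma>)"
    if s: "s \<ge> 0" for s
  proof -
    have "(1 + s) ^ N = exp (real N * ln (1 + s))" using s by (simp add: exp_of_nat_mult)
    also have "\<dots> \<le> exp (real N * ((1 + s) powr a / a))"
      using s assms ln_powr_bound[of "1 + s" a] by (intro iffD2[OF exp_le_cancel_iff] mult_left_mono) auto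
    finally have "exp (M * (1 + s) powr a) * (1 + s) ^ N * exp (- c * s powr \<gamma>) \<le>
        exp (M * (1 + s) powr a) * exp (real N * ((1 + s) powr a / a)) * exp (- c * s powr \<gamma>)"
      by (intro mult_right_mono mult_left_mono) auto
    also have "\<dots> = exp (M' * (1 + s) powr a - c * s powr \<gamma>)"
      by (simp add: M'_def algebra_simps flip: exp_add)
    finally show ?thesis .
  qed
  have "M' * (1 + s) powr a - c * s powr \<gamma> \<le> M' * (1 + s1) powr a" if s: "s \<ge> 0" for s
  proof (cases "s \<le> s1")
    case True
    then have "M' * (1 + s) powr a \<le> M' * (1 + s1) powr a"
      using s M' assms by (intro mult_left_mono powr_mono2) auto
    moreover have "c * s powr \<gamma> \<ge> 0" using assms by simp
    ultimately show ?thesis by linarith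
  next
    case False
    then have s: "s \<ge> 1" "(M' * 2 powr a / c) powr (1 / (\<gamma> - a)) \<le> s" by (auto simp: s1_def)
    have "M' * 2 powr a / c = ((M' * 2 powr a / c) powr (1 / (\<gamma> - a))) powr (\<gamma> - a)"
      using assms M' by (simp add: powr_powr)
    also have "\<dots> \<le> s powr (\<gamma> - a)" using s assms by (intro powr_mono2) auto
    finally have "M' * 2 powr a \<le> c * s powr (\<gamma> - a)" using assms by (simp add: field_simps)
    then have "M' * 2 powr a * s powr a \<le> c * s powr (\<gamma> - a) * s powr a" by (intro mult_right_mono) auto
    also have "\<dots> = c * s powr \<gamma>" by (simp add: mult.assoc flip: powr_add)
    finally have 1: "M' * 2 powr a * s powr a \<le> c * s powr \<gamma>" .
    have "(1 + s) powr a \<le> (2 * s) powr a" using s assms by (intro powr_mono2) auto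
    also have "\<dots> = 2 powr a * s powr a" using s by (simp add: powr_mult)
    finally have "M' * (1 + s) powr a \<le> M' * (2 powr a * s powr a)" using M' by (intro mult_left_mono)
    then have "M' * (1 + s) powr a - c * s powr \<gamma> \<le> 0" using 1 by (simp add: mult.assoc)
    also have "0 \<le> M' * (1 + s1) powr a" using M' by simp
    finally show ?thesis .
  qed
  then have "\<forall>s\<ge>0. exp (M * (1 + s) powr a) * (1 + s) ^ N * exp (- c * s powr \<gamma>) \<le> exp (M' * (1 + s1) powr a)"
    using le by (meson exp_le_cancel_iff order_trans)
  then show ?thesis by (intro exI[of _ "exp (M' * (1 + s1) powr a)"]) auto
qed

lemma continuous_on_closed_unit_interval:
  fixes G :: "real \<Rightarrow> 'b::topological_space"
  assumes c: "continuous_on {0..<1} G" and 1: "(G \<longlongrightarrow> G 1) (at 1 within {0..1})"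
  shows "continuous_on {0..1} G"
  unfolding continuous_on_def
proof
  fix \<tau> :: real assume \<tau>: "\<tau> \<in> {0..1}"
  show "(G \<longlongrightarrow> G \<tau>) (at \<tau> within {0..1})"
  proof (cases "\<tau> < 1")
    case True
    then have eq: "at \<tau> within {0..<1} = at \<tau> within {0..1}"
      by (intro at_within_nhd[of _ "{..<1}"]) auto
    have "(G \<longlongrightarrow> G \<tau>) (at \<tau> within {0..<1})"
      using c \<tau> True unfolding continuous_on_def by simp
    then show ?thesis unfolding eq .
  next
    case False
    then have "\<tau> = 1" using \<tau> by simp
    then show ?thesis using 1 by simp
  qed
qed

lemma tendsto_one_minus_mult: "((\<lambda>x. B * (1 - x)) \<longlongrightarrow> (0::real)) (at 1 within S)"
proof -
  have "((\<lambda>x. B * (1 - x)) \<longlongrightarrow> B * (1 - 1)) (at 1 within S)" by (intro tendsto_intros)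
  then show ?thesis by simp
qed

definition slit_exp :: "real \<Rightarrow> complex \<Rightarrow> complex" where
  "slit_exp \<gamma> v = exp (- (v powr of_real \<gamma>))"

text \<open>Maps the unit interval to the half-line; its derivative is $(1+s)^2$ at $s =$ \<open>ray_param \<tau>\<close>.\<close>

definition ray_param :: "real \<Rightarrow> real" where
  "ray_param \<tau> = \<tau> / (1 - \<tau>)"

lemma ray_param_eq: "\<tau> < 1 \<Longrightarrow> 1 + ray_param \<tau> = 1 / (1 - \<tau>)"
  by (simp add: ray_param_def field_simps)

lemma ray_param_nonneg: "0 \<le> \<tau> \<Longrightarrow> \<tau> < 1 \<Longrightarrow> ray_param \<tau> \<ge> 0"
  by (simp add: ray_param_def)

lemma ray_param_pos: "0 < \<tau> \<Longrightarrow> \<tau> < 1 \<Longrightarrow> ray_param \<tau> > 0"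
  by (simp add: ray_param_def)

definition ray :: "real \<Rightarrow> real \<Rightarrow> complex" where
  "ray t s = of_real s * cis t"

lemma norm_ray: "s \<ge> 0 \<Longrightarrow> cmod (ray t s) = s"
  by (simp add: ray_def norm_mult)

lemma Ln_ray:
  assumes "s > 0" "\<bar>t\<bar> < pi"
  shows "Ln (ray t s) = of_real (ln s) + \<i> * of_real t"
proof (rule Ln_unique)
  show "exp (of_real (ln s) + \<i> * of_real t) = ray t s"
    using assms by (simp add: exp_add exp_of_real ray_def cis_conv_exp)
qed (use assms in auto)

lemma ray_notin_nonpos_Reals:
  assumes "s > 0" "\<bar>t\<bar> < pi" shows "ray t s \<notin> \<real>\<^sub>\<le>\<^sub>0"
proof
  assume "ray t s \<in> \<real>\<^sub>\<le>\<^sub>0"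
  then have "Im (ray t s) = 0" "Re (ray t s) \<le> 0" by (auto simp: complex_nonpos_Reals_iff)
  then have s: "sin t = 0" "cos t \<le> 0" using assms by (auto simp: ray_def mult_le_0_iff)
  then have "t = 0" using assms(2) sin_gt_zero[of t] sin_gt_zero[of "-t"] by (cases "t < 0") force+
  then show False using s by simp
qed

lemma ray_powr:
  assumes "s > 0" "\<bar>t\<bar> < pi"
  shows "ray t s powr of_real \<gamma> = of_real (s powr \<gamma>) * cis (\<gamma> * t)"
proof -
  have "ray t s \<noteq> 0" using assms by (simp add: ray_def)
  then have "ray t s powr of_real \<gamma> = exp (of_real (\<gamma> * ln s) + \<i> * of_real (\<gamma> * t))"
    by (simp add: powr_def Ln_ray[OF assms] algebra_simps)
  also have "\<dots> = of_real (s powr \<gamma>) * cis (\<gamma> * t)"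
    using assms by (simp add: exp_add powr_def cis_conv_exp flip: exp_of_real)
  finally show ?thesis .
qed

text \<open>The contour consists of the two rays $s\,e^{\pm i\eta}$. The last condition makes $v^\gamma$ map the
  region between them into the right half-plane, so that $\exp(-v^\gamma)$ decays there.\<close>

locale wedge =
  fixes \<eta> \<gamma> :: real
  assumes \<eta>: "0 < \<eta>" "\<eta> < pi" and \<gamma>: "\<gamma> > 0" and \<gamma>\<eta>: "\<gamma> * \<eta> < pi / 2"
begin

definition decay :: real where "decay = cos (\<gamma> * \<eta>)"

lemma decay_pos: "decay > 0"
  unfolding decay_def using \<eta> \<gamma> \<gamma>\<eta> by (intro cos_gt_zero_pi) (auto intro: less_le_trans[of _ 0])

lemma norm_slit_exp_le:
  assumes "s \<ge> 0" "\<bar>t\<bar> \<le> \<eta>"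
  shows "cmod (slit_exp \<gamma> (ray t s)) \<le> exp (- decay * s powr \<gamma>)"
proof (cases "s = 0")
  case True then show ?thesis using \<gamma> by (simp add: slit_exp_def ray_def)
next
  case False
  then have s: "s > 0" using assms by simp
  have "cmod (slit_exp \<gamma> (ray t s)) = exp (- (s powr \<gamma> * cos (\<gamma> * t)))"
    using s assms \<eta> by (simp add: slit_exp_def ray_powr norm_exp_eq_Re)
  moreover have "decay \<le> cos (\<gamma> * t)"
  proof -
    have "cos (\<gamma> * t) = cos \<bar>\<gamma> * t\<bar>" by simp
    also have "\<bar>\<gamma> * t\<bar> = \<gamma> * \<bar>t\<bar>" using \<gamma> by (simp add: abs_mult)
    finally have "cos (\<gamma> * t) = cos (\<gamma> * \<bar>t\<bar>)" .
    moreover have "cos (\<gamma> * \<eta>) \<le> cos (\<gamma> * \<bar>t\<bar>)"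
    proof (rule cos_monotone_0_pi_le)
      show "\<gamma> * \<eta> \<le> pi" using \<gamma>\<eta> pi_gt_zero by linarith
    qed (use assms \<gamma> in \<open>auto intro: mult_left_mono\<close>)
    ultimately show ?thesis by (simp add: decay_def)
  qed
  then have "s powr \<gamma> * decay \<le> s powr \<gamma> * cos (\<gamma> * t)" by (intro mult_left_mono) auto
  ultimately show ?thesis by (simp add: mult.commute)
qed

lemma decay_bounded:
  assumes "M \<ge> 0" "0 < a" "a < \<gamma>"
  shows "\<exists>K>0. \<forall>s\<ge>0. exp (M * (1 + s) powr a) * (1 + s) ^ N * exp (- decay * s powr \<gamma>) \<le> K"
  using exp_powr_decay_bounded[OF assms(2,3) decay_pos assms(1)] by blast

lemma poly_decay_bounded:
  "\<exists>K>0. \<forall>s\<ge>0. (1 + s) ^ N * exp (- decay * s powr \<gamma>) \<le> K"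
  using decay_bounded[of 0 "\<gamma>/2" N] \<gamma> by simp

lemma continuous_on_slit_exp_ray:
  assumes "\<bar>t\<bar> \<le> \<eta>"
  shows "continuous_on {0..} (\<lambda>s. slit_exp \<gamma> (ray t s))"
proof -
  have "continuous_on {0..} (\<lambda>s. exp (- (complex_of_real (s powr \<gamma>) * cis (\<gamma> * t))))"
    using \<gamma> by (intro continuous_intros continuous_on_powr') auto
  then show ?thesis
  proof (rule continuous_on_eq)
    fix s :: real assume "s \<in> {0..}"
    then show "exp (- (complex_of_real (s powr \<gamma>) * cis (\<gamma> * t))) = slit_exp \<gamma> (ray t s)"
      using assms \<eta> \<gamma> ray_powr[of s t \<gamma>] by (cases "s = 0") (auto simp: slit_exp_def ray_def)
  qed
qed

text \<open>The integrand of $\int f(v)\,dv$ along the contour, with the outgoing and the incoming ray put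
  together over the common parameter.\<close>

definition scalar_integrand :: "(complex \<Rightarrow> complex) \<Rightarrow> real \<Rightarrow> complex" where
  "scalar_integrand f \<tau> = (if \<tau> < 1 then of_real (1 / (1 - \<tau>)\<^sup>2) *
     (cis \<eta> * f (ray \<eta> (ray_param \<tau>)) - cis (- \<eta>) * f (ray (- \<eta>) (ray_param \<tau>))) else 0)"

lemma ray_param_has_vector_derivative:
  assumes "\<tau> < 1"
  shows "((\<lambda>\<tau>. ray t (ray_param \<tau>)) has_vector_derivative of_real (1 / (1 - \<tau>)\<^sup>2) * cis t) (at \<tau>)"
proof -
  have "(ray_param has_real_derivative 1 / (1 - \<tau>)\<^sup>2) (at \<tau>)"
    unfolding ray_param_def[abs_def] using assms
    by (auto intro!: derivative_eq_intros simp: power2_eq_square field_simps)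
  then have "((\<lambda>\<tau>. complex_of_real (ray_param \<tau>)) has_vector_derivative of_real (1 / (1 - \<tau>)\<^sup>2)) (at \<tau>)"
    by (rule has_vector_derivative_of_real[unfolded has_real_derivative_iff_has_vector_derivative[symmetric]])
  then show ?thesis
    unfolding ray_def by (rule has_vector_derivative_mult_left)
qed

lemma primitive_along_rays:
  assumes \<tau>: "0 < \<tau>" "\<tau> < 1" and t: "\<bar>t\<bar> \<le> \<eta>"
    and P: "(P has_field_derivative f (ray t (ray_param \<tau>))) (at (ray t (ray_param \<tau>)))"
  shows "((\<lambda>\<tau>. P (ray t (ray_param \<tau>))) has_vector_derivative
     of_real (1 / (1 - \<tau>)\<^sup>2) * (cis t * f (ray t (ray_param \<tau>)))) (at \<tau>)"
  using field_vector_diff_chain_at[OF ray_param_has_vector_derivative[OF \<tau>(2), of t] P]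
  by (simp add: o_def mult_ac)

text \<open>The two rays are joined by the circular arc of radius \<open>s\<close>.\<close>

lemma norm_arc_le:
  assumes P: "\<And>v. v \<notin> \<real>\<^sub>\<le>\<^sub>0 \<Longrightarrow> (P has_field_derivative f v) (at v)"
    and f: "\<And>t. \<bar>t\<bar> \<le> \<eta> \<Longrightarrow> cmod (f (ray t s)) \<le> B" and s: "s > 0"
  shows "cmod (P (ray \<eta> s) - P (ray (- \<eta>) s)) \<le> 2 * \<eta> * s * B"
proof -
  have "cmod (P (ray \<eta> s) - P (ray (- \<eta>) s)) \<le> s * B * \<eta> - s * B * (- \<eta>)"
  proof (rule differentiable_bound_general[where f="\<lambda>t. P (ray t s)" and \<phi>="\<lambda>t. s * B * t"])
    have d: "((\<lambda>t. P (ray t s)) has_vector_derivative (of_real s * (\<i> * cis t)) * f (ray t s)) (at t)"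
      if t: "\<bar>t\<bar> \<le> \<eta>" for t
    proof -
      have "(cis has_vector_derivative \<i> * cis t) (at t)"
        unfolding has_vector_derivative_def
        by (rule has_derivative_eq_rhs[OF has_derivative_cis[OF has_derivative_ident]])
           (simp add: fun_eq_iff scaleR_conv_of_real)
      then have "((\<lambda>t. ray t s) has_vector_derivative of_real s * (\<i> * cis t)) (at t)"
        unfolding ray_def by (rule has_vector_derivative_mult_right)
      moreover have "ray t s \<notin> \<real>\<^sub>\<le>\<^sub>0" using s t \<eta> by (intro ray_notin_nonpos_Reals) auto
      ultimately show ?thesis
        using field_vector_diff_chain_at[of "\<lambda>t. ray t s" _ t P "f (ray t s)"] P by (simp add: o_def)
    qed
    show "continuous_on {-\<eta>..\<eta>} (\<lambda>t. P (ray t s))"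
      by (rule continuous_on_vector_derivative)
         (rule has_vector_derivative_at_within[OF d], auto)
    show "continuous_on {-\<eta>..\<eta>} (\<lambda>t. s * B * t)" by (intro continuous_intros)
    fix t assume t: "- \<eta> < t" "t < \<eta>"
    show "((\<lambda>t. P (ray t s)) has_vector_derivative (of_real s * (\<i> * cis t)) * f (ray t s)) (at t)"
      using t by (intro d) auto
    show "((\<lambda>t. s * B * t) has_vector_derivative s * B) (at t)"
      unfolding has_real_derivative_iff_has_vector_derivative[symmetric] by (auto intro!: derivative_eq_intros)
    show "cmod ((of_real s * (\<i> * cis t)) * f (ray t s)) \<le> s * B"
      using f[of t] t s by (simp add: norm_mult)
  qed (use \<eta> in auto)
  then show ?thesis by (simp add: algebra_simps)
qed

lemma continuous_on_unit_interval:
  fixes H :: "real \<Rightarrow> 'b::real_normed_vector"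
  assumes "\<And>\<tau>. 0 < \<tau> \<Longrightarrow> \<tau> < 1 \<Longrightarrow> isCont H \<tau>" and b: "\<And>\<tau>. 0 \<le> \<tau> \<Longrightarrow> \<tau> \<le> 1 \<Longrightarrow> norm (H \<tau>) \<le> B * (\<tau> * (1 - \<tau>))"
  shows "continuous_on {0..1} H"
  unfolding continuous_on_def
proof
  fix \<tau> :: real assume \<tau>: "\<tau> \<in> {0..1}"
  show "(H \<longlongrightarrow> H \<tau>) (at \<tau> within {0..1})"
  proof (cases "0 < \<tau> \<and> \<tau> < 1")
    case True
    then have "isCont H \<tau>" by (intro assms(1)) auto
    then show ?thesis unfolding isCont_def by (rule tendsto_within_subset) simp
  next
    case False
    then have z: "\<tau> * (1 - \<tau>) = 0" using \<tau> by auto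
    have "norm (H \<tau>) \<le> B * (\<tau> * (1 - \<tau>))" using b \<tau> by simp
    then have "norm (H \<tau>) \<le> B * 0" by (simp only: z)
    then have "H \<tau> = 0" by simp
    moreover have "(H \<longlongrightarrow> 0) (at \<tau> within {0..1})"
    proof (rule Lim_null_comparison)
      show "\<forall>\<^sub>F x in at \<tau> within {0..1}. norm (H x) \<le> B * (x * (1 - x))"
        using b by (auto simp: eventually_at_filter)
      have "((\<lambda>x. B * (x * (1 - x))) \<longlongrightarrow> B * (\<tau> * (1 - \<tau>))) (at \<tau> within {0..1})"
        by (intro tendsto_intros)
      then show "((\<lambda>x. B * (x * (1 - x))) \<longlongrightarrow> 0) (at \<tau> within {0..1})" by (simp add: z)
    qed
    ultimately show ?thesis by simp
  qed
qed

text \<open>The slit plane is starlike, so \<open>f\<close> has a primitive \<open>P\<close> there, and the difference of \<open>P\<close> at the two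
  points with parameter \<open>\<tau>\<close> is a primitive of the integrand. By \<open>norm_arc_le\<close> it is
  $O(s/(1+s)^2)$, which tends to zero at both ends.\<close>

lemma cauchy_wedge:
  assumes f: "f holomorphic_on - \<real>\<^sub>\<le>\<^sub>0"
    and K: "\<And>s t. s > 0 \<Longrightarrow> \<bar>t\<bar> \<le> \<eta> \<Longrightarrow> cmod (f (ray t s)) \<le> K / (1 + s)\<^sup>2"
  obtains H where "continuous_on {0..1} H" "H 0 = 0" "H 1 = 0"
    "\<And>\<tau>. 0 < \<tau> \<Longrightarrow> \<tau> < 1 \<Longrightarrow> (H has_vector_derivative scalar_integrand f \<tau>) (at \<tau>)"
proof -
  have op: "open (- \<real>\<^sub>\<le>\<^sub>0 :: complex set)" by (simp add: open_Compl)
  have "starlike (- \<real>\<^sub>\<le>\<^sub>0 :: complex set)"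
    using starlike_slotted_complex_plane_left[of 0] slit_eq by (metis Compl_eq_Diff_UNIV)
  then obtain P where P: "\<And>v. v \<notin> \<real>\<^sub>\<le>\<^sub>0 \<Longrightarrow> (P has_field_derivative f v) (at v)"
    using holomorphic_starlike_primitive[of "- \<real>\<^sub>\<le>\<^sub>0" f "{}"] f op
      holomorphic_on_imp_continuous_on[OF f] holomorphic_on_imp_differentiable_at[OF f op] by auto
  \<comment> \<open>Zero is the limit at both ends.\<close>
  define H where "H \<tau> = (if 0 < \<tau> \<and> \<tau> < 1 then P (ray \<eta> (ray_param \<tau>)) - P (ray (- \<eta>) (ray_param \<tau>)) else 0)" for \<tau>
  have deriv: "(H has_vector_derivative scalar_integrand f \<tau>) (at \<tau>)" if \<tau>: "0 < \<tau>" "\<tau> < 1" for \<tau>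
  proof (rule has_vector_derivative_transform_within_open[where S="{0<..<1}"])
    have s: "ray_param \<tau> > 0" using \<tau> by (rule ray_param_pos)
    have "((\<lambda>\<tau>. P (ray \<eta> (ray_param \<tau>))) has_vector_derivative
        of_real (1 / (1 - \<tau>)\<^sup>2) * (cis \<eta> * f (ray \<eta> (ray_param \<tau>)))) (at \<tau>)"
      using \<eta> s by (intro primitive_along_rays[OF \<tau>] P ray_notin_nonpos_Reals) auto
    moreover have "((\<lambda>\<tau>. P (ray (- \<eta>) (ray_param \<tau>))) has_vector_derivative
        of_real (1 / (1 - \<tau>)\<^sup>2) * (cis (- \<eta>) * f (ray (- \<eta>) (ray_param \<tau>)))) (at \<tau>)"
      using \<eta> s by (intro primitive_along_rays[OF \<tau>] P ray_notin_nonpos_Reals) auto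
    ultimately have "((\<lambda>\<tau>. P (ray \<eta> (ray_param \<tau>)) - P (ray (- \<eta>) (ray_param \<tau>))) has_vector_derivative
      of_real (1 / (1 - \<tau>)\<^sup>2) * (cis \<eta> * f (ray \<eta> (ray_param \<tau>))) -
      of_real (1 / (1 - \<tau>)\<^sup>2) * (cis (- \<eta>) * f (ray (- \<eta>) (ray_param \<tau>)))) (at \<tau>)"
      by (rule has_vector_derivative_diff)
    then show "((\<lambda>\<tau>. P (ray \<eta> (ray_param \<tau>)) - P (ray (- \<eta>) (ray_param \<tau>))) has_vector_derivative
        scalar_integrand f \<tau>) (at \<tau>)"
      using \<tau> by (simp add: scalar_integrand_def right_diff_distrib)
  qed (use \<tau> in \<open>auto simp: H_def\<close>)
  show ?thesis
  proof (rule that[of H])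
    show "continuous_on {0..1} H"
    proof (rule continuous_on_unit_interval)
      show "isCont H \<tau>" if "0 < \<tau>" "\<tau> < 1" for \<tau>
        using deriv[OF that] has_vector_derivative_continuous by blast
      fix \<tau> :: real assume \<tau>: "0 \<le> \<tau>" "\<tau> \<le> 1"
      show "cmod (H \<tau>) \<le> 2 * \<eta> * K * (\<tau> * (1 - \<tau>))"
      proof (cases "0 < \<tau> \<and> \<tau> < 1")
        case True
        then have s: "ray_param \<tau> > 0" by (intro ray_param_pos) auto
        have "cmod (H \<tau>) \<le> 2 * \<eta> * ray_param \<tau> * (K / (1 + ray_param \<tau>)\<^sup>2)"
          using norm_arc_le[OF P K[OF s] s] True by (simp add: H_def)
        also have "ray_param \<tau> / (1 + ray_param \<tau>)\<^sup>2 = \<tau> * (1 - \<tau>)"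
          using True by (simp add: ray_param_eq) (simp add: ray_param_def power2_eq_square field_simps)
        then have "2 * \<eta> * ray_param \<tau> * (K / (1 + ray_param \<tau>)\<^sup>2) = 2 * \<eta> * K * (\<tau> * (1 - \<tau>))"
          by (metis (no_types, lifting) mult.assoc mult.commute times_divide_eq_right)
        finally show ?thesis .
      next
        case False
        then have "\<tau> = 0 \<or> \<tau> = 1" using \<tau> by auto
        then show ?thesis by (auto simp: H_def)
      qed
    qed
  qed (use deriv in \<open>auto simp: H_def\<close>)
qed

end

section \<open>Moments of the weight on the contour\<close>

context wedge
begin

lemma continuous_on_ray_param:
  fixes h :: "real \<Rightarrow> 'b::topological_space"
  assumes "continuous_on {0..} h"
  shows "continuous_on {0..<1} (\<lambda>\<tau>. h (ray_param \<tau>))"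
proof (rule continuous_on_compose2[OF assms])
  show "continuous_on {0..<1} ray_param"
    unfolding ray_param_def[abs_def] by (intro continuous_intros) auto
qed (auto simp: ray_param_def)

text \<open>One power of $1+s = 1/(1-\tau)$ is set aside, so that integrands of polynomial growth vanish at
  $\tau = 1$, the end of the rays.\<close>

lemma weight_bound:
  "\<exists>K>0. \<forall>\<tau>. 0 \<le> \<tau> \<and> \<tau> < 1 \<longrightarrow> (\<forall>t. \<bar>t\<bar> \<le> \<eta> \<longrightarrow>
     1 / (1 - \<tau>)\<^sup>2 * cmod (slit_exp \<gamma> (ray t (ray_param \<tau>))) * (1 + ray_param \<tau>) ^ N \<le> K * (1 - \<tau>))"
proof -
  obtain K where K: "K > 0" "\<And>s. s \<ge> 0 \<Longrightarrow> (1 + s) ^ (N + 3) * exp (- decay * s powr \<gamma>) \<le> K"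
    using poly_decay_bounded by blast
  show ?thesis
  proof (intro exI[of _ K] conjI allI impI)
    fix \<tau> t :: real assume \<tau>: "0 \<le> \<tau> \<and> \<tau> < 1" and t: "\<bar>t\<bar> \<le> \<eta>"
    let ?s = "ray_param \<tau>"
    have s: "?s \<ge> 0" using \<tau> by (intro ray_param_nonneg) auto
    have e: "1 / (1 - \<tau>) = 1 + ?s" using \<tau> ray_param_eq[of \<tau>] by simp
    have "(1 + ?s) ^ 3 * cmod (slit_exp \<gamma> (ray t ?s)) * (1 + ?s) ^ N
        \<le> (1 + ?s) ^ 3 * exp (- decay * ?s powr \<gamma>) * (1 + ?s) ^ N"
      using s by (intro mult_right_mono mult_left_mono norm_slit_exp_le t) auto
    also have "\<dots> = (1 + ?s) ^ (N + 3) * exp (- decay * ?s powr \<gamma>)" by (simp add: power_add mult_ac)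
    also have "\<dots> \<le> K" by (rule K(2)[OF s])
    finally have "(1 + ?s) ^ 3 * cmod (slit_exp \<gamma> (ray t ?s)) * (1 + ?s) ^ N * (1 - \<tau>) \<le> K * (1 - \<tau>)"
      using \<tau> by (intro mult_right_mono) auto
    moreover have "(1 + ?s) ^ 3 * (1 - \<tau>) = 1 / (1 - \<tau>)\<^sup>2"
      using \<tau> by (simp add: power3_eq_cube power2_eq_square flip: e)
    ultimately show "1 / (1 - \<tau>)\<^sup>2 * cmod (slit_exp \<gamma> (ray t ?s)) * (1 + ?s) ^ N \<le> K * (1 - \<tau>)"
      by (metis (no_types, lifting) mult.assoc mult.commute)
  qed (rule K(1))
qed

lemma continuous_on_scalar_integrand:
  assumes g: "continuous_on {0..} (\<lambda>s. g (ray \<eta> s))" "continuous_on {0..} (\<lambda>s. g (ray (- \<eta>) s))"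
    and b: "\<And>s t. s \<ge> 0 \<Longrightarrow> \<bar>t\<bar> = \<eta> \<Longrightarrow> cmod (g (ray t s)) \<le> B * (1 + s) ^ N"
  shows "continuous_on {0..1} (scalar_integrand (\<lambda>v. slit_exp \<gamma> v * g v))"
proof -
  let ?G = "scalar_integrand (\<lambda>v. slit_exp \<gamma> v * g v)"
  have c: "continuous_on {0..<1} ?G"
  proof (rule continuous_on_eq)
    show "continuous_on {0..<1} (\<lambda>\<tau>. of_real (1 / (1 - \<tau>)\<^sup>2) *
     (cis \<eta> * (slit_exp \<gamma> (ray \<eta> (ray_param \<tau>)) * g (ray \<eta> (ray_param \<tau>)))
       - cis (- \<eta>) * (slit_exp \<gamma> (ray (- \<eta>) (ray_param \<tau>)) * g (ray (- \<eta>) (ray_param \<tau>)))))"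
      using \<eta>
      by (intro continuous_intros continuous_on_ray_param[OF g(1)] continuous_on_ray_param[OF g(2)]
          continuous_on_ray_param[OF continuous_on_slit_exp_ray]) auto
  qed (simp add: scalar_integrand_def)
  obtain K where K: "K > 0" "\<And>\<tau> t. 0 \<le> \<tau> \<Longrightarrow> \<tau> < 1 \<Longrightarrow> \<bar>t\<bar> \<le> \<eta> \<Longrightarrow>
     1 / (1 - \<tau>)\<^sup>2 * cmod (slit_exp \<gamma> (ray t (ray_param \<tau>))) * (1 + ray_param \<tau>) ^ N \<le> K * (1 - \<tau>)"
    using weight_bound[of N] by blast
  have bd: "cmod (?G \<tau>) \<le> 2 * \<bar>B\<bar> * K * (1 - \<tau>)" if \<tau>: "0 \<le> \<tau>" "\<tau> \<le> 1" for \<tau>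
  proof (cases "\<tau> < 1")
    case True
    let ?s = "ray_param \<tau>"
    have s: "?s \<ge> 0" using \<tau> True by (intro ray_param_nonneg) auto
    have part: "1 / (1 - \<tau>)\<^sup>2 * cmod (cis t * (slit_exp \<gamma> (ray t ?s) * g (ray t ?s))) \<le> \<bar>B\<bar> * K * (1 - \<tau>)"
      if t: "\<bar>t\<bar> = \<eta>" for t
    proof -
      have "cmod (g (ray t ?s)) \<le> \<bar>B\<bar> * (1 + ?s) ^ N"
        using b[OF s t] s by (smt (verit) mult_right_mono zero_le_power)
      then have "1 / (1 - \<tau>)\<^sup>2 * cmod (slit_exp \<gamma> (ray t ?s)) * cmod (g (ray t ?s))
          \<le> 1 / (1 - \<tau>)\<^sup>2 * cmod (slit_exp \<gamma> (ray t ?s)) * (\<bar>B\<bar> * (1 + ?s) ^ N)"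
        by (intro mult_left_mono) auto
      also have "\<dots> = \<bar>B\<bar> * (1 / (1 - \<tau>)\<^sup>2 * cmod (slit_exp \<gamma> (ray t ?s)) * (1 + ?s) ^ N)" by simp
      also have "\<dots> \<le> \<bar>B\<bar> * (K * (1 - \<tau>))" using t \<tau> True by (intro mult_left_mono K(2)) auto
      finally show ?thesis by (simp add: norm_mult mult.assoc)
    qed
    have "cmod (?G \<tau>) \<le> 1 / (1 - \<tau>)\<^sup>2 * (cmod (cis \<eta> * (slit_exp \<gamma> (ray \<eta> ?s) * g (ray \<eta> ?s)))
        + cmod (cis (- \<eta>) * (slit_exp \<gamma> (ray (- \<eta>) ?s) * g (ray (- \<eta>) ?s))))"
      unfolding scalar_integrand_def using True
      by (simp only: if_True norm_mult[of "of_real _"] norm_of_real)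
        (simp add: divide_right_mono norm_triangle_ineq4 del: norm_mult)
    also have "\<dots> \<le> \<bar>B\<bar> * K * (1 - \<tau>) + \<bar>B\<bar> * K * (1 - \<tau>)"
      unfolding distrib_left using \<eta> by (intro add_mono part) auto
    finally show ?thesis by (simp add: mult_ac)
  next
    case False then show ?thesis using \<tau> by (simp add: scalar_integrand_def)
  qed
  have "(?G \<longlongrightarrow> 0) (at 1 within {0..1})"
    by (rule Lim_null_comparison[OF _ tendsto_one_minus_mult[of "2 * \<bar>B\<bar> * K"]])
      (use bd in \<open>auto simp: eventually_at_filter\<close>)
  then show ?thesis
    by (intro continuous_on_closed_unit_interval[OF c]) (simp add: scalar_integrand_def)
qed

lemma holomorphic_on_slit_exp: "slit_exp \<gamma> holomorphic_on - \<real>\<^sub>\<le>\<^sub>0"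
  unfolding slit_exp_def[abs_def] by (intro holomorphic_intros) auto

lemma norm_one_minus_ray_le: "s \<ge> 0 \<Longrightarrow> cmod (1 - ray t s) \<le> 1 + s"
  using norm_triangle_ineq4[of 1 "ray t s"] by (simp add: norm_ray)

text \<open>The distance from the point $1$ to the line that carries the ray is $\sin\eta$.\<close>

lemma norm_one_minus_ray_ge:
  assumes "\<bar>t\<bar> = \<eta>" shows "cmod (1 - ray t s) \<ge> sin \<eta>"
proof -
  have "t = \<eta> \<or> t = - \<eta>" using assms by auto
  then have ct: "cos t = cos \<eta>" "(sin t)\<^sup>2 = (sin \<eta>)\<^sup>2" by auto
  have "(cmod (1 - ray t s))\<^sup>2 = (1 - s * cos t)\<^sup>2 + (s * sin t)\<^sup>2"
    by (simp add: cmod_power2 ray_def)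
  also have "\<dots> = (s - cos \<eta>)\<^sup>2 + (sin \<eta>)\<^sup>2"
    unfolding power_mult_distrib[of s "sin t"] ct sin_squared_eq by (simp add: power2_eq_square algebra_simps)
  finally have "(sin \<eta>)\<^sup>2 \<le> (cmod (1 - ray t s))\<^sup>2" by simp
  then show ?thesis by (rule power2_le_imp_le) simp
qed

lemma sin_\<eta>_pos: "sin \<eta> > 0"
  using \<eta> by (intro sin_gt_zero) auto

text \<open>The function $e(v)(1-v)^m$ is holomorphic between the rays.\<close>

lemma vanishing_moment:
  "vint (\<lambda>\<tau>. scalar_integrand (\<lambda>v. slit_exp \<gamma> v * (1 - v) ^ m) \<tau> *\<^sub>C y) = 0"
proof -
  obtain K where K: "\<And>s. s \<ge> 0 \<Longrightarrow> (1 + s) ^ (m + 2) * exp (- decay * s powr \<gamma>) \<le> K"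
    using poly_decay_bounded by blast
  have "cmod (slit_exp \<gamma> (ray t s) * (1 - ray t s) ^ m) \<le> K / (1 + s)\<^sup>2" if "s > 0" "\<bar>t\<bar> \<le> \<eta>" for s t
  proof -
    have "cmod (slit_exp \<gamma> (ray t s) * (1 - ray t s) ^ m) \<le> exp (- decay * s powr \<gamma>) * (1 + s) ^ m"
      unfolding norm_mult norm_power
      using that by (intro mult_mono power_mono norm_slit_exp_le norm_one_minus_ray_le) auto
    also have "\<dots> = (1 + s) ^ (m + 2) * exp (- decay * s powr \<gamma>) / (1 + s)\<^sup>2"
      using that unfolding power_add[of _ m 2] by simp
    also have "\<dots> \<le> K / (1 + s)\<^sup>2" using that by (intro divide_right_mono K) auto
    finally show ?thesis .
  qed
  moreover have "(\<lambda>v. slit_exp \<gamma> v * (1 - v) ^ m) holomorphic_on - \<real>\<^sub>\<le>\<^sub>0"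
    by (intro holomorphic_intros holomorphic_on_slit_exp)
  ultimately obtain H where H: "continuous_on {0..1} H" "H 0 = 0" "H 1 = 0"
    "\<And>\<tau>. 0 < \<tau> \<Longrightarrow> \<tau> < 1 \<Longrightarrow> (H has_vector_derivative scalar_integrand (\<lambda>v. slit_exp \<gamma> v * (1 - v) ^ m) \<tau>) (at \<tau>)"
    using cauchy_wedge[of "\<lambda>v. slit_exp \<gamma> v * (1 - v) ^ m" K] by blast
  have "continuous_on {0..1} (scalar_integrand (\<lambda>v. slit_exp \<gamma> v * (1 - v) ^ m))"
    by (rule continuous_on_scalar_integrand[where B=1 and N=m])
      (auto simp: norm_power ray_def intro!: continuous_intros power_mono norm_one_minus_ray_le[unfolded ray_def])
  from vint_fundamental_theorem[OF this H(1,4)] show ?thesis using H by simp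
qed

lemma norm_one_plus_ray_ge:
  assumes "s \<ge> 0" "\<bar>t\<bar> \<le> \<eta>"
  shows "cmod (1 + ray t s) \<ge> sqrt ((1 + cos \<eta>) / 2) * (1 + s)"
proof -
  have "cos \<eta> \<le> cos \<bar>t\<bar>" using assms \<eta> by (intro cos_monotone_0_pi_le) auto
  then have c: "cos \<eta> \<le> cos t" by simp
  have c1: "1 + cos \<eta> \<ge> 0" using cos_ge_minus_one[of \<eta>] by linarith
  have "(sqrt ((1 + cos \<eta>) / 2) * (1 + s))\<^sup>2 = (1 + cos \<eta>) / 2 * (1 + s)\<^sup>2"
    using c1 by (simp add: power_mult_distrib)
  also have "\<dots> \<le> (1 + cos \<eta>) / 2 * (1 + s)\<^sup>2 + (1 - cos \<eta>) / 2 * (1 - s)\<^sup>2"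
    by simp
  also have "\<dots> = 1 + s\<^sup>2 + 2 * (s * cos \<eta>)" by (simp add: power2_eq_square field_simps)
  also have "\<dots> \<le> 1 + s\<^sup>2 + 2 * (s * cos t)" using assms c by (simp add: mult_left_mono)
  also have "\<dots> = (1 + s * cos t)\<^sup>2 + (s * sin t)\<^sup>2"
    by (simp add: power2_sum power_mult_distrib sin_squared_eq algebra_simps)
  also have "\<dots> = (cmod (1 + ray t s))\<^sup>2" by (simp add: cmod_power2 ray_def)
  finally show ?thesis by (rule power2_le_imp_le) simp
qed

lemma one_plus_cos_pos: "1 + cos \<eta> > 0"
  using cos_monotone_0_pi[of \<eta> pi] \<eta> by simp

lemma ray_ne_1:
  assumes "\<bar>t\<bar> = \<eta>" shows "ray t s \<noteq> 1"
  using norm_one_minus_ray_ge[OF assms, of s] sin_\<eta>_pos by auto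

text \<open>The Cayley transform $(1+v)/(1-v)$ maps the upper and the lower half-plane to themselves. After
  multiplication by $\mp i$ it stays off the cut of the logarithm along the ray, the point at infinity included: there
  it takes the value $\pm i$.\<close>

lemma log_cayley_notin:
  assumes t: "\<bar>t\<bar> = \<eta>" and \<tau>: "0 \<le> \<tau>" "\<tau> \<le> 1"
  shows "of_real (1 - \<tau>) - of_real \<tau> * cis t \<noteq> 0"
    and "- \<i> * of_real (sgn t) * (of_real (1 - \<tau>) + of_real \<tau> * cis t) / (of_real (1 - \<tau>) - of_real \<tau> * cis t) \<notin> \<real>\<^sub>\<le>\<^sub>0"
proof -
  have ts: "sgn t * sin t > 0"
  proof (cases "t > 0")
    case True then show ?thesis using t \<eta> sin_gt_zero[of t] by simp
  next
    case False
    then have "t = - \<eta>" using t by simp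
    then show ?thesis using \<eta> sin_\<eta>_pos by (simp add: sgn_if)
  qed
  then have st: "sin t \<noteq> 0" and sg: "sgn t \<noteq> 0" by auto
  let ?B = "of_real (1 - \<tau>) - of_real \<tau> * cis t" and ?A = "of_real (1 - \<tau>) + of_real \<tau> * cis t"
  show B: "?B \<noteq> 0"
  proof
    assume B: "?B = 0"
    have "\<tau> * sin t = 0" using arg_cong[OF B, of Im] by simp
    then have "\<tau> = 0" using st by simp
    then show False using B by simp
  qed
  show "- \<i> * of_real (sgn t) * ?A / ?B \<notin> \<real>\<^sub>\<le>\<^sub>0"
  proof
    assume "- \<i> * of_real (sgn t) * ?A / ?B \<in> \<real>\<^sub>\<le>\<^sub>0"
    then obtain r where r: "r \<le> 0" "- \<i> * of_real (sgn t) * ?A / ?B = of_real r" by (auto simp: nonpos_Reals_def)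
    then have e: "- \<i> * of_real (sgn t) * ?A = of_real r * ?B" using B by (simp add: field_simps)
    have e1: "sgn t * (\<tau> * sin t) = r * ((1 - \<tau>) - \<tau> * cos t)" using arg_cong[OF e, of Re] by simp
    have e2: "- (sgn t * ((1 - \<tau>) + \<tau> * cos t)) = - r * (\<tau> * sin t)" using arg_cong[OF e, of Im] by simp
    have "sgn t * (\<tau> * sin t)\<^sup>2 = (r * (\<tau> * sin t)) * ((1 - \<tau>) - \<tau> * cos t)"
      using arg_cong[OF e1, of "\<lambda>x. x * (\<tau> * sin t)"] by (simp add: power2_eq_square mult_ac)
    also have "r * (\<tau> * sin t) = sgn t * ((1 - \<tau>) + \<tau> * cos t)" using e2 by simp
    finally have "sgn t * (\<tau> * sin t)\<^sup>2 = sgn t * ((1 - \<tau>)\<^sup>2 - (\<tau> * cos t)\<^sup>2)"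
      by (simp add: power2_eq_square algebra_simps)
    then have "(\<tau> * sin t)\<^sup>2 = (1 - \<tau>)\<^sup>2 - (\<tau> * cos t)\<^sup>2" using sg by simp
    then have "\<tau>\<^sup>2 * ((sin t)\<^sup>2 + (cos t)\<^sup>2) = (1 - \<tau>)\<^sup>2"
      by (simp only: power_mult_distrib distrib_left)
    then have half: "\<tau> = 1/2" by (simp add: power2_eq_square algebra_simps)
    have "sgn t * sin t = r * (1 - cos t)" using e1[unfolded half] by (simp add: field_simps)
    also have "\<dots> \<le> 0" using r(1) cos_le_one[of t] by (intro mult_nonpos_nonneg) auto
    finally show False using ts by simp
  qed
qed

text \<open>A primitive of $2/((1-v)(1+v))$ along one ray. It is written in \<open>\<tau>\<close>, not in \<open>v\<close>, so that it extends
  continuously to \<open>\<tau> = 1\<close>.\<close>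

lemma log_cayley_primitive:
  assumes t: "\<bar>t\<bar> = \<eta>"
  obtains L where "continuous_on {0..1} L" "L 1 - L 0 = of_real (sgn t) * \<i> * of_real pi"
    "\<And>\<tau>. 0 < \<tau> \<Longrightarrow> \<tau> < 1 \<Longrightarrow> (L has_vector_derivative of_real (1 / (1 - \<tau>)\<^sup>2) *
       (cis t * (2 / ((1 - ray t (ray_param \<tau>)) * (1 + ray t (ray_param \<tau>)))))) (at \<tau>)"
proof -
  define L where "L \<tau> = Ln (- \<i> * of_real (sgn t) * (of_real (1 - \<tau>) + of_real \<tau> * cis t) / (of_real (1 - \<tau>) - of_real \<tau> * cis t))" for \<tau>
  define P where "P v = Ln (- \<i> * of_real (sgn t) * (1 + v) / (1 - v))" for v
  have sg: "sgn t = 1 \<or> sgn t = -1" using t \<eta> by (auto simp: sgn_if)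
  show ?thesis
  proof (rule that[of L])
    show "continuous_on {0..1} L"
      unfolding L_def using log_cayley_notin[OF t] by (intro continuous_intros) auto
    show "L 1 - L 0 = of_real (sgn t) * \<i> * of_real pi"
      using sg by (auto simp: L_def)
    fix \<tau> :: real assume \<tau>: "0 < \<tau>" "\<tau> < 1"
    show "(L has_vector_derivative of_real (1 / (1 - \<tau>)\<^sup>2) *
       (cis t * (2 / ((1 - ray t (ray_param \<tau>)) * (1 + ray t (ray_param \<tau>)))))) (at \<tau>)"
    proof (rule has_vector_derivative_transform_within_open[where S="{0<..<1}"])
      have PL: "P (ray t (ray_param x)) = L x" "- \<i> * of_real (sgn t) * (1 + ray t (ray_param x)) / (1 - ray t (ray_param x)) \<notin> \<real>\<^sub>\<le>\<^sub>0"
        if "0 < x" "x < 1" for x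
      proof -
        have x: "complex_of_real (1 - x) \<noteq> 0" using that by simp
        have "1 + ray t (ray_param x) = (of_real (1 - x) + of_real x * cis t) / of_real (1 - x)"
          "1 - ray t (ray_param x) = (of_real (1 - x) - of_real x * cis t) / of_real (1 - x)"
          using x by (simp_all add: ray_def ray_param_def add_divide_distrib diff_divide_distrib)
        then have eq: "- \<i> * of_real (sgn t) * (1 + ray t (ray_param x)) / (1 - ray t (ray_param x)) =
            - \<i> * of_real (sgn t) * (of_real (1 - x) + of_real x * cis t) / (of_real (1 - x) - of_real x * cis t)"
          using x by simp
        show "P (ray t (ray_param x)) = L x" unfolding P_def L_def eq ..
        show "- \<i> * of_real (sgn t) * (1 + ray t (ray_param x)) / (1 - ray t (ray_param x)) \<notin> \<real>\<^sub>\<le>\<^sub>0"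
          unfolding eq using log_cayley_notin(2)[OF t] that by auto
      qed
      show "P (ray t (ray_param x)) = L x" if "x \<in> {0<..<1}" for x using PL(1) that by simp
      let ?v = "ray t (ray_param \<tau>)"
      have v: "1 - ?v \<noteq> 0" using ray_ne_1[OF t] by auto
      have nz: "- \<i> * of_real (sgn t) * (1 + ?v) / (1 - ?v) \<notin> \<real>\<^sub>\<le>\<^sub>0" by (rule PL(2)[OF \<tau>])
      then have v': "1 + ?v \<noteq> 0" by auto
      have sg': "complex_of_real (sgn t) \<noteq> 0" using sg by auto
      have "((\<lambda>v. - \<i> * of_real (sgn t) * (1 + v) / (1 - v)) has_field_derivative
          - \<i> * of_real (sgn t) * (2 / (1 - ?v)\<^sup>2)) (at ?v)"
        using v by (auto intro!: derivative_eq_intros simp: power2_eq_square field_simps)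
      from DERIV_chain2[OF has_field_derivative_Ln[OF nz] this]
      have "(P has_field_derivative inverse (- \<i> * of_real (sgn t) * (1 + ?v) / (1 - ?v)) *
          (- \<i> * of_real (sgn t) * (2 / (1 - ?v)\<^sup>2))) (at ?v)"
        unfolding P_def[abs_def] .
      moreover have "inverse (k * (1 + ?v) / (1 - ?v)) * (k * (2 / (1 - ?v)\<^sup>2)) = 2 / ((1 - ?v) * (1 + ?v))"
        if "k \<noteq> 0" for k
      proof -
        have "inverse (k * a / b) * (k * (2 / b\<^sup>2)) = 2 / (b * a)" if "k \<noteq> 0" "a \<noteq> 0" "b \<noteq> 0" for k a b :: complex
          using that by (simp add: power2_eq_square field_simps)
        from this[OF that v' v] show ?thesis .
      qed
      moreover have "- \<i> * complex_of_real (sgn t) \<noteq> 0" using sg' by simp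
      ultimately have "(P has_field_derivative 2 / ((1 - ?v) * (1 + ?v))) (at ?v)" by metis
      then show "((\<lambda>\<tau>. P (ray t (ray_param \<tau>))) has_vector_derivative of_real (1 / (1 - \<tau>)\<^sup>2) *
       (cis t * (2 / ((1 - ray t (ray_param \<tau>)) * (1 + ray t (ray_param \<tau>)))))) (at \<tau>)"
        using t by (intro primitive_along_rays[OF \<tau>]) auto
    qed (use \<tau> in auto)
  qed
qed

text \<open>Near \<open>v = 1\<close> the bound comes from continuity on a compact piece of the wedge; elsewhere division
  by \<open>1 - v\<close> gains one power of \<open>1 + s\<close>.\<close>

lemma simple_pole_quotient_bound:
  fixes f :: "complex \<Rightarrow> complex"
  assumes cont: "continuous_on (- \<real>\<^sub>\<le>\<^sub>0) f"
    and K: "\<And>s t. s > 0 \<Longrightarrow> \<bar>t\<bar> \<le> \<eta> \<Longrightarrow> ray t s \<noteq> 1 \<Longrightarrow> cmod ((1 - ray t s) * f (ray t s)) \<le> K / (1 + s)"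
  shows "\<exists>K'. \<forall>s>0. \<forall>t. \<bar>t\<bar> \<le> \<eta> \<longrightarrow> cmod (f (ray t s)) \<le> K' / (1 + s)\<^sup>2"
proof -
  let ?C = "(\<lambda>x. ray (fst x) (snd x)) ` ({-\<eta>..\<eta>} \<times> {1/2..2})"
  have "compact ?C"
    unfolding ray_def by (intro compact_continuous_image continuous_intros compact_Times compact_Icc)
  moreover have "?C \<subseteq> - \<real>\<^sub>\<le>\<^sub>0"
  proof clarsimp
    fix t s :: real assume "- \<eta> \<le> t" "t \<le> \<eta>" "1 \<le> s * 2" "ray t s \<in> \<real>\<^sub>\<le>\<^sub>0"
    then show False using ray_notin_nonpos_Reals[of s t] \<eta> by simp
  qed
  ultimately have "compact (f ` ?C)"
    by (intro compact_continuous_image[OF continuous_on_subset[OF cont]])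
  then have "bounded (f ` ?C)" by (rule compact_imp_bounded)
  then obtain M where M': "\<And>y. y \<in> f ` ?C \<Longrightarrow> cmod y \<le> M" unfolding bounded_iff by blast
  have M: "cmod (f (ray t s)) \<le> M" if "\<bar>t\<bar> \<le> \<eta>" "1/2 \<le> s" "s \<le> 2" for t s
    by (intro M' imageI image_eqI[where x="(t, s)"]) (use that in auto)
  have "ray 0 2 \<noteq> 1" by (simp add: ray_def)
  then have "0 \<le> K / (1 + 2)" using \<eta> by (intro order_trans[OF norm_ge_zero K[of 2 0]]) auto
  then have K0: "K \<ge> 0" by simp
  have M0: "M \<ge> 0" using M[of 0 1] \<eta> order_trans[OF norm_ge_zero] by simp
  show ?thesis
  proof (intro exI[of _ "max (9 * M) (3 * K)"] allI impI)
    fix s t :: real assume s: "s > 0" and t: "\<bar>t\<bar> \<le> \<eta>"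
    show "cmod (f (ray t s)) \<le> max (9 * M) (3 * K) / (1 + s)\<^sup>2"
    proof (cases "1/2 \<le> s \<and> s \<le> 2")
      case True
      then have "(1 + s)\<^sup>2 \<le> 3\<^sup>2" using s by (intro power_mono) auto
      then have "cmod (f (ray t s)) * (1 + s)\<^sup>2 \<le> M * 9"
        using M[of t s] True t M0 by (intro mult_mono) auto
      then show ?thesis using s by (simp add: le_divide_eq)
    next
      case False
      then have d: "\<bar>1 - s\<bar> \<ge> (1 + s) / 3" by (auto simp: abs_if)
      have "\<bar>1 - s\<bar> \<le> cmod (1 - ray t s)"
        using norm_triangle_ineq3[of 1 "ray t s"] s by (simp add: norm_ray)
      then have d': "cmod (1 - ray t s) \<ge> (1 + s) / 3" using d by linarith
      then have "ray t s \<noteq> 1" using s by auto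
      have "(1 + s) / 3 * cmod (f (ray t s)) \<le> cmod (1 - ray t s) * cmod (f (ray t s))"
        using d' by (intro mult_right_mono) auto
      also have "\<dots> \<le> K / (1 + s)" using K[OF s t \<open>ray t s \<noteq> 1\<close>] by (simp add: norm_mult)
      finally have "cmod (f (ray t s)) * (1 + s)\<^sup>2 \<le> 3 * K"
        using s by (simp add: field_simps power2_eq_square)
      then show ?thesis using s by (simp add: le_divide_eq)
    qed
  qed
qed

definition residue_const :: complex where
  "residue_const = 2 * of_real pi * \<i> * exp (- 1)"

text \<open>The pole of $e(v)/(1-v)$ at $v = 1$ is removed by subtracting $e(1) \cdot 2/((1-v)(1+v))$, whose
  integral along the rays is computed by logarithms. What remains is covered by \<open>cauchy_wedge\<close>.\<close>

lemma residue_moment: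
  "vint (\<lambda>\<tau>. scalar_integrand (\<lambda>v. slit_exp \<gamma> v * (1 / (1 - v))) \<tau> *\<^sub>C y) = residue_const *\<^sub>C y"
proof -
  define e1 where "e1 = exp (- 1 :: complex)"
  define E where "E v = slit_exp \<gamma> v - e1 * (2 / (1 + v))" for v
  have E1: "E 1 = 0" by (simp add: E_def slit_exp_def e1_def)
  have nz: "1 + v \<noteq> 0" if "v \<in> - \<real>\<^sub>\<le>\<^sub>0" for v :: complex
  proof
    assume "1 + v = 0" then have "v = of_real (- 1)" by (simp add: add_eq_0_iff)
    then show False using that by (simp add: complex_nonpos_Reals_iff)
  qed
  have holE: "E holomorphic_on - \<real>\<^sub>\<le>\<^sub>0"
    unfolding E_def[abs_def] using nz by (intro holomorphic_intros holomorphic_on_slit_exp) auto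
  define f where "f v = - (if v = 1 then deriv E 1 else (E v - E 1) / (v - 1))" for v
  have f: "f v = slit_exp \<gamma> v * (1 / (1 - v)) - e1 * (2 / ((1 - v) * (1 + v)))" if "v \<noteq> 1" for v
  proof -
    have "f v = E v / (1 - v)" using that by (simp add: f_def E1 divide_simps algebra_simps)
    then show ?thesis by (simp add: E_def diff_divide_distrib)
  qed
  have holf: "f holomorphic_on - \<real>\<^sub>\<le>\<^sub>0"
    unfolding f_def[abs_def] by (intro holomorphic_intros pole_lemma_open[OF holE]) (simp add: open_Compl)
  obtain K where K: "K > 0" "\<And>s. s \<ge> 0 \<Longrightarrow> (1 + s) ^ 1 * exp (- decay * s powr \<gamma>) \<le> K"
    using poly_decay_bounded by blast
  define \<delta> where "\<delta> = sqrt ((1 + cos \<eta>) / 2)"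
  have \<delta>: "\<delta> > 0" using one_plus_cos_pos by (simp add: \<delta>_def)
  have "cmod ((1 - ray t s) * f (ray t s)) \<le> (K + 2 * cmod e1 / \<delta>) / (1 + s)"
    if s: "s > 0" and t: "\<bar>t\<bar> \<le> \<eta>" and ne: "ray t s \<noteq> 1" for s t
  proof -
    have "(1 - ray t s) * f (ray t s) = E (ray t s)"
      using ne by (simp add: f_def E1 divide_simps algebra_simps)
    then have "cmod ((1 - ray t s) * f (ray t s)) \<le> cmod (slit_exp \<gamma> (ray t s)) + cmod (e1 * (2 / (1 + ray t s)))"
      unfolding E_def by (simp only:) (rule norm_triangle_ineq4)
    also have "cmod (slit_exp \<gamma> (ray t s)) \<le> K / (1 + s)"
    proof -
      have "(1 + s) * cmod (slit_exp \<gamma> (ray t s)) \<le> (1 + s) * exp (- decay * s powr \<gamma>)"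
        using s t by (intro mult_left_mono norm_slit_exp_le) auto
      also have "\<dots> \<le> K" using K(2)[of s] s by simp
      finally show ?thesis using s by (simp add: le_divide_eq mult.commute)
    qed
    also have "cmod (e1 * (2 / (1 + ray t s))) \<le> 2 * cmod e1 / (\<delta> * (1 + s))"
    proof -
      have "\<delta> * (1 + s) \<le> cmod (1 + ray t s)" unfolding \<delta>_def using s t by (intro norm_one_plus_ray_ge) auto
      moreover have "\<delta> * (1 + s) > 0" using \<delta> s by simp
      ultimately have "2 * cmod e1 / cmod (1 + ray t s) \<le> 2 * cmod e1 / (\<delta> * (1 + s))"
        by (intro frac_le) simp_all
      then show ?thesis by (simp add: norm_mult norm_divide mult.commute)
    qed
    finally show ?thesis by (simp add: add_divide_distrib)
  qed
  from simple_pole_quotient_bound[OF holomorphic_on_imp_continuous_on[OF holf] this]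
  obtain K' where K': "\<And>s t. s > 0 \<Longrightarrow> \<bar>t\<bar> \<le> \<eta> \<Longrightarrow> cmod (f (ray t s)) \<le> K' / (1 + s)\<^sup>2" by blast
  obtain H where H: "continuous_on {0..1} H" "H 0 = 0" "H 1 = 0"
    "\<And>\<tau>. 0 < \<tau> \<Longrightarrow> \<tau> < 1 \<Longrightarrow> (H has_vector_derivative scalar_integrand f \<tau>) (at \<tau>)"
    using cauchy_wedge[OF holf K'] by blast
  have sgn: "sgn \<eta> = 1" "sgn (- \<eta>) = - 1" using \<eta> by (auto simp: sgn_if)
  obtain L where L: "continuous_on {0..1} L" "L 1 - L 0 = of_real (sgn \<eta>) * \<i> * of_real pi"
    "\<And>\<tau>. 0 < \<tau> \<Longrightarrow> \<tau> < 1 \<Longrightarrow> (L has_vector_derivative of_real (1 / (1 - \<tau>)\<^sup>2) *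
       (cis \<eta> * (2 / ((1 - ray \<eta> (ray_param \<tau>)) * (1 + ray \<eta> (ray_param \<tau>)))))) (at \<tau>)"
    by (rule log_cayley_primitive[of \<eta>]) (use \<eta> in auto)
  obtain L' where L': "continuous_on {0..1} L'" "L' 1 - L' 0 = of_real (sgn (- \<eta>)) * \<i> * of_real pi"
    "\<And>\<tau>. 0 < \<tau> \<Longrightarrow> \<tau> < 1 \<Longrightarrow> (L' has_vector_derivative of_real (1 / (1 - \<tau>)\<^sup>2) *
       (cis (- \<eta>) * (2 / ((1 - ray (- \<eta>) (ray_param \<tau>)) * (1 + ray (- \<eta>) (ray_param \<tau>)))))) (at \<tau>)"
    by (rule log_cayley_primitive[of "- \<eta>"]) (use \<eta> in auto)
  \<comment> \<open>The increments of \<open>L\<close> and \<open>L'\<close> are \<open>\<i> * pi\<close> and \<open>- \<i> * pi\<close>.\<close>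
  define F where "F \<tau> = H \<tau> + e1 * (L \<tau> - L' \<tau>)" for \<tau>
  have "continuous_on {0..1} F" unfolding F_def by (intro continuous_intros H L L')
  moreover have "(F has_vector_derivative scalar_integrand (\<lambda>v. slit_exp \<gamma> v * (1 / (1 - v))) \<tau>) (at \<tau>)"
    if \<tau>: "0 < \<tau>" "\<tau> < 1" for \<tau>
  proof -
    let ?a = "ray \<eta> (ray_param \<tau>)" and ?b = "ray (- \<eta>) (ray_param \<tau>)" and ?d = "complex_of_real (1 / (1 - \<tau>)\<^sup>2)"
    have fa: "f ?a = slit_exp \<gamma> ?a * (1 / (1 - ?a)) - e1 * (2 / ((1 - ?a) * (1 + ?a)))"
      and fb: "f ?b = slit_exp \<gamma> ?b * (1 / (1 - ?b)) - e1 * (2 / ((1 - ?b) * (1 + ?b)))"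
      by (rule f, rule ray_ne_1, use \<eta> in simp)+
    have "(F has_vector_derivative scalar_integrand f \<tau> +
        e1 * (?d * (cis \<eta> * (2 / ((1 - ?a) * (1 + ?a)))) - ?d * (cis (- \<eta>) * (2 / ((1 - ?b) * (1 + ?b)))))) (at \<tau>)"
      unfolding F_def
      by (intro has_vector_derivative_add has_vector_derivative_mult_right has_vector_derivative_diff H(4) L(3) L'(3) \<tau>)
    also have "scalar_integrand f \<tau> +
        e1 * (?d * (cis \<eta> * (2 / ((1 - ?a) * (1 + ?a)))) - ?d * (cis (- \<eta>) * (2 / ((1 - ?b) * (1 + ?b)))))
        = scalar_integrand (\<lambda>v. slit_exp \<gamma> v * (1 / (1 - v))) \<tau>"
      unfolding scalar_integrand_def fa fb using \<tau>(2) by (simp only: if_True) (simp only: ring_distribs mult_ac, simp)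
    finally show ?thesis .
  qed
  moreover have "continuous_on {0..1} (scalar_integrand (\<lambda>v. slit_exp \<gamma> v * (1 / (1 - v))))"
  proof (rule continuous_on_scalar_integrand[where B="1 / sin \<eta>" and N=0])
    show "continuous_on {0..} (\<lambda>s. 1 / (1 - ray \<eta> s))" "continuous_on {0..} (\<lambda>s. 1 / (1 - ray (- \<eta>) s))"
      using ray_ne_1[of \<eta>] ray_ne_1[of "- \<eta>"] \<eta> by (auto simp: ray_def intro!: continuous_intros)
    show "cmod (1 / (1 - ray t s)) \<le> 1 / sin \<eta> * (1 + s) ^ 0" if "\<bar>t\<bar> = \<eta>" for s t
      using norm_one_minus_ray_ge[OF that, of s] sin_\<eta>_pos by (simp add: norm_divide frac_le)
  qed
  ultimately have "vint (\<lambda>\<tau>. scalar_integrand (\<lambda>v. slit_exp \<gamma> v * (1 / (1 - v))) \<tau> *\<^sub>C y) = (F 1 - F 0) *\<^sub>C y"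
    by (intro vint_fundamental_theorem)
  also have "F 1 - F 0 = e1 * ((L 1 - L 0) - (L' 1 - L' 0))" by (simp add: F_def H algebra_simps)
  also have "\<dots> = residue_const" unfolding L(2) L'(2) sgn by (simp add: residue_const_def e1_def)
  finally show ?thesis .
qed

end

section \<open>Vector-valued contour integrals\<close>

lemma continuous_on_scaleC:
  assumes "continuous_on S f" "continuous_on S g"
  shows "continuous_on S (\<lambda>x. f x *\<^sub>C (g x :: 'a::complex_sclcs))"
  using assms by (simp add: continuous_on_def tendsto_scaleC)

context wedge
begin

definition wedge_integrand :: "(complex \<Rightarrow> 'a::complex_sclcs) \<Rightarrow> real \<Rightarrow> 'a" where
  "wedge_integrand \<Phi> \<tau> = (if \<tau> < 1 then
     (of_real (1 / (1 - \<tau>)\<^sup>2) * (cis \<eta> * slit_exp \<gamma> (ray \<eta> (ray_param \<tau>)))) *\<^sub>C \<Phi> (ray \<eta> (ray_param \<tau>)) -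
     (of_real (1 / (1 - \<tau>)\<^sup>2) * (cis (- \<eta>) * slit_exp \<gamma> (ray (- \<eta>) (ray_param \<tau>)))) *\<^sub>C \<Phi> (ray (- \<eta>) (ray_param \<tau>))
     else 0)"

text \<open>Growth of polynomial order is harmless because of the decay of the weight.\<close>

definition admissible :: "(complex \<Rightarrow> 'a::complex_sclcs) \<Rightarrow> bool" where
  "admissible \<Phi> \<longleftrightarrow> (\<forall>t. \<bar>t\<bar> = \<eta> \<longrightarrow> continuous_on {0..} (\<lambda>s. \<Phi> (ray t s))) \<and>
     (\<forall>p. continuous_seminorm p \<longrightarrow> (\<exists>B N. \<forall>s\<ge>0. \<forall>t. \<bar>t\<bar> = \<eta> \<longrightarrow> p (\<Phi> (ray t s)) \<le> B * (1 + s) ^ N))"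

lemma seminorm_wedge_integrand_le:
  assumes p: "continuous_seminorm p" and \<tau>: "0 \<le> \<tau>" "\<tau> < 1"
    and b: "\<And>t. \<bar>t\<bar> = \<eta> \<Longrightarrow>
      1 / (1 - \<tau>)\<^sup>2 * cmod (slit_exp \<gamma> (ray t (ray_param \<tau>))) * p (\<Phi> (ray t (ray_param \<tau>))) \<le> B"
  shows "p (wedge_integrand \<Phi> \<tau>) \<le> 2 * B"
proof -
  have part: "p ((of_real (1 / (1 - \<tau>)\<^sup>2) * (cis t * slit_exp \<gamma> (ray t (ray_param \<tau>)))) *\<^sub>C \<Phi> (ray t (ray_param \<tau>))) \<le> B"
    if "\<bar>t\<bar> = \<eta>" for t
  proof -
    have "cmod (of_real (1 / (1 - \<tau>)\<^sup>2) * (cis t * slit_exp \<gamma> (ray t (ray_param \<tau>))))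
        = 1 / (1 - \<tau>)\<^sup>2 * cmod (slit_exp \<gamma> (ray t (ray_param \<tau>)))"
      by (simp only: norm_mult norm_of_real norm_cis) simp
    then show ?thesis using b[OF that] by (simp only: seminorm_scaleC[OF p])
  qed
  have "p (wedge_integrand \<Phi> \<tau>) \<le> B + B"
    unfolding wedge_integrand_def if_P[OF \<tau>(2)]
    by (rule order_trans[OF seminorm_diff_le[OF p] add_mono[OF part part]]) (use \<eta> in auto)
  then show ?thesis by simp
qed

lemma continuous_on_wedge_integrand:
  fixes \<Phi> :: "complex \<Rightarrow> 'a::complex_sclcs"
  assumes ad: "admissible \<Phi>"
  shows "continuous_on {0..1} (wedge_integrand \<Phi>)"
proof -
  let ?G = "wedge_integrand \<Phi>"
  have g: "continuous_on {0..} (\<lambda>s. \<Phi> (ray \<eta> s))" "continuous_on {0..} (\<lambda>s. \<Phi> (ray (- \<eta>) s))"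
    using ad \<eta> by (auto simp: admissible_def)
  have c: "continuous_on {0..<1} ?G"
  proof (rule continuous_on_eq)
    show "continuous_on {0..<1} (\<lambda>\<tau>.
     (of_real (1 / (1 - \<tau>)\<^sup>2) * (cis \<eta> * slit_exp \<gamma> (ray \<eta> (ray_param \<tau>)))) *\<^sub>C \<Phi> (ray \<eta> (ray_param \<tau>)) -
     (of_real (1 / (1 - \<tau>)\<^sup>2) * (cis (- \<eta>) * slit_exp \<gamma> (ray (- \<eta>) (ray_param \<tau>)))) *\<^sub>C \<Phi> (ray (- \<eta>) (ray_param \<tau>)))"
      using \<eta>
      by (intro continuous_on_diff continuous_on_scaleC continuous_on_ray_param[OF g(1)] continuous_on_ray_param[OF g(2)]
          continuous_intros continuous_on_ray_param[OF continuous_on_slit_exp_ray]) auto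
  qed (simp add: wedge_integrand_def)
  have bd: "\<exists>B. \<forall>\<tau>. 0 \<le> \<tau> \<and> \<tau> \<le> 1 \<longrightarrow> p (?G \<tau>) \<le> B * (1 - \<tau>)" if p: "continuous_seminorm p" for p
  proof -
    obtain B N where B: "\<And>s t. s \<ge> 0 \<Longrightarrow> \<bar>t\<bar> = \<eta> \<Longrightarrow> p (\<Phi> (ray t s)) \<le> B * (1 + s) ^ N"
      using ad p unfolding admissible_def by blast
    have B0: "B \<ge> 0" using order_trans[OF seminorm_nonneg[OF p] B[of 0 \<eta>]] \<eta> by simp
    obtain K where K: "K > 0" "\<And>\<tau> t. 0 \<le> \<tau> \<Longrightarrow> \<tau> < 1 \<Longrightarrow> \<bar>t\<bar> \<le> \<eta> \<Longrightarrow>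
       1 / (1 - \<tau>)\<^sup>2 * cmod (slit_exp \<gamma> (ray t (ray_param \<tau>))) * (1 + ray_param \<tau>) ^ N \<le> K * (1 - \<tau>)"
      using weight_bound[of N] by blast
    have "p (?G \<tau>) \<le> 2 * (B * K) * (1 - \<tau>)" if \<tau>: "0 \<le> \<tau>" "\<tau> \<le> 1" for \<tau>
    proof (cases "\<tau> < 1")
      case True
      have "p (?G \<tau>) \<le> 2 * (B * (K * (1 - \<tau>)))"
      proof (rule seminorm_wedge_integrand_le[OF p \<tau>(1) True])
        fix t assume t: "\<bar>t\<bar> = \<eta>"
        let ?s = "ray_param \<tau>"
        have "1 / (1 - \<tau>)\<^sup>2 * cmod (slit_exp \<gamma> (ray t ?s)) * p (\<Phi> (ray t ?s)) \<le>
            1 / (1 - \<tau>)\<^sup>2 * cmod (slit_exp \<gamma> (ray t ?s)) * (B * (1 + ?s) ^ N)"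
          using B[OF ray_param_nonneg[OF \<tau>(1) True] t] by (intro mult_left_mono) auto
        also have "\<dots> = B * (1 / (1 - \<tau>)\<^sup>2 * cmod (slit_exp \<gamma> (ray t ?s)) * (1 + ?s) ^ N)" by simp
        also have "\<dots> \<le> B * (K * (1 - \<tau>))" using t \<tau> True B0 by (intro mult_left_mono K(2)) auto
        finally show "1 / (1 - \<tau>)\<^sup>2 * cmod (slit_exp \<gamma> (ray t ?s)) * p (\<Phi> (ray t ?s)) \<le> B * (K * (1 - \<tau>))" .
      qed
      then show ?thesis by (simp add: mult_ac)
    next
      case False then show ?thesis using \<tau> by (simp add: wedge_integrand_def seminorm_0[OF p])
    qed
    then show ?thesis by blast
  qed
  have "((\<lambda>x. p (?G x - 0)) \<longlongrightarrow> 0) (at 1 within {0..1})" if p: "continuous_seminorm p" for p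
  proof -
    obtain B where B: "\<And>x. 0 \<le> x \<Longrightarrow> x \<le> 1 \<Longrightarrow> p (?G x) \<le> B * (1 - x)" using bd[OF p] by blast
    show ?thesis
      by (rule Lim_null_comparison[OF _ tendsto_one_minus_mult[of B]])
        (use B in \<open>auto simp: eventually_at_filter seminorm_nonneg[OF p]\<close>)
  qed
  then have "(?G \<longlongrightarrow> 0) (at 1 within {0..1})" unfolding tendsto_seminorm by blast
  then show ?thesis
    by (intro continuous_on_closed_unit_interval[OF c]) (simp add: wedge_integrand_def)
qed

definition wedge_integral :: "(complex \<Rightarrow> 'a::complex_sclcs) \<Rightarrow> 'a" where
  "wedge_integral \<Phi> = vint (wedge_integrand \<Phi>)"

lemma wedge_integral_cong:
  assumes "\<And>s t. s \<ge> 0 \<Longrightarrow> \<bar>t\<bar> = \<eta> \<Longrightarrow> \<Phi> (ray t s) = \<Psi> (ray t s)"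
  shows "wedge_integral \<Phi> = wedge_integral \<Psi>"
  unfolding wedge_integral_def
proof (rule vint_cong)
  fix \<tau> :: real assume \<tau>: "\<tau> \<in> {0..1}"
  show "wedge_integrand \<Phi> \<tau> = wedge_integrand \<Psi> \<tau>"
  proof (cases "\<tau> < 1")
    case True
    then have "ray_param \<tau> \<ge> 0" using \<tau> by (intro ray_param_nonneg) auto
    then show ?thesis using assms \<eta> by (simp add: wedge_integrand_def)
  qed (simp add: wedge_integrand_def)
qed

lemma seminorm_wedge_integral_le:
  assumes p: "continuous_seminorm p" and ad: "admissible \<Phi>"
    and b: "\<And>s t. s \<ge> 0 \<Longrightarrow> \<bar>t\<bar> = \<eta> \<Longrightarrow> (1 + s)\<^sup>2 * exp (- decay * s powr \<gamma>) * p (\<Phi> (ray t s)) \<le> B"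
  shows "p (wedge_integral \<Phi>) \<le> 2 * B"
  unfolding wedge_integral_def
proof (rule seminorm_vint_le[OF p continuous_on_wedge_integrand[OF ad]])
  fix \<tau> :: real assume \<tau>: "\<tau> \<in> {0..1}"
  show "p (wedge_integrand \<Phi> \<tau>) \<le> 2 * B"
  proof (cases "\<tau> < 1")
    case True
    show ?thesis
    proof (rule seminorm_wedge_integrand_le[OF p _ True])
      fix t assume t: "\<bar>t\<bar> = \<eta>"
      let ?s = "ray_param \<tau>"
      have s: "?s \<ge> 0" using \<tau> True by (intro ray_param_nonneg) auto
      have "1 / (1 - \<tau>)\<^sup>2 = (1 + ?s)\<^sup>2" using ray_param_eq[OF True] by (simp add: power_divide)
      then have "1 / (1 - \<tau>)\<^sup>2 * cmod (slit_exp \<gamma> (ray t ?s)) * p (\<Phi> (ray t ?s)) \<le>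
          (1 + ?s)\<^sup>2 * exp (- decay * ?s powr \<gamma>) * p (\<Phi> (ray t ?s))"
        using norm_slit_exp_le[OF s, of t] t seminorm_nonneg[OF p]
        by (simp only:) (intro mult_right_mono mult_left_mono, auto)
      also have "\<dots> \<le> B" by (rule b[OF s t])
      finally show "1 / (1 - \<tau>)\<^sup>2 * cmod (slit_exp \<gamma> (ray t ?s)) * p (\<Phi> (ray t ?s)) \<le> B" .
    qed (use \<tau> in auto)
  next
    case False
    have "B \<ge> 0"
      using order_trans[OF mult_nonneg_nonneg b[of 0 \<eta>]] seminorm_nonneg[OF p] \<eta> by simp
    then show ?thesis using False by (simp add: wedge_integrand_def seminorm_0[OF p])
  qed
qed

lemma wedge_integral_sum:
  assumes "finite I" "\<And>i. i \<in> I \<Longrightarrow> admissible (\<Phi> i)"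
  shows "wedge_integral (\<lambda>v. \<Sum>i\<in>I. \<Phi> i v) = (\<Sum>i\<in>I. wedge_integral (\<Phi> i))"
proof -
  have "wedge_integrand (\<lambda>v. \<Sum>i\<in>I. \<Phi> i v) = (\<lambda>\<tau>. \<Sum>i\<in>I. wedge_integrand (\<Phi> i) \<tau>)"
  proof
    fix \<tau> show "wedge_integrand (\<lambda>v. \<Sum>i\<in>I. \<Phi> i v) \<tau> = (\<Sum>i\<in>I. wedge_integrand (\<Phi> i) \<tau>)"
      unfolding wedge_integrand_def by (cases "\<tau> < 1") (simp_all only: if_True if_False cvs.scale_sum_right sum_subtractf sum.neutral_const)
  qed
  then show ?thesis
    unfolding wedge_integral_def using assms by (simp add: vint_sum continuous_on_wedge_integrand)
qed

lemma wedge_integral_closed_operator: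
  assumes A: "closed_linear_operator D A" and ad: "admissible \<Phi>" "admissible (\<lambda>v. A (\<Phi> v))"
    and D: "\<And>s t. s \<ge> 0 \<Longrightarrow> \<bar>t\<bar> = \<eta> \<Longrightarrow> \<Phi> (ray t s) \<in> D"
  shows "wedge_integral \<Phi> \<in> D \<and> A (wedge_integral \<Phi>) = wedge_integral (\<lambda>v. A (\<Phi> v))"
proof -
  have *: "wedge_integrand \<Phi> \<tau> \<in> D \<and> A (wedge_integrand \<Phi> \<tau>) = wedge_integrand (\<lambda>v. A (\<Phi> v)) \<tau>"
    if \<tau>: "\<tau> \<in> {0..1}" for \<tau>
  proof (cases "\<tau> < 1")
    case True
    then have s: "ray_param \<tau> \<ge> 0" using \<tau> by (intro ray_param_nonneg) auto
    define f where "f b = \<Phi> (ray (if b then \<eta> else - \<eta>) (ray_param \<tau>))" for b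
    define c where "c b = (if b then of_real (1 / (1 - \<tau>)\<^sup>2) * (cis \<eta> * slit_exp \<gamma> (ray \<eta> (ray_param \<tau>)))
      else - (of_real (1 / (1 - \<tau>)\<^sup>2) * (cis (- \<eta>) * slit_exp \<gamma> (ray (- \<eta>) (ray_param \<tau>)))))" for b
    have "f b \<in> D" for b using D[OF s] \<eta> by (auto simp: f_def)
    then have "(\<Sum>b\<in>UNIV. c b *\<^sub>C f b) \<in> D \<and> A (\<Sum>b\<in>UNIV. c b *\<^sub>C f b) = (\<Sum>b\<in>UNIV. c b *\<^sub>C A (f b))"
      by (intro closed_linear_operator_sum[OF A])
    then show ?thesis using True by (simp add: UNIV_bool f_def c_def wedge_integrand_def)
  next
    case False
    then show ?thesis using closed_linear_operator_sum[OF A, of "{}"] by (simp add: wedge_integrand_def)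
  qed
  have "continuous_on {0..1} (\<lambda>t. A (wedge_integrand \<Phi> t))"
    by (rule continuous_on_eq[OF continuous_on_wedge_integrand[OF ad(2)]]) (use * in auto)
  from vint_closed_operator[OF A _ continuous_on_wedge_integrand[OF ad(1)] this]
  have "vint (wedge_integrand \<Phi>) \<in> D \<and> A (vint (wedge_integrand \<Phi>)) = vint (\<lambda>t. A (wedge_integrand \<Phi> t))"
    using * by blast
  then show ?thesis
    unfolding wedge_integral_def using vint_cong[of "\<lambda>t. A (wedge_integrand \<Phi> t)" "wedge_integrand (\<lambda>v. A (\<Phi> v))"] * by simp
qed

lemma wedge_integrand_scalar:
  "wedge_integrand (\<lambda>v. g v *\<^sub>C y) = (\<lambda>\<tau>. scalar_integrand (\<lambda>v. slit_exp \<gamma> v * g v) \<tau> *\<^sub>C y)"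
  by (simp add: fun_eq_iff wedge_integrand_def scalar_integrand_def scaleC_scaleC right_diff_distrib
      cvs.scale_left_diff_distrib mult.assoc)

lemma wedge_integral_power: "wedge_integral (\<lambda>v. (1 - v) ^ m *\<^sub>C y) = 0"
  unfolding wedge_integral_def wedge_integrand_scalar by (rule vanishing_moment)

lemma wedge_integral_inverse: "wedge_integral (\<lambda>v. (1 / (1 - v)) *\<^sub>C y) = residue_const *\<^sub>C y"
  unfolding wedge_integral_def wedge_integrand_scalar by (rule residue_moment)

text \<open>After multiplication by $\rho^k$ the integrand of the $k$-th term grows like $(m(1+s))^k$. With $T = (m(1+s))^{1/\zeta}$ this is
  $T^{\zeta k} \le e^T\,\Gamma(\zeta k+b)$, by \<open>Gamma_ge_powr_exp\<close>. The factor $e^T$ does not depend on $k$ and is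
  absorbed by the weight, since $1/\zeta < \gamma$.\<close>

lemma fast_decay_wedge_integral:
  fixes \<Phi> :: "nat \<Rightarrow> complex \<Rightarrow> 'a::complex_sclcs"
  assumes \<zeta>: "\<zeta> > 0" "1 / \<zeta> < \<gamma>" and ad: "\<And>k. admissible (\<Phi> k)"
    and b: "\<And>p. continuous_seminorm p \<Longrightarrow> \<exists>B M N. B \<ge> 0 \<and> M \<ge> 0 \<and>
      (\<forall>k s t. s \<ge> 0 \<longrightarrow> \<bar>t\<bar> = \<eta> \<longrightarrow> p (\<Phi> k (ray t s)) \<le> B * (M * (1 + s)) ^ k * (1 + s) ^ N)"
  shows "fast_decay \<zeta> (\<lambda>k. wedge_integral (\<Phi> k))"
  unfolding fast_decay_def
proof (intro allI impI)
  fix p :: "'a \<Rightarrow> real" and \<rho> b' :: real and l :: nat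
  assume p: "continuous_seminorm p" and \<rho>: "\<rho> > 0" and b': "b' \<ge> 1"
  obtain B M N where B: "B \<ge> 0" and M: "M \<ge> 0" and
    bd: "\<And>k s t. s \<ge> 0 \<Longrightarrow> \<bar>t\<bar> = \<eta> \<Longrightarrow> p (\<Phi> k (ray t s)) \<le> B * (M * (1 + s)) ^ k * (1 + s) ^ N"
    using b[OF p] by blast
  \<comment> \<open>The maximum ensures \<open>T \<ge> 1\<close> below, so that the power of \<open>T\<close> may be raised.\<close>
  define m where "m = max 1 (\<rho> * M)"
  have m: "m \<ge> 1" "\<rho> * M \<le> m" by (auto simp: m_def)
  obtain K where K: "K > 0" "\<And>s. s \<ge> 0 \<Longrightarrow>
      exp (m powr (1 / \<zeta>) * (1 + s) powr (1 / \<zeta>)) * (1 + s) ^ (2 + N + l) * exp (- decay * s powr \<gamma>) \<le> K"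
    using decay_bounded[of "m powr (1 / \<zeta>)" "1 / \<zeta>" "2 + N + l"] \<zeta> by auto
  have "\<rho> ^ k * p (wedge_integral (\<Phi> (k + l))) \<le> 2 * (B * M ^ l * K) * Gamma (\<zeta> * real k + b')" for k
  proof -
    let ?G = "Gamma (\<zeta> * real k + b')"
    have G: "?G > 0" using \<zeta> b' by (intro Gamma_real_pos add_nonneg_pos) auto
    have "p (wedge_integral (\<Phi> (k + l))) \<le> 2 * (B * M ^ l * K * ?G / \<rho> ^ k)"
    proof (rule seminorm_wedge_integral_le[OF p ad])
      fix s t :: real assume s: "s \<ge> 0" and t: "\<bar>t\<bar> = \<eta>"
      define T where "T = (m * (1 + s)) powr (1 / \<zeta>)"
      have m1: "m * (1 + s) \<ge> 1" using m s by (metis add_increasing2 mult_mono' mult_1 order_refl zero_le_one)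
      then have T1: "T \<ge> 1" using \<zeta> by (simp add: T_def ge_one_powr_ge_zero)
      have "(\<rho> * (M * (1 + s))) ^ k \<le> (m * (1 + s)) ^ k"
        using m M \<rho> s by (intro power_mono) (auto simp: mult.assoc[symmetric] intro!: mult_right_mono)
      also have "\<dots> = T powr (\<zeta> * real k)"
        using m1 \<zeta> by (simp add: T_def powr_powr powr_realpow)
      also have "\<dots> \<le> T powr (\<zeta> * real k + b' - 1)" using T1 b' by (intro powr_mono) auto
      also have "\<dots> = T powr (\<zeta> * real k + b' - 1) * exp (- T) * exp T" by (simp add: mult.assoc flip: exp_add)
      also have "\<dots> \<le> ?G * exp T"
      proof (intro mult_right_mono Gamma_ge_powr_exp)
        show "1 \<le> \<zeta> * real k + b'" using \<zeta> b' by (simp add: add_increasing)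
      qed (use T1 in auto)
      also have "exp T = exp (m powr (1 / \<zeta>) * (1 + s) powr (1 / \<zeta>))"
        using m s by (simp add: T_def powr_mult)
      finally have key: "(\<rho> * (M * (1 + s))) ^ k \<le> ?G * exp (m powr (1 / \<zeta>) * (1 + s) powr (1 / \<zeta>))" .
      have "\<rho> ^ k * ((1 + s)\<^sup>2 * exp (- decay * s powr \<gamma>) * p (\<Phi> (k + l) (ray t s))) \<le>
         \<rho> ^ k * ((1 + s)\<^sup>2 * exp (- decay * s powr \<gamma>) * (B * (M * (1 + s)) ^ (k + l) * (1 + s) ^ N))"
        using \<rho> s by (intro mult_left_mono bd t) auto
      also have "\<dots> = (\<rho> * (M * (1 + s))) ^ k * ((1 + s) ^ (2 + N + l) * exp (- decay * s powr \<gamma>) * (B * M ^ l))"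
        by (simp add: power_add power_mult_distrib mult_ac power2_eq_square)
      also have "\<dots> \<le> (?G * exp (m powr (1 / \<zeta>) * (1 + s) powr (1 / \<zeta>))) * ((1 + s) ^ (2 + N + l) * exp (- decay * s powr \<gamma>) * (B * M ^ l))"
        using s B M by (intro mult_right_mono key) auto
      also have "\<dots> = (exp (m powr (1 / \<zeta>) * (1 + s) powr (1 / \<zeta>)) * (1 + s) ^ (2 + N + l) * exp (- decay * s powr \<gamma>)) * (?G * (B * M ^ l))"
        by (simp only: mult_ac)
      also have "\<dots> \<le> K * (?G * (B * M ^ l))"
        using G B M s by (intro mult_right_mono K(2)) auto
      finally show "(1 + s)\<^sup>2 * exp (- decay * s powr \<gamma>) * p (\<Phi> (k + l) (ray t s)) \<le> B * M ^ l * K * ?G / \<rho> ^ k"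
        using \<rho> by (simp add: field_simps)
    qed
    then show ?thesis using \<rho> by (simp add: field_simps)
  qed
  then show "\<exists>B. \<forall>k. \<rho> ^ k * p (wedge_integral (\<Phi> (k + l))) \<le> B * Gamma (\<zeta> * real k + b')" by blast
qed

end

section \<open>Solution sequences from the pencil\<close>

lemma fast_decay_lincomb:
  fixes x :: "'i \<Rightarrow> nat \<Rightarrow> 'a::complex_sclcs"
  assumes fin: "finite I" and f: "\<And>i. i \<in> I \<Longrightarrow> fast_decay \<zeta> (x i)"
  shows "fast_decay \<zeta> (\<lambda>k. \<Sum>i\<in>I. c i *\<^sub>C x i k)"
  unfolding fast_decay_def
proof (intro allI impI)
  fix p :: "'a \<Rightarrow> real" and \<rho> b :: real and l :: nat
  assume p: "continuous_seminorm p" and \<rho>: "\<rho> > 0" and b: "b \<ge> 1"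
  have "\<forall>i\<in>I. \<exists>B. \<forall>k. \<rho> ^ k * p (x i (k + l)) \<le> B * Gamma (\<zeta> * real k + b)"
    using f p \<rho> b unfolding fast_decay_def by blast
  then obtain B where B: "\<And>i k. i \<in> I \<Longrightarrow> \<rho> ^ k * p (x i (k + l)) \<le> B i * Gamma (\<zeta> * real k + b)"
    by metis
  have "\<rho> ^ k * p (\<Sum>i\<in>I. c i *\<^sub>C x i (k + l)) \<le> (\<Sum>i\<in>I. cmod (c i) * B i) * Gamma (\<zeta> * real k + b)" for k
  proof -
    have "\<rho> ^ k * p (\<Sum>i\<in>I. c i *\<^sub>C x i (k + l)) \<le> \<rho> ^ k * (\<Sum>i\<in>I. p (c i *\<^sub>C x i (k + l)))"
      using \<rho> by (intro mult_left_mono seminorm_sum[OF p]) auto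
    also have "\<dots> = (\<Sum>i\<in>I. cmod (c i) * (\<rho> ^ k * p (x i (k + l))))"
      by (simp add: seminorm_scaleC[OF p] sum_distrib_left mult_ac)
    also have "\<dots> \<le> (\<Sum>i\<in>I. cmod (c i) * (B i * Gamma (\<zeta> * real k + b)))"
      by (intro sum_mono mult_left_mono B) auto
    finally show ?thesis by (simp add: sum_distrib_right mult.assoc)
  qed
  then show "\<exists>B. \<forall>k. \<rho> ^ k * p (\<Sum>i\<in>I. c i *\<^sub>C x i (k + l)) \<le> B * Gamma (\<zeta> * real k + b)" by blast
qed

lemma solution_seq_lincomb:
  assumes A: "\<And>i. i \<le> n \<Longrightarrow> closed_linear_operator (D i) (A i)" and fin: "finite I"
    and x: "\<And>j. j \<in> I \<Longrightarrow> solution_seq n q D A \<zeta> (x j)"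
  shows "solution_seq n q D A \<zeta> (\<lambda>k. \<Sum>j\<in>I. c j *\<^sub>C x j k)"
proof -
  have *: "(\<Sum>j\<in>I. c j *\<^sub>C x j k) \<in> D i \<and> A i (\<Sum>j\<in>I. c j *\<^sub>C x j k) = (\<Sum>j\<in>I. c j *\<^sub>C A i (x j k))"
    if "i \<le> n" for i k
    using x that by (intro closed_linear_operator_sum[OF A[OF that]]) (auto simp: solution_seq_def)
  have "fast_decay \<zeta> (\<lambda>k. \<Sum>j\<in>I. c j *\<^sub>C x j k)"
    using x by (intro fast_decay_lincomb[OF fin]) (auto simp: solution_seq_def)
  moreover have "fast_decay \<zeta> (\<lambda>k. A i (\<Sum>j\<in>I. c j *\<^sub>C x j k))" if "i \<le> n" for i
  proof -
    have "fast_decay \<zeta> (\<lambda>k. \<Sum>j\<in>I. c j *\<^sub>C A i (x j k))"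
      using x that by (intro fast_decay_lincomb[OF fin]) (auto simp: solution_seq_def)
    then show ?thesis using *[OF that] by simp
  qed
  moreover have "(\<Sum>i\<le>n. A i (\<Sum>j\<in>I. c j *\<^sub>C x j (k + q i))) = 0" for k
  proof -
    have "(\<Sum>i\<le>n. A i (\<Sum>j\<in>I. c j *\<^sub>C x j (k + q i))) = (\<Sum>i\<le>n. \<Sum>j\<in>I. c j *\<^sub>C A i (x j (k + q i)))"
      by (rule sum.cong) (use * in auto)
    also have "\<dots> = (\<Sum>j\<in>I. c j *\<^sub>C (\<Sum>i\<le>n. A i (x j (k + q i))))"
      by (subst sum.swap) (simp only: cvs.scale_sum_right)
    also have "\<dots> = 0"
      using x by (intro sum.neutral) (simp add: solution_seq_def)
    finally show ?thesis .
  qed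
  ultimately show ?thesis using * unfolding solution_seq_def by blast
qed

text \<open>The properties of $Q(z) = P^{-1}C$ on a set \<open>Z\<close> from which solution sequences are built.\<close>

locale wedge_resolvent = wedge \<eta> \<gamma> for \<eta> \<gamma> :: real +
  fixes \<zeta> :: real and n :: nat and q :: "nat \<Rightarrow> nat" and D :: "nat \<Rightarrow> 'a::complex_sclcs set"
    and A :: "nat \<Rightarrow> 'a \<Rightarrow> 'a" and C :: "'a \<Rightarrow> 'a" and Z :: "complex set"
    and Q :: "complex \<Rightarrow> 'a \<Rightarrow> 'a"
  assumes \<zeta>: "\<zeta> > 0" "1 / \<zeta> < \<gamma>"
    and closed_A: "\<And>i. i \<le> n \<Longrightarrow> closed_linear_operator (D i) (A i)"
    and Q_dom: "\<And>z i x. z \<in> Z \<Longrightarrow> i \<le> n \<Longrightarrow> Q z x \<in> D i"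
    and Q_eq: "\<And>z x. z \<in> Z \<Longrightarrow> (\<Sum>i\<le>n. z ^ q i *\<^sub>C A i (Q z x)) = C x"
    and Q_cont: "\<And>x. continuous_on Z (\<lambda>z. Q z x)"
    and AQ_cont: "\<And>i x. i \<le> n \<Longrightarrow> continuous_on Z (\<lambda>z. A i (Q z x))"
    and Q_bound: "\<And>p x. continuous_seminorm p \<Longrightarrow> \<exists>B N. \<forall>z\<in>Z. p (Q z x) \<le> B * (1 + cmod z) ^ N"
    and AQ_bound: "\<And>p i x. continuous_seminorm p \<Longrightarrow> i \<le> n \<Longrightarrow>
      \<exists>B N. \<forall>z\<in>Z. p (A i (Q z x)) \<le> B * (1 + cmod z) ^ N"
begin

text \<open>The rays are mapped into \<open>Z\<close> by $v \mapsto \omega(1-v)$. This turns the wedge around and dilates it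
  by $|\omega|$; the point $v = 1$ goes to the origin of the $\lambda$-plane.\<close>

definition on_contour :: "complex \<Rightarrow> bool" where
  "on_contour \<omega> \<longleftrightarrow> \<omega> \<noteq> 0 \<and> (\<forall>s\<ge>0. \<forall>t. \<bar>t\<bar> = \<eta> \<longrightarrow> \<omega> * (1 - ray t s) \<in> Z)"

text \<open>The function $\lambda^{k-b}\,\Psi(\lambda)$ at $\lambda = \omega(1-v)$, with a possibly negative exponent.\<close>

definition power_family :: "complex \<Rightarrow> (complex \<Rightarrow> 'a) \<Rightarrow> nat \<Rightarrow> nat \<Rightarrow> complex \<Rightarrow> 'a" where
  "power_family \<omega> \<Psi> b k v = ((\<omega> * (1 - v)) ^ k / (\<omega> * (1 - v)) ^ b) *\<^sub>C \<Psi> (\<omega> * (1 - v))"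

lemma power_family_bound:
  assumes \<omega>: "on_contour \<omega>" and p: "continuous_seminorm p"
    and bd: "\<exists>B N. \<forall>z\<in>Z. p (\<Psi> z) \<le> B * (1 + cmod z) ^ N"
  shows "\<exists>B M N. B \<ge> 0 \<and> M \<ge> 0 \<and> (\<forall>k s t. s \<ge> 0 \<longrightarrow> \<bar>t\<bar> = \<eta> \<longrightarrow>
    p (power_family \<omega> \<Psi> b k (ray t s)) \<le> B * (M * (1 + s)) ^ k * (1 + s) ^ N)"
proof -
  obtain B N where B: "\<And>z. z \<in> Z \<Longrightarrow> p (\<Psi> z) \<le> B * (1 + cmod z) ^ N" using bd by blast
  have \<omega>0: "\<omega> \<noteq> 0" using \<omega> by (simp add: on_contour_def)
  let ?d = "cmod \<omega> * sin \<eta>"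
  have d: "?d > 0" using \<omega>0 sin_\<eta>_pos by simp
  show ?thesis
  proof (intro exI conjI allI impI)
    show "0 \<le> \<bar>B\<bar> * (1 + cmod \<omega>) ^ N / ?d ^ b" using d by (intro divide_nonneg_nonneg) auto
    show "0 \<le> cmod \<omega>" by simp
    fix k s t assume s: "(s::real) \<ge> 0" and t: "\<bar>t\<bar> = \<eta>"
    let ?l = "\<omega> * (1 - ray t s)"
    have l: "?l \<in> Z" using \<omega> s t by (simp add: on_contour_def)
    have up: "cmod ?l \<le> cmod \<omega> * (1 + s)"
      using norm_one_minus_ray_le[OF s] by (simp add: norm_mult mult_left_mono)
    have low: "?d \<le> cmod ?l" using norm_one_minus_ray_ge[OF t] by (simp add: norm_mult mult_left_mono)
    have "1 + cmod ?l \<le> (1 + cmod \<omega>) * (1 + s)" using up s by (simp add: algebra_simps)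
    then have "(1 + cmod ?l) ^ N \<le> ((1 + cmod \<omega>) * (1 + s)) ^ N" by (intro power_mono) auto
    then have "\<bar>B\<bar> * (1 + cmod ?l) ^ N \<le> \<bar>B\<bar> * ((1 + cmod \<omega>) * (1 + s)) ^ N" by (intro mult_left_mono) auto
    moreover have "p (\<Psi> ?l) \<le> \<bar>B\<bar> * (1 + cmod ?l) ^ N"
      by (rule order_trans[OF B[OF l]]) (intro mult_right_mono, auto)
    ultimately have P: "p (\<Psi> ?l) \<le> \<bar>B\<bar> * ((1 + cmod \<omega>) * (1 + s)) ^ N" by linarith
    have "cmod ?l ^ k / cmod ?l ^ b \<le> (cmod \<omega> * (1 + s)) ^ k / ?d ^ b"
      using up low d by (intro frac_le power_mono) auto
    then have "(cmod ?l ^ k / cmod ?l ^ b) * p (\<Psi> ?l) \<le>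
        ((cmod \<omega> * (1 + s)) ^ k / ?d ^ b) * (\<bar>B\<bar> * ((1 + cmod \<omega>) * (1 + s)) ^ N)"
      using P seminorm_nonneg[OF p] d s by (intro mult_mono) auto
    also have "\<dots> = (\<bar>B\<bar> * (1 + cmod \<omega>) ^ N / ?d ^ b) * (cmod \<omega> * (1 + s)) ^ k * (1 + s) ^ N"
      by (simp only: power_mult_distrib times_divide_eq_left times_divide_eq_right mult_ac)
    finally show "p (power_family \<omega> \<Psi> b k (ray t s)) \<le>
        (\<bar>B\<bar> * (1 + cmod \<omega>) ^ N / ?d ^ b) * (cmod \<omega> * (1 + s)) ^ k * (1 + s) ^ N"
      unfolding power_family_def by (simp only: seminorm_scaleC[OF p] norm_divide norm_power)
  qed
qed

lemma admissible_power_family: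
  assumes \<omega>: "on_contour \<omega>" and cont: "continuous_on Z \<Psi>"
    and bd: "\<And>p. continuous_seminorm p \<Longrightarrow> \<exists>B N. \<forall>z\<in>Z. p (\<Psi> z) \<le> B * (1 + cmod z) ^ N"
  shows "admissible (power_family \<omega> \<Psi> b k)"
  unfolding admissible_def
proof (intro conjI allI impI)
  fix t assume t: "\<bar>t\<bar> = \<eta>"
  have \<omega>0: "\<omega> \<noteq> 0" using \<omega> by (simp add: on_contour_def)
  have ne: "1 - ray t s \<noteq> 0" for s using ray_ne_1[OF t] by auto
  have c: "continuous_on {0..} (\<lambda>s. \<omega> * (1 - ray t s))"
    unfolding ray_def by (intro continuous_intros)
  have "continuous_on {0..} (\<lambda>s. \<Psi> (\<omega> * (1 - ray t s)))"
    by (rule continuous_on_compose2[OF cont c]) (use \<omega> t in \<open>auto simp: on_contour_def\<close>)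
  then show "continuous_on {0..} (\<lambda>s. power_family \<omega> \<Psi> b k (ray t s))"
    unfolding power_family_def
    using \<omega>0 ne by (intro continuous_on_scaleC continuous_intros c) auto
next
  fix p :: "'a \<Rightarrow> real" assume p: "continuous_seminorm p"
  obtain B M N where "B \<ge> 0" "M \<ge> 0" and b: "\<And>k s t. s \<ge> 0 \<Longrightarrow> \<bar>t\<bar> = \<eta> \<Longrightarrow>
    p (power_family \<omega> \<Psi> b k (ray t s)) \<le> B * (M * (1 + s)) ^ k * (1 + s) ^ N"
    using power_family_bound[OF \<omega> p bd[OF p], of b] by blast
  show "\<exists>B N. \<forall>s\<ge>0. \<forall>t. \<bar>t\<bar> = \<eta> \<longrightarrow> p (power_family \<omega> \<Psi> b k (ray t s)) \<le> B * (1 + s) ^ N"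
  proof (intro exI allI impI)
    fix s t :: real assume "s \<ge> 0" "\<bar>t\<bar> = \<eta>"
    from b[OF this, of k] show "p (power_family \<omega> \<Psi> b k (ray t s)) \<le> (B * M ^ k) * (1 + s) ^ (k + N)"
      by (simp add: power_mult_distrib power_add mult_ac)
  qed
qed

lemma fast_decay_power_family:
  assumes \<omega>: "on_contour \<omega>" and cont: "continuous_on Z \<Psi>"
    and bd: "\<And>p. continuous_seminorm p \<Longrightarrow> \<exists>B N. \<forall>z\<in>Z. p (\<Psi> z) \<le> B * (1 + cmod z) ^ N"
  shows "fast_decay \<zeta> (\<lambda>k. wedge_integral (power_family \<omega> \<Psi> b k))"
  by (rule fast_decay_wedge_integral[OF \<zeta> admissible_power_family[OF assms] power_family_bound[OF \<omega> _ bd]])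

definition moment :: "complex \<Rightarrow> nat \<Rightarrow> 'a \<Rightarrow> nat \<Rightarrow> 'a" where
  "moment \<omega> b y k = wedge_integral (power_family \<omega> (\<lambda>z. Q z y) b k)"

lemma const_bound: "continuous_seminorm p \<Longrightarrow> \<exists>B N. \<forall>z\<in>Z. p y \<le> B * (1 + cmod z) ^ N"
  by (rule exI[of _ "p y"], rule exI[of _ 0]) simp

lemma moment_closed:
  assumes \<omega>: "on_contour \<omega>" and i: "i \<le> n"
  shows "moment \<omega> b y k \<in> D i \<and> A i (moment \<omega> b y k) = wedge_integral (power_family \<omega> (\<lambda>z. A i (Q z y)) b k)"
proof -
  have sc: "A i (c *\<^sub>C x) = c *\<^sub>C A i x" "c *\<^sub>C x \<in> D i" if "x \<in> D i" for c x
    using closed_A[OF i] that cvs.subspace_scale unfolding closed_linear_operator_def by auto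
  have Z: "\<omega> * (1 - ray t s) \<in> Z" if "s \<ge> 0" "\<bar>t\<bar> = \<eta>" for s t
    using \<omega> that by (simp add: on_contour_def)
  have AQ: "A i (power_family \<omega> (\<lambda>z. Q z y) b k (ray t s)) = power_family \<omega> (\<lambda>z. A i (Q z y)) b k (ray t s)"
    if "s \<ge> 0" "\<bar>t\<bar> = \<eta>" for s t
    using sc(1)[OF Q_dom[OF Z[OF that] i]] by (simp add: power_family_def)
  have ad: "admissible (power_family \<omega> (\<lambda>z. Q z y) b k)"
    "admissible (power_family \<omega> (\<lambda>z. A i (Q z y)) b k)"
    by (intro admissible_power_family \<omega> Q_cont Q_bound AQ_cont AQ_bound i; assumption)+
  have ad': "admissible (\<lambda>v. A i (power_family \<omega> (\<lambda>z. Q z y) b k v))"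
    unfolding admissible_def
  proof (intro conjI allI impI)
    show "continuous_on {0..} (\<lambda>s. A i (power_family \<omega> (\<lambda>z. Q z y) b k (ray t s)))" if t: "\<bar>t\<bar> = \<eta>" for t
      by (rule continuous_on_eq[where f="\<lambda>s. power_family \<omega> (\<lambda>z. A i (Q z y)) b k (ray t s)"])
        (use ad(2) t AQ in \<open>auto simp: admissible_def\<close>)
    show "\<exists>B N. \<forall>s\<ge>0. \<forall>t. \<bar>t\<bar> = \<eta> \<longrightarrow> p (A i (power_family \<omega> (\<lambda>z. Q z y) b k (ray t s))) \<le> B * (1 + s) ^ N"
      if p: "continuous_seminorm p" for p
    proof -
      obtain B N where "\<forall>s\<ge>0. \<forall>t. \<bar>t\<bar> = \<eta> \<longrightarrow> p (power_family \<omega> (\<lambda>z. A i (Q z y)) b k (ray t s)) \<le> B * (1 + s) ^ N"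
        using ad(2) p unfolding admissible_def by blast
      then show ?thesis using AQ by (intro exI[of _ B] exI[of _ N]) auto
    qed
  qed
  have "power_family \<omega> (\<lambda>z. Q z y) b k (ray t s) \<in> D i" if "s \<ge> 0" "\<bar>t\<bar> = \<eta>" for s t
    unfolding power_family_def by (rule sc(2)[OF Q_dom[OF Z[OF that] i]])
  from wedge_integral_closed_operator[OF closed_A[OF i] ad(1) ad' this]
  show ?thesis
    unfolding moment_def 
    using wedge_integral_cong[where \<Phi>="\<lambda>v. A i (power_family \<omega> (\<lambda>z. Q z y) b k v)"
        and \<Psi>="power_family \<omega> (\<lambda>z. A i (Q z y)) b k", OF AQ] by simp
qed

text \<open>For \<open>k \<ge> b\<close> the integrand is a polynomial times the weight; for \<open>b = k + 1\<close> it has a simple pole at the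
  origin.\<close>

lemma const_moment:
  assumes \<omega>: "on_contour \<omega>"
  shows "wedge_integral (power_family \<omega> (\<lambda>_. y) b (b + m)) = 0"
    and "wedge_integral (power_family \<omega> (\<lambda>_. y) (Suc k) k) = (residue_const / \<omega>) *\<^sub>C y"
proof -
  have \<omega>0: "\<omega> \<noteq> 0" using \<omega> by (simp add: on_contour_def)
  have ne: "1 - ray t s \<noteq> 0" if "\<bar>t\<bar> = \<eta>" for s t using ray_ne_1[OF that] by auto
  have "wedge_integral (power_family \<omega> (\<lambda>_. y) b (b + m)) = wedge_integral (\<lambda>v. (1 - v) ^ m *\<^sub>C (\<omega> ^ m *\<^sub>C y))"
    by (rule wedge_integral_cong) (use \<omega>0 ne in \<open>simp add: power_family_def power_add power_mult_distrib scaleC_scaleC mult.commute\<close>)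
  then show "wedge_integral (power_family \<omega> (\<lambda>_. y) b (b + m)) = 0" by (simp only: wedge_integral_power)
  have "wedge_integral (power_family \<omega> (\<lambda>_. y) (Suc k) k) = wedge_integral (\<lambda>v. (1 / (1 - v)) *\<^sub>C ((1 / \<omega>) *\<^sub>C y))"
    by (rule wedge_integral_cong) (use \<omega>0 ne in \<open>simp add: power_family_def scaleC_scaleC mult.commute\<close>)
  also have "\<dots> = residue_const *\<^sub>C ((1 / \<omega>) *\<^sub>C y)" by (rule wedge_integral_inverse)
  finally show "wedge_integral (power_family \<omega> (\<lambda>_. y) (Suc k) k) = (residue_const / \<omega>) *\<^sub>C y"
    by (simp add: scaleC_scaleC)
qed

text \<open>Because $\sum_i z^{q_i} A_i Q(z) = C$, the recurrence reduces to the moments of $\lambda^{k+a-b}$, which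
  vanish for $a \ge b$.\<close>

lemma solution_seq_moment:
  assumes \<omega>: "on_contour \<omega>" and ab: "a \<ge> b"
  shows "solution_seq n q D A \<zeta> (\<lambda>k. moment \<omega> b y (k + a))"
proof -
  have Z: "\<omega> * (1 - ray t s) \<in> Z" if "s \<ge> 0" "\<bar>t\<bar> = \<eta>" for s t
    using \<omega> that by (simp add: on_contour_def)
  have ad: "admissible (power_family \<omega> (\<lambda>z. A i (Q z y)) b k)" if "i \<le> n" for i k
    by (intro admissible_power_family \<omega> AQ_cont AQ_bound that; assumption)
  have "fast_decay \<zeta> (\<lambda>k. moment \<omega> b y k)"
    unfolding moment_def by (intro fast_decay_power_family \<omega> Q_cont Q_bound; assumption)
  then have 1: "fast_decay \<zeta> (\<lambda>k. moment \<omega> b y (k + a))" by (rule fast_decay_shift)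
  have 2: "fast_decay \<zeta> (\<lambda>k. A i (moment \<omega> b y (k + a)))" if i: "i \<le> n" for i
  proof -
    have "fast_decay \<zeta> (\<lambda>k. wedge_integral (power_family \<omega> (\<lambda>z. A i (Q z y)) b k))"
      by (intro fast_decay_power_family \<omega> AQ_cont AQ_bound i; assumption)
    from fast_decay_shift[OF this, of a] show ?thesis using moment_closed[OF \<omega> i] by simp
  qed
  have 3: "(\<Sum>i\<le>n. A i (moment \<omega> b y (k + q i + a))) = 0" for k
  proof -
    have "(\<Sum>i\<le>n. A i (moment \<omega> b y (k + q i + a))) =
        (\<Sum>i\<le>n. wedge_integral (power_family \<omega> (\<lambda>z. A i (Q z y)) b (k + q i + a)))"
      by (rule sum.cong) (use moment_closed[OF \<omega>] in auto)
    also have "\<dots> = wedge_integral (\<lambda>v. \<Sum>i\<le>n. power_family \<omega> (\<lambda>z. A i (Q z y)) b (k + q i + a) v)"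
      by (rule wedge_integral_sum[symmetric]) (use ad in auto)
    also have "\<dots> = wedge_integral (power_family \<omega> (\<lambda>_. C y) b (b + (k + a - b)))"
    proof (rule wedge_integral_cong)
      fix s t :: real assume st: "s \<ge> 0" "\<bar>t\<bar> = \<eta>"
      let ?z = "\<omega> * (1 - ray t s)"
      have "(\<Sum>i\<le>n. power_family \<omega> (\<lambda>z. A i (Q z y)) b (k + q i + a) (ray t s)) =
          (\<Sum>i\<le>n. (?z ^ (k + a) / ?z ^ b) *\<^sub>C (?z ^ q i *\<^sub>C A i (Q ?z y)))"
        unfolding power_family_def scaleC_scaleC
        by (intro sum.cong refl arg_cong2[where f="(*\<^sub>C)"]) (simp add: power_add mult_ac)
      also have "\<dots> = (?z ^ (k + a) / ?z ^ b) *\<^sub>C C y"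
        by (simp only: Q_eq[OF Z[OF st]] flip: cvs.scale_sum_right)
      finally show "(\<Sum>i\<le>n. power_family \<omega> (\<lambda>z. A i (Q z y)) b (k + q i + a) (ray t s)) =
          power_family \<omega> (\<lambda>_. C y) b (b + (k + a - b)) (ray t s)"
        using ab by (simp add: power_family_def)
    qed
    also have "\<dots> = 0" by (rule const_moment(1)[OF \<omega>])
    finally show ?thesis .
  qed
  show ?thesis
    unfolding solution_seq_def using 1 2 3 moment_closed[OF \<omega>] by (simp add: add_ac)
qed

lemma moment_sum:
  assumes \<omega>: "on_contour \<omega>" and x: "\<And>z. z \<in> Z \<Longrightarrow> (\<Sum>j\<le>n. z ^ q j *\<^sub>C Q z (A j x)) = C x"
  shows "(\<Sum>j\<le>n. moment \<omega> b (A j x) (k + q j)) = wedge_integral (power_family \<omega> (\<lambda>_. C x) b k)"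
proof -
  have Z: "\<omega> * (1 - ray t s) \<in> Z" if "s \<ge> 0" "\<bar>t\<bar> = \<eta>" for s t
    using \<omega> that by (simp add: on_contour_def)
  have ad: "admissible (power_family \<omega> (\<lambda>z. Q z y) b k)" for k y
    by (intro admissible_power_family \<omega> Q_cont Q_bound; assumption)
  have "(\<Sum>j\<le>n. moment \<omega> b (A j x) (k + q j)) =
      wedge_integral (\<lambda>v. \<Sum>j\<le>n. power_family \<omega> (\<lambda>z. Q z (A j x)) b (k + q j) v)"
    unfolding moment_def by (rule wedge_integral_sum[symmetric]) (use ad in auto)
  also have "\<dots> = wedge_integral (power_family \<omega> (\<lambda>_. C x) b k)"
  proof (rule wedge_integral_cong)
    fix s t :: real assume st: "s \<ge> 0" "\<bar>t\<bar> = \<eta>"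
    let ?z = "\<omega> * (1 - ray t s)"
    have "(\<Sum>j\<le>n. power_family \<omega> (\<lambda>z. Q z (A j x)) b (k + q j) (ray t s)) =
        (\<Sum>j\<le>n. (?z ^ k / ?z ^ b) *\<^sub>C (?z ^ q j *\<^sub>C Q ?z (A j x)))"
      unfolding power_family_def scaleC_scaleC
      by (intro sum.cong refl arg_cong2[where f="(*\<^sub>C)"]) (simp add: power_add mult_ac)
    also have "\<dots> = (?z ^ k / ?z ^ b) *\<^sub>C C x"
      by (simp only: x[OF Z[OF st]] flip: cvs.scale_sum_right)
    finally show "(\<Sum>j\<le>n. power_family \<omega> (\<lambda>z. Q z (A j x)) b (k + q j) (ray t s)) =
        power_family \<omega> (\<lambda>_. C x) b k (ray t s)"
      by (simp add: power_family_def)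
  qed
  finally show ?thesis .
qed

text \<open>The constant does not depend on $\omega$: on the contour $|\lambda| \ge |\omega| \sin\eta$, and the weight is
  the same for all dilations.\<close>

lemma power_family_integral_le:
  "\<exists>K>0. \<forall>\<omega> \<Psi> b k p B. on_contour \<omega> \<longrightarrow> continuous_seminorm p \<longrightarrow>
      admissible (power_family \<omega> \<Psi> b k) \<longrightarrow> B \<ge> 0 \<longrightarrow>
      (\<forall>z\<in>Z. cmod z \<ge> cmod \<omega> * sin \<eta> \<longrightarrow> cmod (z ^ k / z ^ b) * p (\<Psi> z) \<le> B) \<longrightarrow>
      p (wedge_integral (power_family \<omega> \<Psi> b k)) \<le> K * B"
proof -
  obtain K where K: "K > 0" "\<And>s. s \<ge> 0 \<Longrightarrow> (1 + s) ^ 2 * exp (- decay * s powr \<gamma>) \<le> K"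
    using poly_decay_bounded by blast
  show ?thesis
  proof (intro exI[of _ "2 * K"] conjI allI impI)
    fix \<omega> \<Psi> b k and p :: "'a \<Rightarrow> real" and B
    assume \<omega>: "on_contour \<omega>" and p: "continuous_seminorm p" and ad: "admissible (power_family \<omega> \<Psi> b k)"
      and B: "B \<ge> 0" and bd: "\<forall>z\<in>Z. cmod z \<ge> cmod \<omega> * sin \<eta> \<longrightarrow> cmod (z ^ k / z ^ b) * p (\<Psi> z) \<le> B"
    have "p (wedge_integral (power_family \<omega> \<Psi> b k)) \<le> 2 * (K * B)"
    proof (rule seminorm_wedge_integral_le[OF p ad])
      fix s t :: real assume st: "s \<ge> 0" "\<bar>t\<bar> = \<eta>"
      let ?z = "\<omega> * (1 - ray t s)"
      have "?z \<in> Z" using \<omega> st by (simp add: on_contour_def)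
      moreover have "cmod ?z \<ge> cmod \<omega> * sin \<eta>"
        using norm_one_minus_ray_ge[OF st(2)] by (simp add: norm_mult mult_left_mono)
      ultimately have "p (power_family \<omega> \<Psi> b k (ray t s)) \<le> B"
        unfolding power_family_def seminorm_scaleC[OF p] by (rule bd[rule_format])
      then show "(1 + s)\<^sup>2 * exp (- decay * s powr \<gamma>) * p (power_family \<omega> \<Psi> b k (ray t s)) \<le> K * B"
        using K(2)[OF st(1)] K(1) B seminorm_nonneg[OF p] by (intro mult_mono) auto
    qed
    then show "p (wedge_integral (power_family \<omega> \<Psi> b k)) \<le> 2 * K * B" by simp
  qed (use K in auto)
qed

text \<open>The factor $\omega$ comes from the normalization of the residue. It is compensated because the
  integrand decays faster than $1/|\lambda|$.\<close>

lemma wedge_integral_tendsto_0: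
  assumes \<omega>: "\<And>m. on_contour (\<omega> m)" and lim: "filterlim (\<lambda>m. cmod (\<omega> m)) at_top sequentially"
    and ad: "\<And>m. admissible (power_family (\<omega> m) \<Psi> b k)" and \<rho>: "\<rho> > 1"
    and bd: "\<And>p. continuous_seminorm p \<Longrightarrow> \<exists>B\<ge>0. \<forall>z\<in>Z. cmod z \<ge> 1 \<longrightarrow> cmod (z ^ k / z ^ b) * p (\<Psi> z) \<le> B * cmod z powr (- \<rho>)"
  shows "(\<lambda>m. (\<omega> m / residue_const) *\<^sub>C wedge_integral (power_family (\<omega> m) \<Psi> b k)) \<longlonglongrightarrow> 0"
  unfolding tendsto_seminorm
proof (intro allI impI)
  fix p :: "'a \<Rightarrow> real" assume p: "continuous_seminorm p"
  obtain B where B: "B \<ge> 0" "\<And>z. z \<in> Z \<Longrightarrow> cmod z \<ge> 1 \<Longrightarrow> cmod (z ^ k / z ^ b) * p (\<Psi> z) \<le> B * cmod z powr (- \<rho>)"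
    using bd[OF p] by blast
  obtain K where K: "K > 0" and K_le: "\<forall>\<omega> \<Psi> b k p B. on_contour \<omega> \<longrightarrow> continuous_seminorm p \<longrightarrow>
      admissible (power_family \<omega> \<Psi> b k) \<longrightarrow> B \<ge> 0 \<longrightarrow>
      (\<forall>z\<in>Z. cmod z \<ge> cmod \<omega> * sin \<eta> \<longrightarrow> cmod (z ^ k / z ^ b) * p (\<Psi> z) \<le> B) \<longrightarrow>
      p (wedge_integral (power_family \<omega> \<Psi> b k)) \<le> K * B"
    using power_family_integral_le by (elim exE conjE)
  let ?c = "cmod residue_const"
  let ?M = "1 / ?c * (K * B * sin \<eta> powr (- \<rho>))"
  show "(\<lambda>m. p ((\<omega> m / residue_const) *\<^sub>C wedge_integral (power_family (\<omega> m) \<Psi> b k) - 0)) \<longlonglongrightarrow> 0"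
  proof (rule Lim_null_comparison)
    have "\<forall>\<^sub>F m in sequentially. cmod (\<omega> m) \<ge> 1 / sin \<eta>"
      using lim unfolding filterlim_at_top by blast
    then show "\<forall>\<^sub>F m in sequentially.
        norm (p ((\<omega> m / residue_const) *\<^sub>C wedge_integral (power_family (\<omega> m) \<Psi> b k) - 0)) \<le> ?M * cmod (\<omega> m) powr (1 - \<rho>)"
    proof eventually_elim
      case (elim m)
      let ?d = "cmod (\<omega> m) * sin \<eta>"
      have w0: "cmod (\<omega> m) > 0" using \<omega>[of m] by (simp add: on_contour_def)
      have d1: "?d \<ge> 1" using elim sin_\<eta>_pos by (simp add: divide_le_eq)
      have "p (wedge_integral (power_family (\<omega> m) \<Psi> b k)) \<le> K * (B * ?d powr (- \<rho>))"
      proof (rule K_le[rule_format, OF \<omega> p ad])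
        fix z assume z: "z \<in> Z" "?d \<le> cmod z"
        then have z1: "cmod z \<ge> 1" using d1 by linarith
        have "cmod (z ^ k / z ^ b) * p (\<Psi> z) \<le> B * cmod z powr (- \<rho>)" by (rule B(2)[OF z(1) z1])
        also have "\<dots> \<le> B * ?d powr (- \<rho>)"
          using z d1 \<rho> B(1) by (intro mult_left_mono powr_mono2') auto
        finally show "cmod (z ^ k / z ^ b) * p (\<Psi> z) \<le> B * ?d powr (- \<rho>)" .
      qed (use B in simp)
      then have "cmod (\<omega> m / residue_const) * p (wedge_integral (power_family (\<omega> m) \<Psi> b k))
          \<le> cmod (\<omega> m / residue_const) * (K * (B * ?d powr (- \<rho>)))" by (intro mult_left_mono) auto
      also have "?d powr (- \<rho>) = cmod (\<omega> m) powr (- \<rho>) * sin \<eta> powr (- \<rho>)"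
        using sin_\<eta>_pos by (simp add: powr_mult)
      also have "cmod (\<omega> m / residue_const) * (K * (B * (cmod (\<omega> m) powr (- \<rho>) * sin \<eta> powr (- \<rho>))))
          = ?M * (cmod (\<omega> m) powr 1 * cmod (\<omega> m) powr (- \<rho>))"
        using w0 by (simp add: norm_divide)
      also have "cmod (\<omega> m) powr 1 * cmod (\<omega> m) powr (- \<rho>) = cmod (\<omega> m) powr (1 - \<rho>)"
        by (simp only: powr_add[symmetric]) simp
      finally show ?case
        using seminorm_nonneg[OF p] by (simp add: seminorm_scaleC[OF p])
    qed
    have "((\<lambda>x. x powr (1 - \<rho>)) \<longlongrightarrow> 0) at_top"
      by (rule tendsto_neg_powr) (use \<rho> in \<open>auto intro: filterlim_ident\<close>)
    then have "(\<lambda>m. cmod (\<omega> m) powr (1 - \<rho>)) \<longlonglongrightarrow> 0" using lim by (rule filterlim_compose)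
    then show "(\<lambda>m. ?M * cmod (\<omega> m) powr (1 - \<rho>)) \<longlonglongrightarrow> 0" by (rule tendsto_mult_right_zero)
  qed
qed

lemma residue_const_nonzero: "residue_const \<noteq> 0"
  by (simp add: residue_const_def)

text \<open>The indices \<open>j\<close> with \<open>q j \<ge> w + 1\<close> are those for which the moments satisfy the recurrence. The full
  sum over \<open>j\<close> is a moment of the constant vector \<open>C x\<close>, and so the initial values differ from the
  wanted ones by the moments with \<open>q j \<le> w\<close>, which tend to zero.\<close>

lemma approximating_solution_seq:
  assumes \<omega>: "\<And>m. on_contour (\<omega> m)" and lim: "filterlim (\<lambda>m. cmod (\<omega> m)) at_top sequentially"
    and x: "\<And>z. z \<in> Z \<Longrightarrow> (\<Sum>j\<le>n. z ^ q j *\<^sub>C Q z (A j x)) = C x"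
    and \<nu>: "\<nu> < 0" "\<And>j. j \<le> n \<Longrightarrow> q j \<le> w \<Longrightarrow> real N - 1 + real (q j) - real w + \<nu> < 0"
    and Q\<nu>: "\<And>p y. continuous_seminorm p \<Longrightarrow> \<exists>B\<ge>0. \<forall>z\<in>Z. p (Q z y) \<le> B * (1 + cmod z) powr \<nu>"
  shows "\<exists>X. (\<forall>m::nat. solution_seq n q D A \<zeta> (X m)) \<and>
    (\<forall>k<N. (\<lambda>m. X m k) \<longlonglongrightarrow> (if k = w then C x else 0))"
proof -
  define c where "c m = \<omega> m / residue_const" for m
  define S where "S = {j \<in> {..n}. q j \<ge> w + 1}"
  define X where "X m k = (\<Sum>j\<in>S. c m *\<^sub>C moment (\<omega> m) (w + 1) (A j x) (k + q j))" for m k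
  have w0: "\<omega> m \<noteq> 0" for m using \<omega>[of m] by (simp add: on_contour_def)
  have sol: "solution_seq n q D A \<zeta> (X m)" for m
    unfolding X_def
    by (rule solution_seq_lincomb[OF closed_A]) (auto simp: S_def intro!: solution_seq_moment[OF \<omega>])
  have adc: "admissible (power_family (\<omega> m) (\<lambda>_. y) b k)" for m b k y
    by (rule admissible_power_family[OF \<omega>]) (auto intro: const_bound)
  have adQ: "admissible (power_family (\<omega> m) (\<lambda>z. Q z y) b k)" for m b k y
    by (intro admissible_power_family \<omega> Q_cont Q_bound; assumption)
  have split: "X m k = c m *\<^sub>C wedge_integral (power_family (\<omega> m) (\<lambda>_. C x) (w + 1) k)
      - (\<Sum>j\<in>{..n} - S. c m *\<^sub>C moment (\<omega> m) (w + 1) (A j x) (k + q j))" for m k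
  proof -
    have "c m *\<^sub>C (\<Sum>j\<le>n. moment (\<omega> m) (w + 1) (A j x) (k + q j)) =
        (\<Sum>j\<in>{..n} - S. c m *\<^sub>C moment (\<omega> m) (w + 1) (A j x) (k + q j)) + X m k"
      unfolding X_def cvs.scale_sum_right by (rule sum.subset_diff) (auto simp: S_def)
    moreover have "(\<Sum>j\<le>n. moment (\<omega> m) (w + 1) (A j x) (k + q j)) = wedge_integral (power_family (\<omega> m) (\<lambda>_. C x) (w + 1) k)"
      by (rule moment_sum[OF \<omega> x])
    ultimately show ?thesis by (simp add: algebra_simps)
  qed
  have main: "(\<lambda>m. c m *\<^sub>C wedge_integral (power_family (\<omega> m) (\<lambda>_. y) (w + 1) k)) \<longlonglongrightarrow> (if k = w then y else 0)" for k y
  proof -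
    consider "k = w" | "k \<ge> w + 1" | "k < w" by linarith
    then show ?thesis
    proof cases
      case 1
      then show ?thesis
        using const_moment(2)[OF \<omega>, of _ y w] w0 residue_const_nonzero
        by (simp add: c_def scaleC_scaleC scaleC_one)
    next
      case 2
      then obtain l where "k = w + 1 + l" using le_Suc_ex by blast
      then show ?thesis using const_moment(1)[OF \<omega>, of _ y "w + 1" l] by simp
    next
      case 3
      show ?thesis
        unfolding c_def
      proof (subst if_not_P, use 3 in simp, rule wedge_integral_tendsto_0[OF \<omega> lim adc, of 2])
        fix p :: "'a \<Rightarrow> real" assume p: "continuous_seminorm p"
        show "\<exists>B\<ge>0. \<forall>z\<in>Z. cmod z \<ge> 1 \<longrightarrow> cmod (z ^ k / z ^ (w + 1)) * p y \<le> B * cmod z powr (- 2)"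
        proof (intro exI[of _ "p y"] conjI ballI impI)
          fix z assume z: "cmod z \<ge> 1"
          have "cmod z ^ k * cmod z ^ 2 \<le> cmod z ^ (w + 1)"
            unfolding power_add[symmetric] using z 3 by (intro power_increasing) auto
          then have "cmod (z ^ k / z ^ (w + 1)) \<le> 1 / cmod z ^ 2"
            using z by (simp add: norm_divide norm_mult norm_power divide_le_eq le_divide_eq field_simps)
          also have "\<dots> = cmod z powr (- 2)" using z by (simp add: powr_minus powr_numeral divide_inverse)
          finally show "cmod (z ^ k / z ^ (w + 1)) * p y \<le> p y * cmod z powr (- 2)"
            using seminorm_nonneg[OF p] by (simp add: mult.commute mult_left_mono)
        qed (rule seminorm_nonneg[OF p])
      qed simp
    qed
  qed
  have rest: "(\<lambda>m. c m *\<^sub>C moment (\<omega> m) (w + 1) y (k + q j)) \<longlonglongrightarrow> 0"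
    if k: "k < N" and j: "j \<le> n" "q j \<le> w" for k j y
    unfolding moment_def c_def
  proof (rule wedge_integral_tendsto_0[OF \<omega> lim adQ])
    define e where "e = real N - 1 + real (q j) - real w + \<nu>"
    have e: "e < 0" using \<nu>(2)[OF j] by (simp add: e_def)
    then show "1 - e > 1" by simp
    fix p :: "'a \<Rightarrow> real" assume p: "continuous_seminorm p"
    obtain B where B: "B \<ge> 0" "\<And>z. z \<in> Z \<Longrightarrow> p (Q z y) \<le> B * (1 + cmod z) powr \<nu>" using Q\<nu>[OF p] by blast
    show "\<exists>B\<ge>0. \<forall>z\<in>Z. cmod z \<ge> 1 \<longrightarrow> cmod (z ^ (k + q j) / z ^ (w + 1)) * p (Q z y) \<le> B * cmod z powr (- (1 - e))"
    proof (intro exI[of _ B] conjI ballI impI)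
      fix z assume zZ: "z \<in> Z" and z: "cmod z \<ge> 1"
      have "p (Q z y) \<le> B * (1 + cmod z) powr \<nu>" by (rule B(2)[OF zZ])
      also have "\<dots> \<le> B * cmod z powr \<nu>" using B(1) z \<nu>(1) by (intro mult_left_mono powr_mono2') auto
      finally have pQ: "p (Q z y) \<le> B * cmod z powr \<nu>" .
      have "cmod (z ^ (k + q j) / z ^ (w + 1)) = cmod z powr (real (k + q j) - real (w + 1))"
        using z by (simp only: norm_divide norm_power powr_diff) (simp only: powr_realpow)
      then have "cmod (z ^ (k + q j) / z ^ (w + 1)) * p (Q z y) \<le> cmod z powr (real (k + q j) - real (w + 1)) * (B * cmod z powr \<nu>)"
        using pQ by (simp add: mult_left_mono)
      also have "\<dots> = B * cmod z powr (real (k + q j) - real (w + 1) + \<nu>)"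
        by (simp add: powr_add)
      also have "\<dots> \<le> B * cmod z powr (- (1 - e))"
        using B(1) z k by (intro mult_left_mono powr_mono) (auto simp: e_def)
      finally show "cmod (z ^ (k + q j) / z ^ (w + 1)) * p (Q z y) \<le> B * cmod z powr (- (1 - e))" .
    qed (rule B(1))
  qed
  have "(\<lambda>m. X m k) \<longlonglongrightarrow> (if k = w then C x else 0)" if k: "k < N" for k
  proof -
    have "(\<lambda>m. \<Sum>j\<in>{..n} - S. c m *\<^sub>C moment (\<omega> m) (w + 1) (A j x) (k + q j)) \<longlonglongrightarrow> (\<Sum>j\<in>{..n} - S. 0)"
      by (intro tendsto_sum rest k) (auto simp: S_def)
    from tendsto_diff[OF main[of "C x" k] this] show ?thesis unfolding split by simp
  qed
  then show ?thesis using sol by blast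
qed

end

section \<open>The contour lies in the sector\<close>

text \<open>Since $1 - s e^{i\eta} = 1 + s e^{-i(\pi-\eta)}$, its argument is at most $\pi-\eta$ in absolute
  value. This is shown by comparing cosines.\<close>

lemma one_minus_ray_in_sector:
  assumes \<eta>: "0 < \<eta>" "\<eta> < pi" and t: "\<bar>t\<bar> = \<eta>" and s: "s \<ge> 0" and \<alpha>: "pi - \<eta> < \<alpha>" "\<alpha> < pi"
  shows "1 - ray t s \<in> sector \<alpha>"
proof -
  let ?z = "1 - ray t s"
  have sin: "sin \<eta> > 0" using \<eta> by (intro sin_gt_zero) auto
  have z0: "?z \<noteq> 0"
  proof
    assume "?z = 0"
    then have "s * sin t = 0" "s * cos t = 1" by (auto simp: ray_def complex_eq_iff)
    then show False using sin t by (auto simp: abs_if split: if_splits)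
  qed
  define c where "c = cos (pi - \<eta>)"
  have "cos t = cos \<eta>" using t by (metis cos_abs_real)
  then have Re: "Re ?z = 1 + s * c" by (simp add: ray_def c_def)
  have "c * cmod ?z \<le> 1 + s * c"
  proof (cases "c \<ge> 0")
    case True
    have "cmod ?z \<le> 1 + s" using norm_triangle_ineq4[of 1 "ray t s"] s by (simp add: norm_ray)
    then have "c * cmod ?z \<le> c * (1 + s)" using True by (rule mult_left_mono)
    also have "\<dots> \<le> 1 + s * c" using cos_le_one[of "pi - \<eta>"] by (simp add: algebra_simps c_def)
    finally show ?thesis .
  next
    case False
    have "s - 1 \<le> cmod ?z" using norm_triangle_ineq2[of "ray t s" 1] s by (simp add: norm_ray norm_minus_commute)
    then have "c * cmod ?z \<le> c * (s - 1)" using False by (intro mult_left_mono_neg) auto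
    also have "\<dots> \<le> 1 + s * c" using cos_ge_minus_one[of "pi - \<eta>"] by (simp add: algebra_simps c_def)
    finally show ?thesis .
  qed
  also have "1 + s * c = cos (Arg ?z) * cmod ?z"
    using arg_cong[OF rcis_cmod_Arg[of ?z], of Re] Re by (simp add: mult.commute)
  finally have "c \<le> cos \<bar>Arg ?z\<bar>" using z0 by simp
  moreover have "cos \<alpha> < c" unfolding c_def using \<eta> \<alpha> by (intro cos_monotone_0_pi) auto
  ultimately have "cos \<alpha> < cos \<bar>Arg ?z\<bar>" by linarith
  then have "\<bar>Arg ?z\<bar> < \<alpha>"
    using \<eta> \<alpha> mpi_less_Arg[of ?z] Arg_le_pi[of ?z] by (subst (asm) cos_mono_less_eq) auto
  then show ?thesis using z0 by (simp add: sector_def)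
qed

lemma one_minus_ray_in_truncated_sector:
  assumes \<eta>: "0 < \<eta>" "\<eta> < pi" and t: "\<bar>t\<bar> = \<eta>" and s: "s \<ge> 0" and \<alpha>: "pi - \<eta> < \<alpha>" "\<alpha> < pi"
    and R: "R > 0" "r \<le> R * sin \<eta>" and norm: "sin \<eta> \<le> cmod (1 - ray t s)"
  shows "exp (\<i> * of_real \<phi>) * of_real R * (1 - ray t s) \<in> truncated_sector \<phi> \<alpha> r"
proof -
  have "of_real R * (1 - ray t s) \<in> sector \<alpha>"
    using one_minus_ray_in_sector[OF \<eta> t s \<alpha>] R(1) by (simp add: sector_def)
  moreover have "r \<le> R * cmod (1 - ray t s)"
    using R norm by (meson less_imp_le mult_left_mono order_trans)
  ultimately show ?thesis
    unfolding truncated_sector_def using R(1) by (auto simp: norm_mult mult.assoc)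
qed

section \<open>Bounds from equicontinuity\<close>

lemma bounded_ops_sum_scaleC:
  assumes "T \<in> bounded_ops"
  shows "T (\<Sum>i\<in>I. c i *\<^sub>C x i) = (\<Sum>i\<in>I. c i *\<^sub>C T (x i))" "T (c' *\<^sub>C y) = c' *\<^sub>C T y"
proof -
  have T: "T (x + y) = T x + T y" "T (c *\<^sub>C x) = c *\<^sub>C T x" for x y c
    using assms by (auto simp: bounded_ops_def Vector_Spaces.linear_iff)
  show "T (c' *\<^sub>C y) = c' *\<^sub>C T y" by (rule T(2))
  have "T 0 = 0" using T(2)[of 0 0] by simp
  then show "T (\<Sum>i\<in>I. c i *\<^sub>C x i) = (\<Sum>i\<in>I. c i *\<^sub>C T (x i))"
    by (induction I rule: infinite_finite_induct) (auto simp: T)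
qed

text \<open>A neighbourhood of the origin absorbs every vector, so equicontinuity gives pointwise bounds,
  uniform over the family.\<close>

lemma equicontinuous_family_bound:
  assumes eq: "equicontinuous_family ((\<lambda>z x. c z *\<^sub>R T z x) ` Z)" and T: "\<And>z. z \<in> Z \<Longrightarrow> T z \<in> bounded_ops"
    and c: "\<And>z. c z \<ge> 0" and p: "continuous_seminorm p"
  shows "\<exists>B\<ge>0. \<forall>z\<in>Z. c z * p (T z x) \<le> B"
proof -
  obtain U where U: "open U" "0 \<in> U" "\<And>x. x \<in> U \<Longrightarrow> p x \<le> 1" using p unfolding continuous_seminorm_def by blast
  obtain V where V: "open V" "0 \<in> V" and V_U: "\<forall>S\<in>(\<lambda>z x. c z *\<^sub>R T z x) ` Z. S ` V \<subseteq> U"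
    using eq[unfolded equicontinuous_family_def, rule_format, OF conjI[OF U(1,2)]] by (elim exE conjE)
  have VU: "c z *\<^sub>R T z x \<in> U" if "z \<in> Z" "x \<in> V" for z x
    using bspec[OF V_U imageI[OF that(1)]] that(2) by blast
  have "((\<lambda>e. complex_of_real e *\<^sub>C x) \<longlongrightarrow> complex_of_real 0 *\<^sub>C x) (at_right 0)"
    by (intro tendsto_scaleC tendsto_of_real tendsto_ident_at tendsto_const)
  then have "\<forall>\<^sub>F e in at_right 0. complex_of_real e *\<^sub>C x \<in> V"
    by (rule topological_tendstoD) (use V in auto)
  moreover have "\<forall>\<^sub>F e in at_right (0::real). e > 0" by (simp add: eventually_at_right_less)
  ultimately have "\<forall>\<^sub>F e in at_right (0::real). complex_of_real e *\<^sub>C x \<in> V \<and> e > 0" by (rule eventually_conj)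
  then obtain e where e: "complex_of_real e *\<^sub>C x \<in> V" "e > 0"
    using eventually_happens'[OF trivial_limit_at_right_real] by blast
  show ?thesis
  proof (intro exI[of _ "1 / e"] conjI ballI)
    fix z assume z: "z \<in> Z"
    have "p (c z *\<^sub>R T z (complex_of_real e *\<^sub>C x)) \<le> 1" by (rule U(3)[OF VU[OF z e(1)]])
    then have "c z * (e * p (T z x)) \<le> 1"
      using c[of z] e(2) by (simp add: bounded_ops_sum_scaleC(2)[OF T[OF z]] seminorm_scaleR[OF p] seminorm_scaleC[OF p])
    then show "c z * p (T z x) \<le> 1 / e" using e(2) by (simp add: field_simps)
  qed (use e in auto)
qed

lemma poly_bound_sum:
  fixes g :: "'i \<Rightarrow> complex \<Rightarrow> real"
  assumes "finite I" "\<And>i. i \<in> I \<Longrightarrow> \<exists>B N. \<forall>z\<in>Z. g i z \<le> B * (1 + cmod z) ^ N"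
  shows "\<exists>B N. \<forall>z\<in>Z. (\<Sum>i\<in>I. g i z) \<le> B * (1 + cmod z) ^ N"
  using assms
proof (induction I rule: finite_induct)
  case empty
  show ?case by (rule exI[of _ 0]) simp
next
  case (insert i I)
  have "\<exists>B N. \<forall>z\<in>Z. (\<Sum>i\<in>I. g i z) \<le> B * (1 + cmod z) ^ N"
    by (rule insert.IH) (rule insert.prems, simp)
  then obtain B N where B: "\<And>z. z \<in> Z \<Longrightarrow> (\<Sum>i\<in>I. g i z) \<le> B * (1 + cmod z) ^ N" by blast
  have "\<exists>B N. \<forall>z\<in>Z. g i z \<le> B * (1 + cmod z) ^ N" by (rule insert.prems) simp
  then obtain B' N' where B': "\<And>z. z \<in> Z \<Longrightarrow> g i z \<le> B' * (1 + cmod z) ^ N'" by blast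
  have up: "b * (1 + cmod z) ^ m \<le> \<bar>b\<bar> * (1 + cmod z) ^ (N + N')" if "m \<le> N + N'" for b m z
  proof -
    have "b * (1 + cmod z) ^ m \<le> \<bar>b\<bar> * (1 + cmod z) ^ m" by (intro mult_right_mono) auto
    also have "\<dots> \<le> \<bar>b\<bar> * (1 + cmod z) ^ (N + N')" using that by (intro mult_left_mono power_increasing) auto
    finally show ?thesis .
  qed
  show ?case
  proof (intro exI[of _ "\<bar>B'\<bar> + \<bar>B\<bar>"] exI[of _ "N + N'"] ballI)
    fix z assume z: "z \<in> Z"
    have "(\<Sum>i\<in>insert i I. g i z) = g i z + (\<Sum>i\<in>I. g i z)" using insert.hyps by simp
    also have "\<dots> \<le> \<bar>B'\<bar> * (1 + cmod z) ^ (N + N') + \<bar>B\<bar> * (1 + cmod z) ^ (N + N')"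
      by (intro add_mono order_trans[OF B'[OF z]] order_trans[OF B[OF z]] up) auto
    finally show "(\<Sum>i\<in>insert i I. g i z) \<le> (\<bar>B'\<bar> + \<bar>B\<bar>) * (1 + cmod z) ^ (N + N')" by (simp add: distrib_right)
  qed
qed

lemma poly_bound_powr:
  assumes "\<exists>B\<ge>0. \<forall>z\<in>Z. (1 + cmod z) powr (- \<nu>) * g z \<le> B"
  shows "\<exists>B\<ge>0. \<forall>z\<in>Z. g z \<le> B * (1 + cmod z) powr \<nu>"
proof -
  obtain B where B: "B \<ge> 0" "\<And>z. z \<in> Z \<Longrightarrow> (1 + cmod z) powr (- \<nu>) * g z \<le> B" using assms by blast
  have "g z \<le> B * (1 + cmod z) powr \<nu>" if z: "z \<in> Z" for z
  proof -
    have pos: "1 + cmod z > 0" using norm_ge_zero[of z] by linarith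
    have "(1 + cmod z) powr \<nu> * ((1 + cmod z) powr (- \<nu>) * g z) \<le> (1 + cmod z) powr \<nu> * B"
      by (intro mult_left_mono B z) auto
    moreover have "(1 + cmod z) powr \<nu> * (1 + cmod z) powr (- \<nu>) = 1"
      using pos by (simp flip: powr_add)
    ultimately show ?thesis by (simp only: mult.assoc[symmetric]) (simp add: mult.commute)
  qed
  then show ?thesis using B(1) by blast
qed

lemma poly_bound_nat:
  assumes "\<exists>B\<ge>0. \<forall>z\<in>Z. g z \<le> B * (1 + cmod z) powr \<nu>"
  shows "\<exists>B N. \<forall>z\<in>Z. g z \<le> B * (1 + cmod z) ^ N"
proof -
  obtain B where B: "B \<ge> 0" "\<And>z. z \<in> Z \<Longrightarrow> g z \<le> B * (1 + cmod z) powr \<nu>" using assms by blast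
  define N where "N = nat \<lceil>\<nu>\<rceil>"
  have "g z \<le> B * (1 + cmod z) ^ N" if z: "z \<in> Z" for z
  proof -
    have pos: "1 + cmod z > 0" using norm_ge_zero[of z] by linarith
    have "\<nu> \<le> real N" unfolding N_def by linarith
    then have "(1 + cmod z) powr \<nu> \<le> (1 + cmod z) powr real N" by (intro powr_mono) auto
    also have "\<dots> = (1 + cmod z) ^ N" using pos by (rule powr_realpow)
    finally have "B * (1 + cmod z) powr \<nu> \<le> B * (1 + cmod z) ^ N" using B(1) by (rule mult_left_mono)
    then show ?thesis using B(2)[OF z] by linarith
  qed
  then show ?thesis by blast
qed

section \<open>The inverse of the pencil\<close>

text \<open>The hypotheses are kept in the form in which the final theorem has them.\<close>

locale pencil_hypotheses =
  fixes n :: nat and q :: "nat \<Rightarrow> nat"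
    and D :: "nat \<Rightarrow> 'a::complex_sclcs set" and A :: "nat \<Rightarrow> 'a \<Rightarrow> 'a" and C :: "'a \<Rightarrow> 'a"
    and \<zeta> \<phi> \<theta> r \<nu>' :: real
  assumes closed_A: "\<forall>i\<le>n. closed_linear_operator (D i) (A i)"
    and C: "C \<in> bounded_ops"
    and commute: "\<forall>i\<le>n. \<forall>x\<in>D i. C x \<in> D i \<and> C (A i x) = A i (C x)"
    and \<zeta>: "0 < \<zeta>" "\<zeta> \<le> 2"
    and \<theta>: "\<theta> \<in> {pi - pi * \<zeta><..<pi - pi * \<zeta> / 2}"
    and r: "r > 0"
    and q_0: "q 0 = 0"
    and \<nu>': "\<nu>' < Min ((\<lambda>\<omega>. - (real (q n) - 1 - real \<omega>
                              + real (Max {q j | j. j \<in> {0..n} - {j \<in> {0..n}. int (q j) - 1 \<ge> int \<omega>}})))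
                      ` {0..q n - 1})"
    and i_defined: "\<forall>z\<in>truncated_sector \<phi> (\<zeta> * pi / 2 + \<theta>) r.
                      pencil_inv_defined n q D A C z \<and> pencil_inv n q D A C z \<in> bounded_ops"
    and i_equicontinuous: "equicontinuous_family
           ((\<lambda>z x. ((1 + norm z) powr (- \<nu>')) *\<^sub>R pencil_inv n q D A C z x)
              ` truncated_sector \<phi> (\<zeta> * pi / 2 + \<theta>) r)"
    and i_continuous: "\<forall>x. continuous_on (truncated_sector \<phi> (\<zeta> * pi / 2 + \<theta>) r)
           (\<lambda>z. ((1 + norm z) powr (- \<nu>')) *\<^sub>R pencil_inv n q D A C z x)"
    and ii_continuous: "\<forall>x. \<forall>i<n. continuous_on (truncated_sector \<phi> (\<zeta> * pi / 2 + \<theta>) r)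
           (\<lambda>z. A i (pencil_inv n q D A C z x))"
    and ii_equicontinuous: "\<forall>i<n. \<exists>v::nat. v \<ge> 1 \<and>
           (\<forall>z\<in>truncated_sector \<phi> (\<zeta> * pi / 2 + \<theta>) r.
              (\<lambda>x. A i (pencil_inv n q D A C z x)) \<in> bounded_ops) \<and>
           equicontinuous_family
             ((\<lambda>z x. ((1 + norm z) powr (- real v)) *\<^sub>R A i (pencil_inv n q D A C z x))
                ` truncated_sector \<phi> (\<zeta> * pi / 2 + \<theta>) r)"
begin

abbreviation Z :: "complex set" where "Z \<equiv> truncated_sector \<phi> (\<zeta> * pi / 2 + \<theta>) r"

abbreviation Q :: "complex \<Rightarrow> 'a \<Rightarrow> 'a" where "Q \<equiv> pencil_inv n q D A C"

lemma pencil_eq_sum: "pencil n q A z x = (\<Sum>i\<le>n. z ^ q i *\<^sub>C A i x)"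
  by (simp add: pencil_def lessThan_Suc_atMost[symmetric] add.commute)

lemma Z_nonzero: "z \<in> Z \<Longrightarrow> z \<noteq> 0" and Z_norm: "z \<in> Z \<Longrightarrow> cmod z \<ge> r"
  using r by (auto simp: truncated_sector_def)

lemma Q_in_dom: "z \<in> Z \<Longrightarrow> Q z x \<in> pencil_dom n D"
  and pencil_Q: "z \<in> Z \<Longrightarrow> pencil n q A z (Q z x) = C x"
proof -
  assume z: "z \<in> Z"
  then have *: "C x \<in> pencil n q A z ` pencil_dom n D"
    using i_defined unfolding pencil_inv_defined_def by blast
  show "Q z x \<in> pencil_dom n D" unfolding pencil_inv_def by (rule inv_into_into[OF *])
  show "pencil n q A z (Q z x) = C x" unfolding pencil_inv_def by (rule f_inv_into_f[OF *])
qed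

text \<open>The operator \<open>C\<close> commutes with the pencil, which therefore may be applied before \<open>C\<close>.\<close>

lemma Q_pencil:
  assumes z: "z \<in> Z" and x: "x \<in> pencil_dom n D"
  shows "(\<Sum>j\<le>n. z ^ q j *\<^sub>C Q z (A j x)) = C x"
proof -
  have xD: "x \<in> D i" if "i \<le> n" for i using x that by (auto simp: pencil_dom_def)
  have Cx: "C x \<in> pencil_dom n D" using commute xD by (auto simp: pencil_dom_def)
  have inj: "inj_on (pencil n q A z) (pencil_dom n D)"
    using i_defined z unfolding pencil_inv_defined_def by blast
  have QB: "Q z \<in> bounded_ops" using i_defined z by blast
  have "(\<Sum>j\<le>n. z ^ q j *\<^sub>C Q z (A j x)) = Q z (pencil n q A z x)"
    unfolding pencil_eq_sum by (rule bounded_ops_sum_scaleC(1)[OF QB, symmetric])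
  also have "C (pencil n q A z x) = pencil n q A z (C x)"
    unfolding pencil_eq_sum bounded_ops_sum_scaleC(1)[OF C]
    by (rule sum.cong) (use commute xD in auto)
  then have "Q z (pencil n q A z x) = C x"
    unfolding pencil_inv_def using inv_into_f_f[OF inj Cx] by simp
  finally show ?thesis .
qed

lemma Q_bound_powr:
  assumes p: "continuous_seminorm p"
  shows "\<exists>B\<ge>0. \<forall>z\<in>Z. p (Q z x) \<le> B * (1 + cmod z) powr \<nu>'"
  by (rule poly_bound_powr, rule equicontinuous_family_bound[OF i_equicontinuous _ _ p])
     (use i_defined in auto)

lemma Q_continuous: "continuous_on Z (\<lambda>z. Q z x)"
proof -
  have pos: "1 + cmod z > 0" for z :: complex using norm_ge_zero[of z] by linarith
  have "continuous_on Z (\<lambda>z. complex_of_real ((1 + cmod z) powr \<nu>') *\<^sub>C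
      (((1 + norm z) powr (- \<nu>')) *\<^sub>R Q z x))"
    using i_continuous pos
    by (intro continuous_on_scaleC continuous_intros continuous_on_powr) (auto simp: less_imp_neq[OF pos, symmetric])
  moreover have "complex_of_real ((1 + cmod z) powr \<nu>') *\<^sub>C (((1 + norm z) powr (- \<nu>')) *\<^sub>R Q z x) = Q z x" for z
  proof -
    have "(1 + cmod z) powr \<nu>' * (1 + norm z) powr (- \<nu>') = 1" using pos[of z] by (simp flip: powr_add)
    then show ?thesis by (simp add: scaleR_scaleC scaleC_scaleC scaleC_one flip: of_real_mult)
  qed
  ultimately show ?thesis by simp
qed

lemma AQ_bound_less:
  assumes p: "continuous_seminorm p" and i: "i < n"
  shows "\<exists>B N. \<forall>z\<in>Z. p (A i (Q z x)) \<le> B * (1 + cmod z) ^ N"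
proof -
  obtain v :: nat where v: "\<And>z. z \<in> Z \<Longrightarrow> (\<lambda>x. A i (Q z x)) \<in> bounded_ops"
    "equicontinuous_family ((\<lambda>z x. ((1 + norm z) powr (- real v)) *\<^sub>R A i (Q z x)) ` Z)"
    using ii_equicontinuous i by blast
  show ?thesis
    by (rule poly_bound_nat, rule poly_bound_powr,
        rule equicontinuous_family_bound[where T="\<lambda>z x. A i (Q z x)", OF v(2,1) _ p]) auto
qed

text \<open>The leading operator \<open>A n\<close> is not covered by the second hypothesis, but the equation
  $P Q = C$ expresses $A_n Q$ by the others.\<close>

lemma A_top_eq:
  assumes z: "z \<in> Z"
  shows "A n (Q z x) = (1 / z ^ q n) *\<^sub>C (C x - (\<Sum>i<n. z ^ q i *\<^sub>C A i (Q z x)))"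
proof -
  have "z ^ q n *\<^sub>C A n (Q z x) = C x - (\<Sum>i<n. z ^ q i *\<^sub>C A i (Q z x))"
    using pencil_Q[OF z, of x] by (simp add: pencil_def algebra_simps)
  then have "(1 / z ^ q n) *\<^sub>C (z ^ q n *\<^sub>C A n (Q z x)) = (1 / z ^ q n) *\<^sub>C (C x - (\<Sum>i<n. z ^ q i *\<^sub>C A i (Q z x)))"
    by simp
  then show ?thesis using Z_nonzero[OF z] by (simp add: scaleC_scaleC scaleC_one)
qed

lemma AQ_continuous:
  assumes i: "i \<le> n" shows "continuous_on Z (\<lambda>z. A i (Q z x))"
proof (cases "i < n")
  case False
  then have i: "i = n" using i by simp
  have "continuous_on Z (\<lambda>z. \<Sum>i<n. z ^ q i *\<^sub>C A i (Q z x))"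
    using ii_continuous unfolding continuous_on_def
    by (auto intro!: tendsto_sum tendsto_scaleC tendsto_intros)
  then have "continuous_on Z (\<lambda>z. (1 / z ^ q n) *\<^sub>C (C x - (\<Sum>i<n. z ^ q i *\<^sub>C A i (Q z x))))"
    using Z_nonzero ii_continuous by (intro continuous_on_scaleC continuous_on_diff continuous_intros) auto
  then show ?thesis unfolding i by (rule continuous_on_eq) (rule A_top_eq[symmetric])
qed (use ii_continuous in blast)

lemma AQ_bound:
  assumes p: "continuous_seminorm p" and i: "i \<le> n"
  shows "\<exists>B N. \<forall>z\<in>Z. p (A i (Q z x)) \<le> B * (1 + cmod z) ^ N"
proof (cases "i < n")
  case True then show ?thesis by (rule AQ_bound_less[OF p])
next
  case False
  then have i: "i = n" using i by simp
  have "\<exists>B N. \<forall>z\<in>Z. cmod z ^ q j * p (A j (Q z x)) \<le> B * (1 + cmod z) ^ N" if j: "j < n" for j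
  proof -
    obtain B N where B: "\<And>z. z \<in> Z \<Longrightarrow> p (A j (Q z x)) \<le> B * (1 + cmod z) ^ N"
      using AQ_bound_less[OF p j] by blast
    have "cmod z ^ q j * p (A j (Q z x)) \<le> B * (1 + cmod z) ^ (q j + N)" if z: "z \<in> Z" for z
    proof -
      have "cmod z ^ q j * p (A j (Q z x)) \<le> (1 + cmod z) ^ q j * (B * (1 + cmod z) ^ N)"
        using seminorm_nonneg[OF p] by (intro mult_mono B z power_mono) auto
      then show ?thesis by (simp add: power_add mult_ac)
    qed
    then show ?thesis by blast
  qed
  then have "\<exists>B N. \<forall>z\<in>Z. (\<Sum>j\<in>{..<n}. cmod z ^ q j * p (A j (Q z x))) \<le> B * (1 + cmod z) ^ N"
    by (intro poly_bound_sum) auto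
  then obtain B N where B: "\<And>z. z \<in> Z \<Longrightarrow> (\<Sum>j<n. cmod z ^ q j * p (A j (Q z x))) \<le> B * (1 + cmod z) ^ N"
    by blast
  have "p (A n (Q z x)) \<le> (1 / r ^ q n * (p (C x) + \<bar>B\<bar>)) * (1 + cmod z) ^ N" if z: "z \<in> Z" for z
  proof -
    have "(\<Sum>j<n. p (z ^ q j *\<^sub>C A j (Q z x))) \<le> B * (1 + cmod z) ^ N"
      using B[OF z] by (simp add: seminorm_scaleC[OF p] norm_power)
    also have "\<dots> \<le> \<bar>B\<bar> * (1 + cmod z) ^ N" by (intro mult_right_mono) auto
    finally have S: "(\<Sum>j<n. p (z ^ q j *\<^sub>C A j (Q z x))) \<le> \<bar>B\<bar> * (1 + cmod z) ^ N" .
    have "p (C x) * 1 \<le> p (C x) * (1 + cmod z) ^ N"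
      by (intro mult_left_mono one_le_power seminorm_nonneg[OF p]) auto
    then have "p (C x) + (\<Sum>j<n. p (z ^ q j *\<^sub>C A j (Q z x))) \<le> (p (C x) + \<bar>B\<bar>) * (1 + cmod z) ^ N"
      using S by (simp add: distrib_right)
    moreover have "p (C x - (\<Sum>j<n. z ^ q j *\<^sub>C A j (Q z x))) \<le> p (C x) + (\<Sum>j<n. p (z ^ q j *\<^sub>C A j (Q z x)))"
      by (rule order_trans[OF seminorm_diff_le[OF p] add_left_mono[OF seminorm_sum[OF p]]])
    ultimately have X: "p (C x - (\<Sum>j<n. z ^ q j *\<^sub>C A j (Q z x))) \<le> (p (C x) + \<bar>B\<bar>) * (1 + cmod z) ^ N"
      by linarith
    have "1 / cmod z ^ q n \<le> 1 / r ^ q n"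
      using Z_norm[OF z] r by (intro divide_left_mono power_mono mult_pos_pos zero_less_power) auto
    then have "1 / cmod z ^ q n * p (C x - (\<Sum>j<n. z ^ q j *\<^sub>C A j (Q z x))) \<le>
        1 / r ^ q n * ((p (C x) + \<bar>B\<bar>) * (1 + cmod z) ^ N)"
      using X seminorm_nonneg[OF p] r by (intro mult_mono) auto
    then show ?thesis
      unfolding A_top_eq[OF z] seminorm_scaleC[OF p] by (simp add: norm_divide norm_power mult.assoc)
  qed
  then show ?thesis unfolding i by blast
qed

text \<open>The meaning of the condition on \<open>\<nu>'\<close>: every term with \<open>q j \<le> w\<close> that has to be discarded decays
  faster than $1/|\lambda|$ on the contour. The set below the maximum consists of the \<open>q j \<le> w\<close>.\<close>

lemma exponent_gap:
  assumes w: "w < q n"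
  shows "\<nu>' < 0" and "j \<le> n \<Longrightarrow> q j \<le> w \<Longrightarrow> real (q n) - 1 + real (q j) - real w + \<nu>' < 0"
proof -
  let ?S = "{q j | j. j \<in> {0..n} - {j \<in> {0..n}. int (q j) - 1 \<ge> int w}}"
  have S: "?S = q ` {j \<in> {0..n}. q j \<le> w}" by (auto simp: image_def)
  have fin: "finite ?S" unfolding S by simp
  have "w \<in> {0..q n - 1}" using w by auto
  then have "Min ((\<lambda>\<omega>. - (real (q n) - 1 - real \<omega>
      + real (Max {q j | j. j \<in> {0..n} - {j \<in> {0..n}. int (q j) - 1 \<ge> int \<omega>}}))) ` {0..q n - 1})
      \<le> - (real (q n) - 1 - real w + real (Max ?S))"
    by (intro Min_le) auto
  then have *: "\<nu>' < - (real (q n) - 1 - real w + real (Max ?S))" using \<nu>' by linarith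
  have "real (q n) - 1 - real w \<ge> 0" using w by linarith
  then show "\<nu>' < 0" using * by linarith
  assume "j \<le> n" "q j \<le> w"
  then have "q j \<le> Max ?S" by (intro Max_ge[OF fin]) (auto simp: S)
  then show "real (q n) - 1 + real (q j) - real w + \<nu>' < 0" using * by linarith
qed

text \<open>The sequences found for the single indices \<open>w\<close> are added up.\<close>

lemma solution_seqs_reach_initial_values:
  assumes x: "\<And>w. w < q n \<Longrightarrow> x w \<in> pencil_dom n D"
  shows "\<exists>X. (\<forall>m::nat. solution_seq n q D A \<zeta> (X m)) \<and> (\<forall>k<q n. (\<lambda>m. X m k) \<longlonglongrightarrow> C (x k))"
proof -
  define \<alpha> where "\<alpha> = \<zeta> * pi / 2 + \<theta>"
  have \<alpha>: "pi - \<alpha> < pi * \<zeta> / 2" "\<alpha> < pi" using \<theta> by (auto simp: \<alpha>_def algebra_simps)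
  \<comment> \<open>The rays must lie in the sector, and \<open>\<gamma> > 1 / \<zeta>\<close> with \<open>\<gamma> * \<eta> < pi / 2\<close> must exist; the bounds on \<open>\<theta>\<close> leave room for both.\<close>
  define \<eta> where "\<eta> = ((pi - \<alpha>) + pi * \<zeta> / 2) / 2"
  have "pi * \<zeta> \<le> pi * 2" using \<zeta> pi_gt_zero by (intro mult_left_mono) auto
  moreover have "0 < \<eta>" "pi - \<alpha> < \<eta>" "\<eta> < pi * \<zeta> / 2" using \<alpha> by (auto simp: \<eta>_def)
  ultimately have angle: "0 < \<eta>" "pi - \<alpha> < \<eta>" "\<eta> < pi * \<zeta> / 2" "\<eta> < pi" by linarith+
  define \<gamma> where "\<gamma> = (1 / \<zeta> + pi / (2 * \<eta>)) / 2"
  have lt: "1 / \<zeta> < pi / (2 * \<eta>)" using angle \<zeta> by (simp add: field_simps)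
  then have \<gamma>: "1 / \<zeta> < \<gamma>" "\<gamma> < pi / (2 * \<eta>)" by (auto simp: \<gamma>_def)
  have \<gamma>0: "\<gamma> > 0" using \<gamma>(1) \<zeta> by (meson divide_pos_pos less_trans zero_less_one)
  have "\<gamma> * \<eta> < pi / (2 * \<eta>) * \<eta>" using \<gamma>(2) angle(1) by (intro mult_strict_right_mono)
  then have \<gamma>\<eta>: "\<gamma> * \<eta> < pi / 2" using angle(1) by simp
  interpret wedge_resolvent \<eta> \<gamma> \<zeta> n q D A C Z Q
  proof unfold_locales
    show "Q z x \<in> D i" if "z \<in> Z" "i \<le> n" for z i x
      using Q_in_dom[OF that(1), of x] that(2) by (auto simp: pencil_dom_def)
    show "(\<Sum>i\<le>n. z ^ q i *\<^sub>C A i (Q z x)) = C x" if "z \<in> Z" for z x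
      using pencil_Q[OF that] by (simp add: pencil_eq_sum)
    show "\<exists>B N. \<forall>z\<in>Z. p (Q z x) \<le> B * (1 + cmod z) ^ N" if "continuous_seminorm p" for p x
      by (rule poly_bound_nat[OF Q_bound_powr[OF that]])
  qed (use angle \<gamma> \<gamma>0 \<gamma>\<eta> \<zeta> closed_A Q_continuous AQ_continuous AQ_bound in auto)
  \<comment> \<open>The distance of the contour from the origin is \<open>R m * sin \<eta> \<ge> r\<close>.\<close>
  define R where "R m = r / sin \<eta> + real m" for m
  define \<omega> where "\<omega> m = exp (\<i> * of_real \<phi>) * complex_of_real (R m)" for m
  have sin: "sin \<eta> > 0" using angle by (intro sin_gt_zero) auto
  have R: "R m > 0" "r \<le> R m * sin \<eta>" for m
  proof -
    show "R m > 0" using r sin by (simp add: R_def add_pos_nonneg)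
    show "r \<le> R m * sin \<eta>" using sin by (simp add: R_def distrib_right)
  qed
  have norm_\<omega>: "cmod (\<omega> m) = R m" for m using R(1)[of m] by (simp add: \<omega>_def norm_mult)
  have on: "on_contour (\<omega> m)" for m
    unfolding on_contour_def
  proof (intro conjI allI impI)
    show "\<omega> m \<noteq> 0" using norm_\<omega>[of m] R(1)[of m] by auto
    fix s t :: real assume s: "s \<ge> 0" and t: "\<bar>t\<bar> = \<eta>"
    have "pi - \<eta> < \<alpha>" using angle(2) by linarith
    from one_minus_ray_in_truncated_sector[OF angle(1,4) t s this \<alpha>(2) R norm_one_minus_ray_ge[OF t]]
    show "\<omega> m * (1 - ray t s) \<in> Z" by (simp only: \<omega>_def \<alpha>_def)
  qed
  have lim: "filterlim (\<lambda>m. cmod (\<omega> m)) at_top sequentially"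
    unfolding norm_\<omega> R_def by (intro filterlim_tendsto_add_at_top[OF tendsto_const] filterlim_real_sequentially)
  have "\<exists>X. (\<forall>m::nat. solution_seq n q D A \<zeta> (X m)) \<and>
    (\<forall>k<q n. (\<lambda>m. X m k) \<longlonglongrightarrow> (if k = w then C (x w) else 0))" if w: "w < q n" for w
    by (rule approximating_solution_seq[OF on lim Q_pencil[OF _ x[OF w]] exponent_gap[OF w] Q_bound_powr])
  then obtain X where X: "\<And>w m. w < q n \<Longrightarrow> solution_seq n q D A \<zeta> (X w m)"
    "\<And>w k. w < q n \<Longrightarrow> k < q n \<Longrightarrow> (\<lambda>m. X w m k) \<longlonglongrightarrow> (if k = w then C (x w) else 0)"
    by metis
  define Y where "Y m k = (\<Sum>w\<in>{..<q n}. 1 *\<^sub>C X w m k)" for m k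
  have "solution_seq n q D A \<zeta> (Y m)" for m
    unfolding Y_def using X(1) closed_A by (intro solution_seq_lincomb) auto
  moreover have "(\<lambda>m. Y m k) \<longlonglongrightarrow> C (x k)" if k: "k < q n" for k
  proof -
    have "(\<lambda>m. \<Sum>w<q n. X w m k) \<longlonglongrightarrow> (\<Sum>w<q n. if k = w then C (x w) else 0)"
      by (intro tendsto_sum X(2) k) auto
    then show ?thesis using k by (simp add: Y_def scaleC_one)
  qed
  ultimately show ?thesis by blast
qed

end

section \<open>Density of the initial values\<close>

lemma in_closure_of_power_topology:
  fixes f :: "nat \<Rightarrow> 'a::complex_sclcs"
  assumes f: "f \<in> {..<k} \<rightarrow>\<^sub>E UNIV" and g: "\<And>m::nat. restrict (g m) {..<k} \<in> W"
    and lim: "\<And>j. j < k \<Longrightarrow> (\<lambda>m. g m j) \<longlonglongrightarrow> f j"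
  shows "f \<in> power_topology k closure_of W"
proof -
  have "limitin (power_topology k) (\<lambda>m. restrict (g m) {..<k}) f sequentially"
    unfolding power_topology_def limitin_componentwise
    using f lim by (auto simp: PiE_def)
  then have top: "f \<in> topspace (power_topology k)"
    and ev: "\<And>U. openin (power_topology k) U \<Longrightarrow> f \<in> U \<Longrightarrow> \<forall>\<^sub>F m in sequentially. restrict (g m) {..<k} \<in> U"
    by (auto simp: limitin_def)
  show ?thesis
    unfolding in_closure_of
  proof (intro conjI top allI impI)
    fix T assume "f \<in> T \<and> openin (power_topology k) T"
    then have "\<forall>\<^sub>F m in sequentially. restrict (g m) {..<k} \<in> T" using ev by blast
    then obtain m where "restrict (g m) {..<k} \<in> T" unfolding eventually_sequentially by blast
    then show "\<exists>y. y \<in> W \<and> y \<in> T" using g by blast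
  qed
qed

context pencil_hypotheses
begin

lemma solution_seq_zero: "solution_seq n q D A \<zeta> (\<lambda>_. 0)"
  using solution_seq_lincomb[of n D A "{}"] closed_A by simp

text \<open>The two kinds of initial values are approached independently, each by a sequence of solution
  sequences.\<close>

lemma dense_in_power_of_solution_seqs:
  assumes sol: "\<And>x y w. solution_seq n q D A \<zeta> x \<Longrightarrow> solution_seq n q D A \<zeta> y \<Longrightarrow>
      w \<in> {..<initial_dim \<zeta> (q n)} \<rightarrow>\<^sub>E UNIV \<Longrightarrow> (\<And>j. j < q n \<Longrightarrow> w j = x j) \<Longrightarrow>
      (\<And>j. \<zeta> > 1 \<Longrightarrow> j < q n \<Longrightarrow> w (q n + j) = y j) \<Longrightarrow> w \<in> W"
  shows "dense_in_power (initial_dim \<zeta> (q n)) W (C ` pencil_dom n D)"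
  unfolding dense_in_power_def
proof
  let ?k = "initial_dim \<zeta> (q n)"
  fix f assume f: "f \<in> {..<?k} \<rightarrow>\<^sub>E C ` pencil_dom n D"
  then have "\<forall>j\<in>{..<?k}. \<exists>x\<in>pencil_dom n D. f j = C x" by (auto simp: PiE_def Pi_def)
  then obtain x where x: "\<And>j. j < ?k \<Longrightarrow> x j \<in> pencil_dom n D" "\<And>j. j < ?k \<Longrightarrow> f j = C (x j)" by (metis lessThan_iff)
  have k: "q n \<le> ?k" by (simp add: initial_dim_def)
  obtain X where X: "\<And>m::nat. solution_seq n q D A \<zeta> (X m)" "\<And>j. j < q n \<Longrightarrow> (\<lambda>m. X m j) \<longlonglongrightarrow> f j"
    using solution_seqs_reach_initial_values[of x] x k by (metis order_less_le_trans)
  obtain Y where Y: "\<And>m::nat. solution_seq n q D A \<zeta> (Y m)"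
    "\<And>j. \<zeta> > 1 \<Longrightarrow> j < q n \<Longrightarrow> (\<lambda>m. Y m j) \<longlonglongrightarrow> f (q n + j)"
  proof (cases "\<zeta> > 1")
    case True
    then have dim: "?k = 2 * q n" by (simp add: initial_dim_def)
    obtain Y where "\<And>m::nat. solution_seq n q D A \<zeta> (Y m)" "\<And>j. j < q n \<Longrightarrow> (\<lambda>m. Y m j) \<longlonglongrightarrow> C (x (q n + j))"
      using solution_seqs_reach_initial_values[of "\<lambda>j. x (q n + j)"] x(1) dim by auto
    then show ?thesis using x(2) dim by (intro that[of Y]) auto
  next
    case False
    then show ?thesis using solution_seq_zero by (intro that[of "\<lambda>_ _. 0"]) auto
  qed
  define g where "g m j = (if j < q n then X m j else Y m (j - q n))" for m j
  show "f \<in> power_topology ?k closure_of W"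
  proof (rule in_closure_of_power_topology)
    show "f \<in> {..<?k} \<rightarrow>\<^sub>E UNIV" using f by (auto simp: PiE_def)
    show "restrict (g m) {..<?k} \<in> W" for m
      by (rule sol[OF X(1)[of m] Y(1)[of m]]) (use k in \<open>auto simp: g_def initial_dim_def\<close>)
    show "(\<lambda>m. g m j) \<longlonglongrightarrow> f j" if j: "j < ?k" for j
    proof (cases "j < q n")
      case True then show ?thesis using X(2) by (simp add: g_def)
    next
      case False
      then have z: "\<zeta> > 1" using j by (auto simp: initial_dim_def split: if_splits)
      then have "j - q n < q n" using j False by (simp add: initial_dim_def)
      from Y(2)[OF z this] show ?thesis using False by (simp add: g_def)
    qed
  qed
qed

lemma analytical_values_dense:
  "dense_in_power (initial_dim \<zeta> (q n)) (analytical_values n q D A \<zeta>) (C ` pencil_dom n D)"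
proof (rule dense_in_power_of_solution_seqs)
  fix x y w
  assume *: "solution_seq n q D A \<zeta> x" "solution_seq n q D A \<zeta> y"
    "w \<in> {..<initial_dim \<zeta> (q n)} \<rightarrow>\<^sub>E UNIV" "\<And>j. j < q n \<Longrightarrow> w j = x j"
    "\<And>j. \<zeta> > 1 \<Longrightarrow> j < q n \<Longrightarrow> w (q n + j) = y j"
  show "w \<in> analytical_values n q D A \<zeta>"
    unfolding analytical_values_def using * analytical_solution_frac_sol[OF closed_A \<zeta> *(1,2,4,5)] by blast
qed

lemma entire_values_dense:
  assumes "\<zeta> = 1 \<or> \<zeta> = 2"
  shows "dense_in_power (initial_dim \<zeta> (q n)) (entire_values n q D A \<zeta>) (C ` pencil_dom n D)"
proof (rule dense_in_power_of_solution_seqs)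
  fix x y w
  assume *: "solution_seq n q D A \<zeta> x" "solution_seq n q D A \<zeta> y"
    "w \<in> {..<initial_dim \<zeta> (q n)} \<rightarrow>\<^sub>E UNIV" "\<And>j. j < q n \<Longrightarrow> w j = x j"
    "\<And>j. \<zeta> > 1 \<Longrightarrow> j < q n \<Longrightarrow> w (q n + j) = y j"
  show "w \<in> entire_values n q D A \<zeta>"
    unfolding entire_values_def using * entire_solution_frac_sol[OF closed_A \<zeta> assms *(1,2,4,5)] by blast
qed

end

theorem theorem2p2:
  fixes n :: nat and q :: "nat \<Rightarrow> nat"
    and D :: "nat \<Rightarrow> 'a::complex_sclcs set" and A :: "nat \<Rightarrow> 'a \<Rightarrow> 'a" and C :: "'a \<Rightarrow> 'a"
    and \<zeta> \<phi> \<theta> a r \<nu>' :: real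
  assumes n: "n \<ge> 1"
    and q: "q 0 = 0" "0 < q 1" "\<forall>i\<in>{1..<n}. q i \<le> q (Suc i)"
    and closed_A: "\<forall>i\<le>n. closed_linear_operator (D i) (A i)"
    and C: "C \<in> bounded_ops" "inj C"
    and commute: "\<forall>i\<le>n. \<forall>x\<in>D i. C x \<in> D i \<and> C (A i x) = A i (C x)"
    and \<zeta>: "0 < \<zeta>" "\<zeta> \<le> 2"
    and \<phi>: "\<phi> \<in> {-pi<..pi}"
    and \<theta>: "\<theta> \<in> {pi - pi * \<zeta><..<pi - pi * \<zeta> / 2}"
    and ar: "a > r" "r > 0"
    and \<nu>': "\<nu>' < Min ((\<lambda>\<omega>. - (real (q n) - 1 - real \<omega>
                              + real (Max {q j | j. j \<in> {0..n} - {j \<in> {0..n}. int (q j) - 1 \<ge> int \<omega>}})))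
                      ` {0..q n - 1})"
    and i_defined: "\<forall>z\<in>truncated_sector \<phi> (\<zeta> * pi / 2 + \<theta>) r.
                      pencil_inv_defined n q D A C z \<and> pencil_inv n q D A C z \<in> bounded_ops"
    and i_equicontinuous: "equicontinuous_family
           ((\<lambda>z x. ((1 + norm z) powr (- \<nu>')) *\<^sub>R pencil_inv n q D A C z x)
              ` truncated_sector \<phi> (\<zeta> * pi / 2 + \<theta>) r)"
    and i_continuous: "\<forall>x. continuous_on (truncated_sector \<phi> (\<zeta> * pi / 2 + \<theta>) r)
           (\<lambda>z. ((1 + norm z) powr (- \<nu>')) *\<^sub>R pencil_inv n q D A C z x)"
    and ii_continuous: "\<forall>x. \<forall>i<n. continuous_on (truncated_sector \<phi> (\<zeta> * pi / 2 + \<theta>) r)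
           (\<lambda>z. A i (pencil_inv n q D A C z x))"
    and ii_equicontinuous: "\<forall>i<n. \<exists>v::nat. v \<ge> 1 \<and>
           (\<forall>z\<in>truncated_sector \<phi> (\<zeta> * pi / 2 + \<theta>) r.
              (\<lambda>x. A i (pencil_inv n q D A C z x)) \<in> bounded_ops) \<and>
           equicontinuous_family
             ((\<lambda>z x. ((1 + norm z) powr (- real v)) *\<^sub>R A i (pencil_inv n q D A C z x))
                ` truncated_sector \<phi> (\<zeta> * pi / 2 + \<theta>) r)"
  shows "(0 < \<zeta> \<and> \<zeta> < 1 \<longrightarrow>
            dense_in_power (q n) (analytical_values n q D A \<zeta>) (C ` (\<Inter>j\<in>{0..n}. D j)))
       \<and> (1 < \<zeta> \<and> \<zeta> < 2 \<longrightarrow>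
            dense_in_power (2 * q n) (analytical_values n q D A \<zeta>) (C ` (\<Inter>j\<in>{0..n}. D j)))
       \<and> (\<zeta> = 1 \<longrightarrow>
            dense_in_power (q n) (entire_values n q D A \<zeta>) (C ` (\<Inter>j\<in>{0..n}. D j)))
       \<and> (\<zeta> = 2 \<longrightarrow>
            dense_in_power (2 * q n) (entire_values n q D A \<zeta>) (C ` (\<Inter>j\<in>{0..n}. D j)))"
proof -
  interpret pencil_hypotheses n q D A C \<zeta> \<phi> \<theta> r \<nu>'
    by unfold_locales (fact closed_A C(1) commute \<zeta> \<theta> ar(2) q(1) \<nu>' i_defined i_equicontinuous
        i_continuous ii_continuous ii_equicontinuous)+
  have dom: "(\<Inter>j\<in>{0..n}. D j) = pencil_dom n D" by (simp add: pencil_dom_def)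
  show ?thesis
    unfolding dom using analytical_values_dense entire_values_dense by (auto simp: initial_dim_def)
qed

end
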